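(* Let $p$ be an odd prime, let $K$ be a number field, and let $A$ be an abelian variety of dimension $g$ over $K$ such that $\widehat{\rho}$ has big image. Let $K_\infty/K$ be any Galois extension whose Galois group is a pro-$p$ group, and assume $A(K)$ has no $p$-torsion. Then the torsion subgroup of $A(K_\infty)$ is finite.
   Context: The adelic Galois representation $\widehat{\rho}:\mathrm{Gal}(\bar K/K)\to\mathrm{GSp}_{2g}(\widehat{\mathbb{Z}})$ is the Galois action on the full Tate module $T(A)=\varprojlim_m A[m]$ (with respect to a symplectic basis for the Weil pairing); with image $G$, $\widehat\rho$ has big image if $G\cap\mathrm{Sp}_{2g}(\widehat{\mathbb{Z}})$ has finite index in $\mathrm{Sp}_{2g}(\widehat{\mathbb{Z}})$. No assumption is made on the reduction type of $A$ at primes above $p$. *)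

theory Defs
  imports
    "HOL-Library.Poly_Mapping"
    "HOL-Analysis.T1_Spaces"
    "HOL-Algebra.Coset"
    "HOL-Algebra.Module"
    "HOL-Algebra.Subrings"
    "HOL-Algebra.Algebraic_Closure_Type"
    "Jordan_Normal_Form.Matrix"
begin

section \<open>Number fields and Galois groups\<close>

text \<open>
  A number field is a type \<open>'k\<close>, its algebraic closure is the library type \<open>'k alg_closure\<close>, and
  \<open>'k\<close> is identified with the subfield \<open>range to_ac\<close> of it. All algebraic extensions of \<open>'k\<close>
  are taken inside \<open>'k alg_closure\<close>.
\<close>

definition number_field :: "'k::field_char_0 itself \<Rightarrow> bool" where
  "number_field _ \<longleftrightarrow>
     (\<exists>B::'k set. finite B \<and> (\<forall>x. \<exists>c::'k \<Rightarrow> rat. x = (\<Sum>b\<in>B. of_rat (c b) * b)))"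

text \<open>
  Automorphisms of \<open>E\<close> are represented by functions that are extensional on \<open>E\<close>, so that equality
  of automorphisms is equality of functions. For \<open>E = UNIV\<close> these are all functions.
\<close>

definition Gal :: "'a::field set \<Rightarrow> 'a set \<Rightarrow> ('a \<Rightarrow> 'a) set" where
  "Gal E F = {\<sigma> \<in> extensional E. bij_betw \<sigma> E E \<and>
     (\<forall>x\<in>E. \<forall>y\<in>E. \<sigma> (x + y) = \<sigma> x + \<sigma> y \<and> \<sigma> (x * y) = \<sigma> x * \<sigma> y) \<and> (\<forall>x\<in>F. \<sigma> x = x)}"

definition gal_group :: "'a::field set \<Rightarrow> 'a set \<Rightarrow> ('a \<Rightarrow> 'a) monoid" where
  "gal_group E F = \<lparr>carrier = Gal E F, monoid.mult = compose E, one = (\<lambda>x\<in>E. x)\<rparr>"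

definition krull_topology :: "'a::field set \<Rightarrow> 'a set \<Rightarrow> ('a \<Rightarrow> 'a) topology" where
  "krull_topology E F = subtopology (product_topology (\<lambda>_. discrete_topology E) E) (Gal E F)"

definition galois_extension :: "'a::field set \<Rightarrow> 'a set \<Rightarrow> bool" where
  "galois_extension E F \<longleftrightarrow>
     subfield E ring_of_type_algebra \<and> subfield F ring_of_type_algebra \<and> F \<subseteq> E \<and>
     (\<forall>x\<in>E. \<exists>q. q \<noteq> 0 \<and> (\<forall>i. Polynomial.coeff q i \<in> F) \<and> Polynomial.poly q x = 0) \<and>
     {x \<in> E. \<forall>\<sigma>\<in>Gal E F. \<sigma> x = x} = F"

definition profinite_group :: "('g, 'b) monoid_scheme \<Rightarrow> 'g topology \<Rightarrow> bool" where
  "profinite_group G T \<longleftrightarrow> group G \<and> topspace T = carrier G \<and>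
     continuous_map (prod_topology T T) T (\<lambda>(x, y). x \<otimes>\<^bsub>G\<^esub> y) \<and> continuous_map T T (m_inv G) \<and>
     compact_space T \<and> Hausdorff_space T \<and> (\<forall>x\<in>carrier G. connected_component_of_set T x = {x})"

definition pro_p_group :: "nat \<Rightarrow> ('g, 'b) monoid_scheme \<Rightarrow> 'g topology \<Rightarrow> bool" where
  "pro_p_group p G T \<longleftrightarrow> profinite_group G T \<and>
     (\<forall>N. N \<lhd> G \<and> openin T N \<longrightarrow> (\<exists>k. card (rcosets\<^bsub>G\<^esub> N) = p ^ k))"


section \<open>Projective space and its Zariski topology\<close>

text \<open>
  Homogeneous coordinates are indexed by a finite type \<open>'n\<close> (so the projective space has dimension
  \<open>CARD('n) - 1\<close>), and a point is the set of all its homogeneous coordinate vectors.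
\<close>

type_synonym ('n, 'a) pt = "('n \<Rightarrow> 'a) set"
type_synonym ('v, 'a) mpoly = "('v \<Rightarrow>\<^sub>0 nat) \<Rightarrow>\<^sub>0 'a"

definition mp_eval :: "('v::finite, 'a::comm_semiring_1) mpoly \<Rightarrow> ('v \<Rightarrow> 'a) \<Rightarrow> 'a" where
  "mp_eval f x = (\<Sum>m\<in>Poly_Mapping.keys f. Poly_Mapping.lookup f m * (\<Prod>i\<in>UNIV. x i ^ Poly_Mapping.lookup m i))"

definition homogeneous :: "nat \<Rightarrow> ('v::finite, 'a::zero) mpoly \<Rightarrow> bool" where
  "homogeneous d f \<longleftrightarrow> (\<forall>m\<in>Poly_Mapping.keys f. (\<Sum>i\<in>UNIV. Poly_Mapping.lookup m i) = d)"

definition bihomogeneous :: "nat \<Rightarrow> nat \<Rightarrow> ('v::finite + 'w::finite, 'a::zero) mpoly \<Rightarrow> bool" where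
  "bihomogeneous d e f \<longleftrightarrow>
     (\<forall>m\<in>Poly_Mapping.keys f. (\<Sum>i\<in>UNIV. Poly_Mapping.lookup m (Inl i)) = d \<and> (\<Sum>i\<in>UNIV. Poly_Mapping.lookup m (Inr i)) = e)"

definition coeffs_in :: "'a::zero set \<Rightarrow> ('v, 'a) mpoly \<Rightarrow> bool" where
  "coeffs_in F f \<longleftrightarrow> (\<forall>m. Poly_Mapping.lookup f m \<in> F)"

definition proj_pt :: "('n \<Rightarrow> 'a::field) \<Rightarrow> ('n, 'a) pt" where
  "proj_pt v = {(\<lambda>i. c * v i) |c. c \<noteq> 0}"

definition proj_space :: "('n, 'a::field) pt set" where
  "proj_space = {proj_pt v |v. v \<noteq> (\<lambda>_. 0)}"

definition rational_points :: "'a set \<Rightarrow> ('n, 'a::field) pt set \<Rightarrow> ('n, 'a) pt set" where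
  "rational_points F V = {P \<in> V. \<exists>v\<in>P. range v \<subseteq> F}"

definition zariski :: "('n::finite, 'a::field) pt set \<Rightarrow> ('n, 'a) pt topology" where
  "zariski V = subtopology
     (topology_generated_by
        {{P \<in> proj_space. \<forall>v\<in>P. mp_eval f v \<noteq> 0} |f. \<exists>d. homogeneous d f}) V"

definition closed_over :: "'a set \<Rightarrow> ('n::finite, 'a::field) pt set \<Rightarrow> bool" where
  "closed_over F V \<longleftrightarrow> (\<exists>S. (\<forall>f\<in>S. coeffs_in F f \<and> (\<exists>d. homogeneous d f)) \<and>
     V = {P \<in> proj_space. \<forall>f\<in>S. \<forall>v\<in>P. mp_eval f v = 0})"

definition irreducible_closed :: "('n::finite, 'a::field) pt set \<Rightarrow> bool" where
  "irreducible_closed V \<longleftrightarrow> closedin (zariski proj_space) V \<and> V \<noteq> {} \<and>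
     (\<forall>Y Z. closedin (zariski V) Y \<and> closedin (zariski V) Z \<and> V = Y \<union> Z \<longrightarrow> Y = V \<or> Z = V)"

text \<open>Krull dimension: the supremum of the lengths of chains of irreducible closed subsets.\<close>

definition closed_chain :: "('n::finite, 'a::field) pt set \<Rightarrow> nat \<Rightarrow> (nat \<Rightarrow> ('n, 'a) pt set) \<Rightarrow> bool" where
  "closed_chain V d Z \<longleftrightarrow>
     (\<forall>i\<le>d. irreducible_closed (Z i) \<and> Z i \<subseteq> V) \<and> (\<forall>i<d. Z i \<subset> Z (Suc i))"

definition has_dimension :: "('n::finite, 'a::field) pt set \<Rightarrow> nat \<Rightarrow> bool" where
  "has_dimension V d \<longleftrightarrow> (\<exists>Z. closed_chain V d Z) \<and> (\<forall>d' Z. closed_chain V d' Z \<longrightarrow> d' \<le> d)"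

definition regular_map ::
  "'a set \<Rightarrow> ('n::finite, 'a::field) pt set \<Rightarrow> (('n, 'a) pt \<Rightarrow> ('m::finite, 'a) pt) \<Rightarrow> bool" where
  "regular_map F V \<phi> \<longleftrightarrow> (\<forall>P\<in>V. \<exists>(f :: 'm \<Rightarrow> ('n, 'a) mpoly) d.
     (\<forall>k. homogeneous d (f k) \<and> coeffs_in F (f k)) \<and>
     (\<forall>v\<in>P. (\<lambda>k. mp_eval (f k) v) \<noteq> (\<lambda>_. 0)) \<and>
     (\<forall>Q\<in>V. \<forall>v\<in>Q. (\<lambda>k. mp_eval (f k) v) \<noteq> (\<lambda>_. 0) \<longrightarrow> \<phi> Q = proj_pt (\<lambda>k. mp_eval (f k) v)))"

definition regular_map2 ::
  "'a set \<Rightarrow> ('n::finite, 'a::field) pt set \<Rightarrow> (('n, 'a) pt \<Rightarrow> ('n, 'a) pt \<Rightarrow> ('m::finite, 'a) pt) \<Rightarrow> bool" where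
  "regular_map2 F V \<phi> \<longleftrightarrow> (\<forall>P\<in>V. \<forall>P'\<in>V. \<exists>(f :: 'm \<Rightarrow> ('n + 'n, 'a) mpoly) d e.
     (\<forall>k. bihomogeneous d e (f k) \<and> coeffs_in F (f k)) \<and>
     (\<forall>v\<in>P. \<forall>w\<in>P'. (\<lambda>k. mp_eval (f k) (case_sum v w)) \<noteq> (\<lambda>_. 0)) \<and>
     (\<forall>Q\<in>V. \<forall>Q'\<in>V. \<forall>v\<in>Q. \<forall>w\<in>Q'. (\<lambda>k. mp_eval (f k) (case_sum v w)) \<noteq> (\<lambda>_. 0) \<longrightarrow>
        \<phi> Q Q' = proj_pt (\<lambda>k. mp_eval (f k) (case_sum v w))))"


section \<open>Abelian varieties\<close>

text \<open>
  An abelian variety over \<open>F\<close> is a geometrically irreducible projective variety over \<open>F\<close> with a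
  group law given by regular maps over \<open>F\<close>; it is described here by its group of points over the
  algebraically closed field \<open>'a\<close>. In characteristic zero a group variety is automatically smooth,
  and by rigidity the group law of a projective group variety is automatically commutative;
  commutativity is included so that the library's commutative groups apply.
\<close>

locale abelian_variety = comm_group A
  for F :: "'a::alg_closed_field set" and A :: "('n::finite, 'a) pt monoid" (structure) +
  assumes closed: "closed_over F (carrier A)"
    and irred: "irreducible_closed (carrier A)"
    and one_rational: "\<one> \<in> rational_points F (carrier A)"
    and mult_regular: "regular_map2 F (carrier A) (\<lambda>P Q. P \<otimes> Q)"
    and inv_regular: "regular_map F (carrier A) (\<lambda>P. inv P)"

definition torsion_of :: "nat \<Rightarrow> ('g, 'b) monoid_scheme \<Rightarrow> 'g set" where
  "torsion_of m G = {x \<in> carrier G. x [^]\<^bsub>G\<^esub> m = \<one>\<^bsub>G\<^esub>}"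

definition torsion :: "('g, 'b) monoid_scheme \<Rightarrow> 'g set" where
  "torsion G = (\<Union>m\<in>{1..}. torsion_of m G)"


section \<open>Rational functions and Cartier divisors\<close>

text \<open>
  A rational function on an irreducible \<open>V\<close> is represented by a total function on points that is a
  quotient of homogeneous polynomials of equal degree on some nonempty open subset; its values off
  that subset are irrelevant, and two such functions are identified if they agree generically.
  In particular \<open>unit_at V \<phi> P\<close> says that the rational function underlying \<open>\<phi>\<close> is an invertible
  element of the local ring at \<open>P\<close>, whatever the value of \<open>\<phi>\<close> at \<open>P\<close> itself.
\<close>

type_synonym ('n, 'a) ratfun = "('n, 'a) pt \<Rightarrow> 'a"

definition gen_eq :: "('n::finite, 'a::field) pt set \<Rightarrow> ('n, 'a) ratfun \<Rightarrow> ('n, 'a) ratfun \<Rightarrow> bool" where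
  "gen_eq V \<phi> \<psi> \<longleftrightarrow> (\<exists>U. openin (zariski V) U \<and> U \<noteq> {} \<and> (\<forall>P\<in>U. \<phi> P = \<psi> P))"

definition gen_quotient ::
  "('n::finite, 'a::field) pt set \<Rightarrow> ('n, 'a) ratfun \<Rightarrow> ('n, 'a) mpoly \<Rightarrow> ('n, 'a) mpoly \<Rightarrow> bool" where
  "gen_quotient V \<phi> a b \<longleftrightarrow> (\<exists>d. homogeneous d a \<and> homogeneous d b) \<and>
     (\<exists>U. openin (zariski V) U \<and> U \<noteq> {} \<and>
        (\<forall>P\<in>U. \<forall>v\<in>P. mp_eval b v \<noteq> 0 \<and> \<phi> P = mp_eval a v / mp_eval b v))"

definition regular_at :: "('n::finite, 'a::field) pt set \<Rightarrow> ('n, 'a) ratfun \<Rightarrow> ('n, 'a) pt \<Rightarrow> bool" where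
  "regular_at V \<phi> P \<longleftrightarrow> (\<exists>a b. gen_quotient V \<phi> a b \<and> (\<forall>v\<in>P. mp_eval b v \<noteq> 0))"

definition unit_at :: "('n::finite, 'a::field) pt set \<Rightarrow> ('n, 'a) ratfun \<Rightarrow> ('n, 'a) pt \<Rightarrow> bool" where
  "unit_at V \<phi> P \<longleftrightarrow>
     (\<exists>a b. gen_quotient V \<phi> a b \<and> (\<forall>v\<in>P. mp_eval a v \<noteq> 0 \<and> mp_eval b v \<noteq> 0))"

text \<open>
  A Cartier divisor, i.e. a global section of the sheaf \<open>\<K>\<^sup>*/\<O>\<^sup>*\<close>, is given by a local equation
  \<open>D P\<close> at every point \<open>P\<close>. A nonzero rational function is one that is a unit at some point.
\<close>

type_synonym ('n, 'a) divisor = "('n, 'a) pt \<Rightarrow> ('n, 'a) ratfun"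

definition cartier_divisor :: "('n::finite, 'a::field) pt set \<Rightarrow> ('n, 'a) divisor \<Rightarrow> bool" where
  "cartier_divisor V D \<longleftrightarrow> (\<forall>P\<in>V. (\<exists>Q\<in>V. unit_at V (D P) Q) \<and>
     (\<exists>U. openin (zariski V) U \<and> P \<in> U \<and> (\<forall>Q\<in>U. unit_at V (\<lambda>R. D P R / D Q R) Q)))"

definition div_diff :: "('n, 'a::field) divisor \<Rightarrow> ('n, 'a) divisor \<Rightarrow> ('n, 'a) divisor" where
  "div_diff D E = (\<lambda>P R. D P R / E P R)"

definition div_pullback ::
  "(('n, 'a) pt \<Rightarrow> ('n, 'a) pt) \<Rightarrow> ('n, 'a::field) divisor \<Rightarrow> ('n, 'a) divisor" where
  "div_pullback f D = (\<lambda>P R. D (f P) (f R))"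

definition is_div_of :: "('n::finite, 'a::field) pt set \<Rightarrow> ('n, 'a) ratfun \<Rightarrow> ('n, 'a) divisor \<Rightarrow> bool" where
  "is_div_of V h D \<longleftrightarrow> (\<forall>P\<in>V. unit_at V (\<lambda>R. h R / D P R) P)"

definition lin_equiv :: "('n::finite, 'a::field) pt set \<Rightarrow> ('n, 'a) divisor \<Rightarrow> ('n, 'a) divisor \<Rightarrow> bool" where
  "lin_equiv V D E \<longleftrightarrow> (\<exists>h. is_div_of V h (div_diff D E))"

text \<open>
  Ampleness as in EGA II, 4.5.2: the nonvanishing loci of the global sections of the sheaves
  \<open>\<O>(nD)\<close>, \<open>n > 0\<close>, form a base of the Zariski topology. A section of \<open>\<O>(nD)\<close> is a rational
  function \<open>s\<close> for which \<open>s \<cdot> (D Q)\<^sup>n\<close> is regular at each point \<open>Q\<close>.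
\<close>

definition ample :: "('n::finite, 'a::field) pt set \<Rightarrow> ('n, 'a) divisor \<Rightarrow> bool" where
  "ample V D \<longleftrightarrow> (\<forall>U P. openin (zariski V) U \<and> P \<in> U \<longrightarrow>
     (\<exists>n>0. \<exists>s. (\<forall>Q\<in>V. regular_at V (\<lambda>R. s R * D Q R ^ n) Q) \<and>
        unit_at V (\<lambda>R. s R * D P R ^ n) P \<and>
        {Q \<in> V. unit_at V (\<lambda>R. s R * D Q R ^ n) Q} \<subseteq> U))"


section \<open>Galois action, polarizations and the Weil pairing\<close>

definition gal_pt :: "('a \<Rightarrow> 'a) \<Rightarrow> ('n, 'a) pt \<Rightarrow> ('n, 'a) pt" where
  "gal_pt \<sigma> P = (\<lambda>v i. \<sigma> (v i)) ` P"

definition gal_div :: "('a \<Rightarrow> 'a) \<Rightarrow> ('n, 'a) divisor \<Rightarrow> ('n, 'a) divisor" where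
  "gal_div \<sigma> D = (\<lambda>P R. \<sigma> (D (gal_pt (inv_into UNIV \<sigma>) P) (gal_pt (inv_into UNIV \<sigma>) R)))"

text \<open>
  \<open>phi A D b = t\<^sub>b\<^sup>* D - D\<close>, where \<open>t\<^sub>b\<close> is translation by \<open>b\<close>; its class is the image of \<open>b\<close> under
  the homomorphism from \<open>A\<close> to its dual \<open>Pic\<^sup>0(A)\<close> attached to \<open>D\<close>.
\<close>

definition phi :: "('n, 'a::field) pt monoid \<Rightarrow> ('n, 'a) divisor \<Rightarrow> ('n, 'a) pt \<Rightarrow> ('n, 'a) divisor" where
  "phi A D b = div_diff (div_pullback (\<lambda>P. P \<otimes>\<^bsub>A\<^esub> b) D) D"

text \<open>
  A polarization over \<open>F\<close> is a homomorphism from \<open>A\<close> to its dual that is defined over \<open>F\<close> and, over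
  the algebraic closure, is attached to an ample divisor \<open>D\<close>; the divisor itself need not be
  defined over \<open>F\<close>. Since \<open>F\<close> is perfect, being defined over \<open>F\<close> means Galois equivariance on points.
\<close>

definition polarization ::
  "'a set \<Rightarrow> ('n::finite, 'a::alg_closed_field) pt monoid \<Rightarrow> ('n, 'a) divisor \<Rightarrow> bool" where
  "polarization F A D \<longleftrightarrow> cartier_divisor (carrier A) D \<and> ample (carrier A) D \<and>
     (\<forall>\<sigma>\<in>Gal UNIV F. \<forall>b\<in>carrier A.
        lin_equiv (carrier A) (gal_div \<sigma> (phi A D b)) (phi A D (gal_pt \<sigma> b)))"

text \<open>
  The Weil pairing of the \<open>m\<close>-torsion points \<open>a\<close> and \<open>b\<close> with respect to the polarization of \<open>D\<close>:
  if \<open>h\<close> has divisor \<open>[m]\<^sup>* (t\<^sub>b\<^sup>* D - D)\<close>, it is the constant \<open>h(x + a) / h(x)\<close>.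
\<close>

definition weil_pairing ::
  "('n::finite, 'a::alg_closed_field) pt monoid \<Rightarrow> ('n, 'a) divisor \<Rightarrow> nat \<Rightarrow>
     ('n, 'a) pt \<Rightarrow> ('n, 'a) pt \<Rightarrow> 'a" where
  "weil_pairing A D m a b = (THE c. \<exists>h.
     is_div_of (carrier A) h (div_pullback (\<lambda>P. P [^]\<^bsub>A\<^esub> m) (phi A D b)) \<and>
     gen_eq (carrier A) (\<lambda>P. h (P \<otimes>\<^bsub>A\<^esub> a) / h P) (\<lambda>_. c))"


section \<open>The ring of profinite integers\<close>

text \<open>
  Compatible families of residues modulo all \<open>n > 0\<close>, each represented in \<open>{0..<n}\<close> (this is the
  case \<open>m = n\<close> of the condition below). The value at \<open>0\<close> is a dummy.
\<close>

typedef zhat = "{z :: nat \<Rightarrow> int. z 0 = 0 \<and> (\<forall>n>0. \<forall>m. m dvd n \<longrightarrow> z n mod int m = z m)}"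
  morphisms residue Abs_zhat
  by (rule exI[of _ "\<lambda>_. 0"]) simp

setup_lifting type_definition_zhat

instantiation zhat :: comm_ring_1
begin

lift_definition zero_zhat :: zhat is "\<lambda>_. 0" by simp
lift_definition one_zhat :: zhat is "\<lambda>n. if n = 0 then 0 else 1 mod int n"
  by (auto simp: mod_mod_cancel dest: dvd_pos_nat)
lift_definition plus_zhat :: "zhat \<Rightarrow> zhat \<Rightarrow> zhat" is "\<lambda>x y n. (x n + y n) mod int n"
  by (simp add: mod_mod_cancel) (metis mod_add_eq)
lift_definition times_zhat :: "zhat \<Rightarrow> zhat \<Rightarrow> zhat" is "\<lambda>x y n. (x n * y n) mod int n"
  by (simp add: mod_mod_cancel) (metis mod_mult_eq)
lift_definition uminus_zhat :: "zhat \<Rightarrow> zhat" is "\<lambda>x n. (- x n) mod int n"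
  by (simp add: mod_mod_cancel) (metis mod_minus_eq)
lift_definition minus_zhat :: "zhat \<Rightarrow> zhat \<Rightarrow> zhat" is "\<lambda>x y n. (x n - y n) mod int n"
  by (simp add: mod_mod_cancel) (metis mod_diff_eq)

instance
proof
  have self: "x n mod int n = x n"
    if "x 0 = 0 \<and> (\<forall>n>0. \<forall>m. m dvd n \<longrightarrow> x n mod int m = x m)" for x :: "nat \<Rightarrow> int" and n
    using that by (cases "n = 0") auto
  fix a b c :: zhat
  show "a * b * c = a * (b * c)"
    by transfer (auto simp: mod_simps algebra_simps)
  show "a * b = b * a"
    by transfer (auto simp: mult.commute)
  show "1 * a = a"
  proof transfer
    fix x :: "nat \<Rightarrow> int"
    assume x: "x 0 = 0 \<and> (\<forall>n>0. \<forall>m. m dvd n \<longrightarrow> x n mod int m = x m)"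
    have "(if n = 0 then 0 else 1 mod int n) * x n mod int n = x n" for n
      using x self[OF x, of n] by (cases "n = 0") (auto simp: mod_simps)
    then show "(\<lambda>n. (if n = 0 then 0 else 1 mod int n) * x n mod int n) = x" by auto
  qed
  show "a + b + c = a + (b + c)"
    by transfer (auto simp: mod_simps algebra_simps)
  show "a + b = b + a"
    by transfer (auto simp: add.commute)
  show "0 + a = a"
  proof transfer
    fix x :: "nat \<Rightarrow> int"
    assume x: "x 0 = 0 \<and> (\<forall>n>0. \<forall>m. m dvd n \<longrightarrow> x n mod int m = x m)"
    show "(\<lambda>n. (0 + x n) mod int n) = x" using self[OF x] by auto
  qed
  show "- a + a = 0"
    by transfer (auto simp: mod_simps)
  show "a - b = a + - b"
    by transfer (auto simp: mod_simps)
  show "(a + b) * c = a * c + b * c"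
    by transfer (auto simp: mod_simps algebra_simps)
  have "(\<lambda>n::nat. 0::int) 2 \<noteq> (\<lambda>n. if n = 0 then 0 else 1 mod int n) 2" by simp
  then have "(\<lambda>n::nat. 0::int) \<noteq> (\<lambda>n. if n = 0 then 0 else 1 mod int n)" by metis
  then show "(0::zhat) \<noteq> 1"
    by transfer
qed

end


section \<open>The Tate module and the adelic representation\<close>

text \<open>
  The \<open>\<int>^\<close>-module \<open>lim A[m]\<close>, with transition maps \<open>[n div m] : A[n] \<rightarrow> A[m]\<close> for \<open>m dvd n\<close>. Its
  elements are functions extensional on \<open>{1..}\<close>. The ring structure of the library's module record
  plays no role.
\<close>

definition tate_module :: "('g, 'b) monoid_scheme \<Rightarrow> (zhat, nat \<Rightarrow> 'g) module" where
  "tate_module A =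
     \<lparr>carrier = {t \<in> \<Pi>\<^sub>E m\<in>{1..}. torsion_of m A. \<forall>m\<ge>1. \<forall>k\<ge>1. t (m * k) [^]\<^bsub>A\<^esub> k = t m},
      monoid.mult = undefined, one = undefined,
      ring.zero = (\<lambda>m\<in>{1..}. \<one>\<^bsub>A\<^esub>), add = (\<lambda>s t. \<lambda>m\<in>{1..}. s m \<otimes>\<^bsub>A\<^esub> t m),
      module.smult = (\<lambda>z t. \<lambda>m\<in>{1..}. t m [^]\<^bsub>A\<^esub> residue z m)\<rparr>"

definition gal_tate :: "('a \<Rightarrow> 'a) \<Rightarrow> (nat \<Rightarrow> ('n, 'a) pt) \<Rightarrow> nat \<Rightarrow> ('n, 'a) pt" where
  "gal_tate \<sigma> t = (\<lambda>m\<in>{1..}. gal_pt \<sigma> (t m))"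

definition lin_comb :: "('r, 'm) module \<Rightarrow> nat \<Rightarrow> (nat \<Rightarrow> 'r) \<Rightarrow> (nat \<Rightarrow> 'm) \<Rightarrow> 'm" where
  "lin_comb M r z e = (\<Oplus>\<^bsub>M\<^esub>i\<in>{..<r}. z i \<odot>\<^bsub>M\<^esub> e i)"

definition is_basis :: "('r, 'm) module \<Rightarrow> nat \<Rightarrow> (nat \<Rightarrow> 'm) \<Rightarrow> bool" where
  "is_basis M r e \<longleftrightarrow> e ` {..<r} \<subseteq> carrier M \<and>
     (\<forall>t\<in>carrier M. \<exists>!z. z \<in> extensional {..<r} \<and> t = lin_comb M r z e)"

definition symp_form :: "nat \<Rightarrow> 'r::comm_ring_1 mat" where
  "symp_form g = four_block_mat (0\<^sub>m g g) (1\<^sub>m g) (- 1\<^sub>m g) (0\<^sub>m g g)"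

text \<open>
  A symplectic basis: the Weil pairing on the Tate module has Gram matrix \<open>symp_form g\<close> once
  \<open>\<int>^(1) = lim \<mu>\<^sub>m\<close> is identified with \<open>\<int>^\<close> by some generator \<open>\<zeta>\<close>. As this matrix is
  unimodular, the existence of a symplectic basis forces the polarization to be principal.
\<close>

definition symplectic_basis ::
  "('n::finite, 'a::alg_closed_field) pt monoid \<Rightarrow> ('n, 'a) divisor \<Rightarrow> nat \<Rightarrow>
     (nat \<Rightarrow> nat \<Rightarrow> ('n, 'a) pt) \<Rightarrow> bool" where
  "symplectic_basis A D g e \<longleftrightarrow> is_basis (tate_module A) (2 * g) e \<and>
     (\<exists>\<zeta> :: nat \<Rightarrow> 'a.
        (\<forall>m\<ge>1. \<zeta> m ^ m = 1 \<and> (\<forall>k. 0 < k \<and> k < m \<longrightarrow> \<zeta> m ^ k \<noteq> 1)) \<and>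
        (\<forall>m\<ge>1. \<forall>k\<ge>1. \<zeta> (m * k) ^ k = \<zeta> m) \<and>
        (\<forall>m\<ge>1. \<forall>i<2 * g. \<forall>j<2 * g.
           weil_pairing A D m (e i m) (e j m) = \<zeta> m powi (symp_form g $$ (i, j))))"

text \<open>
  The matrix of \<open>\<sigma>\<close> acting on the Tate module. With respect to a symplectic basis it lies in
  \<open>GSp\<close>, because the Weil pairing is Galois equivariant.
\<close>

definition adelic_rep ::
  "('n, 'a) pt monoid \<Rightarrow> nat \<Rightarrow> (nat \<Rightarrow> nat \<Rightarrow> ('n, 'a) pt) \<Rightarrow> ('a \<Rightarrow> 'a) \<Rightarrow> zhat mat" where
  "adelic_rep A g e \<sigma> = (THE M. M \<in> carrier_mat (2 * g) (2 * g) \<and>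
     (\<forall>j<2 * g. gal_tate \<sigma> (e j) = lin_comb (tate_module A) (2 * g) (\<lambda>i. M $$ (i, j)) e))"

definition Sp :: "nat \<Rightarrow> 'r::comm_ring_1 mat monoid" where
  "Sp g = \<lparr>carrier = {M \<in> carrier_mat (2 * g) (2 * g).
              transpose_mat M * symp_form g * M = symp_form g},
           monoid.mult = (*), one = 1\<^sub>m (2 * g)\<rparr>"

definition has_big_image ::
  "'a set \<Rightarrow> ('n, 'a::field) pt monoid \<Rightarrow> nat \<Rightarrow> (nat \<Rightarrow> nat \<Rightarrow> ('n, 'a) pt) \<Rightarrow> bool" where
  "has_big_image F A g e \<longleftrightarrow>
     finite (rcosets\<^bsub>Sp g\<^esub> (adelic_rep A g e ` Gal UNIV F \<inter> carrier (Sp g)))"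

end

theory Submission
  imports Defs "HOL-Library.Function_Algebras" "HOL-Algebra.Group_Action" "HOL-Algebra.Multiplicative_Group"
begin

text \<open>
  Since a pro-\<open>p\<close> group acts on the finite \<open>p\<close>-group \<open>A(K\<^sub>\<infinity>)[p]\<close> with only the trivial
  \<open>K\<close>-rational fixed point, \<open>A(K\<^sub>\<infinity>)\<close> has no \<open>p\<close>-torsion. Big image yields, for some
  \<open>n, n' > 0\<close>, Galois elements acting on the Tate module as the unipotent matrices with blocks
  \<open>(1, n; 0, 1)\<close> and \<open>(1, 0; n', 1)\<close>. Let \<open>P\<close> be a point of \<open>A(K\<^sub>\<infinity>)\<close> of order \<open>m\<close> prime to
  \<open>p\<close>. Both elements act on \<open>A(K\<^sub>\<infinity>)[m]\<close> through a finite \<open>p\<close>-group, so their \<open>p\<^sup>k\<close>-th powers fix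
  \<open>P\<close>; in coordinates, \<open>p\<^sup>k n\<close> and \<open>p\<^sup>k n'\<close> annihilate the two halves of the coordinate vector
  of \<open>P\<close> modulo \<open>m\<close>, and as \<open>p\<close> is invertible modulo \<open>m\<close>, \<open>P\<close> is killed by \<open>n n'\<close>.

  That the Tate module surjects onto \<open>A[m]\<close> amounts to the surjectivity of \<open>[m]\<close> on \<open>A\<close>. In
  characteristic zero \<open>[m]\<close> acts on the \<open>k\<close>-th graded piece of the local ring at the identity
  as \<open>m\<^sup>k\<close>, so by Krull's intersection theorem it is dominant; by Chevalley its image contains
  a nonempty open set, and a subgroup of the irreducible group \<open>A\<close> that contains one is all of \<open>A\<close>.
\<close>

section \<open>Noetherian subrings\<close>

text \<open>The varieties are given by their points alone, so coordinate rings are realized as rings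
  of functions on points. These are subsets of a type with zero divisors, which is why
  Noetherianity, the domain property and homomorphisms are stated relative to a subset of a
  commutative ring. Surjectivity of [m] is reached without dimension theory, through the injectivity
  of the pullback of functions; this can be tested at the identity, where [m] is known to first
  order. Unipotent elements are chosen because s = 1 + N with N^2 = 0 gives s^k = 1 + k N: an
  exponent that depends on the point enters only as a factor, which is invertible modulo m and can
  be cancelled, so that the final bound does not depend on the point. Each of the two elements
  restricts only the coordinates of the vectors that it moves. Comparing coordinates modulo m
  requires that the basis of the Tate module reduces to generators of A[m], where divisibility
  enters, and to independent ones, where a Tate vector that is trivial at level m is divided by
  m.\<close>

definition subr :: "'b::comm_ring_1 set \<Rightarrow> bool" where
  "subr R \<longleftrightarrow> 1 \<in> R \<and> (\<forall>x\<in>R. - x \<in> R) \<and> (\<forall>x\<in>R. \<forall>y\<in>R. x + y \<in> R \<and> x * y \<in> R)"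

lemma subr_1: "subr R \<Longrightarrow> 1 \<in> R"
  and subr_add: "subr R \<Longrightarrow> x \<in> R \<Longrightarrow> y \<in> R \<Longrightarrow> x + y \<in> R"
  and subr_mult: "subr R \<Longrightarrow> x \<in> R \<Longrightarrow> y \<in> R \<Longrightarrow> x * y \<in> R"
  and subr_uminus: "subr R \<Longrightarrow> x \<in> R \<Longrightarrow> - x \<in> R"
  by (auto simp: subr_def)

lemma subr_0: "subr R \<Longrightarrow> 0 \<in> R"
  using subr_add[of R 1 "-1"] subr_1[of R] subr_uminus[of R 1] by simp

lemma subr_diff: "subr R \<Longrightarrow> x \<in> R \<Longrightarrow> y \<in> R \<Longrightarrow> x - y \<in> R"
  using subr_add[of R x "- y"] subr_uminus[of R y] by simp

lemma subr_sum: "subr R \<Longrightarrow> (\<And>i. i \<in> I \<Longrightarrow> f i \<in> R) \<Longrightarrow> sum f I \<in> R"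
  by (induction I rule: infinite_finite_induct) (auto simp: subr_0 subr_add)

lemma subr_prod: "subr R \<Longrightarrow> (\<And>i. i \<in> I \<Longrightarrow> f i \<in> R) \<Longrightarrow> prod f I \<in> R"
  by (induction I rule: infinite_finite_induct) (auto simp: subr_1 subr_mult)

lemma subr_power: "subr R \<Longrightarrow> x \<in> R \<Longrightarrow> x ^ n \<in> R"
  by (induction n) (auto simp: subr_1 subr_mult)

lemma subr_of_nat: "subr R \<Longrightarrow> of_nat n \<in> R"
  by (induction n) (auto simp: subr_0 subr_1 subr_add)

lemmas subr_closed = subr_0 subr_1 subr_add subr_mult subr_uminus subr_diff subr_sum subr_prod
  subr_power subr_of_nat

inductive_set ring_gen :: "'b::comm_ring_1 set \<Rightarrow> 'b set" for S where
  base: "x \<in> S \<Longrightarrow> x \<in> ring_gen S"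
| one: "1 \<in> ring_gen S"
| uminus: "x \<in> ring_gen S \<Longrightarrow> - x \<in> ring_gen S"
| add: "x \<in> ring_gen S \<Longrightarrow> y \<in> ring_gen S \<Longrightarrow> x + y \<in> ring_gen S"
| mult: "x \<in> ring_gen S \<Longrightarrow> y \<in> ring_gen S \<Longrightarrow> x * y \<in> ring_gen S"

lemma subr_ring_gen: "subr (ring_gen S)"
  by (auto simp: subr_def intro: ring_gen.intros)

lemma ring_gen_least: "subr R \<Longrightarrow> S \<subseteq> R \<Longrightarrow> ring_gen S \<subseteq> R"
proof
  fix x assume R: "subr R" "S \<subseteq> R" and "x \<in> ring_gen S"
  from this(3) show "x \<in> R"
    by induction (use R in \<open>auto simp: subr_def\<close>)
qed

lemma ring_gen_mono: "S \<subseteq> T \<Longrightarrow> ring_gen S \<subseteq> ring_gen T"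
  by (rule ring_gen_least[OF subr_ring_gen]) (auto intro: ring_gen.base)

definition polys_over :: "'b::comm_ring_1 set \<Rightarrow> 'b poly set" where
  "polys_over R = {p. \<forall>i. poly.coeff p i \<in> R}"

lemma polys_over_pCons: "pCons a p \<in> polys_over R \<longleftrightarrow> a \<in> R \<and> p \<in> polys_over R"
  by (auto simp: polys_over_def coeff_pCons split: nat.splits)

lemma polys_over_monom: "subr R \<Longrightarrow> a \<in> R \<Longrightarrow> Polynomial.monom a n \<in> polys_over R"
  by (auto simp: polys_over_def subr_0)

lemma subr_polys_over: "subr R \<Longrightarrow> subr (polys_over R)"
  unfolding subr_def[of "polys_over R"] unfolding polys_over_def
  by (auto simp: coeff_mult subr_0 subr_1 subr_add subr_uminus of_bool_def intro!: subr_sum subr_mult)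

lemma polys_over_smult: "subr R \<Longrightarrow> a \<in> R \<Longrightarrow> p \<in> polys_over R \<Longrightarrow> Polynomial.smult a p \<in> polys_over R"
  by (auto simp: polys_over_def subr_closed)

lemma poly_in_subr:
  assumes "subr R" "p \<in> polys_over R" "x \<in> R"
  shows "poly p x \<in> R"
  using assms(2)
  by (induction p) (use assms in \<open>auto simp: polys_over_pCons subr_closed\<close>)

definition adjoin :: "'b::comm_ring_1 set \<Rightarrow> 'b \<Rightarrow> 'b set" where
  "adjoin R x = (\<lambda>p. poly p x) ` polys_over R"

lemma subr_adjoin: assumes "subr R" shows "subr (adjoin R x)"
proof -
  note P = subr_polys_over[OF assms]
  show ?thesis
    unfolding subr_def adjoin_def
  proof (intro conjI ballI)
    show "1 \<in> (\<lambda>p. poly p x) ` polys_over R"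
      by (rule image_eqI[of _ _ 1]) (auto simp: subr_1[OF P])
  next
    fix a assume "a \<in> (\<lambda>p. poly p x) ` polys_over R"
    then obtain p where "p \<in> polys_over R" "a = poly p x" by auto
    then show "- a \<in> (\<lambda>p. poly p x) ` polys_over R"
      by (intro image_eqI[of _ _ "- p"]) (auto simp: subr_uminus[OF P])
  next
    fix a b assume "a \<in> (\<lambda>p. poly p x) ` polys_over R" "b \<in> (\<lambda>p. poly p x) ` polys_over R"
    then obtain p q where "p \<in> polys_over R" "a = poly p x" "q \<in> polys_over R" "b = poly q x" by auto
    then have "a + b = poly (p + q) x" "a * b = poly (p * q) x" "p + q \<in> polys_over R" "p * q \<in> polys_over R"
      by (auto simp: subr_add[OF P] subr_mult[OF P])
    then show "a + b \<in> (\<lambda>p. poly p x) ` polys_over R" "a * b \<in> (\<lambda>p. poly p x) ` polys_over R"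
      by blast+
  qed
qed

lemma adjoin_base: assumes "subr R" "r \<in> R" shows "r \<in> adjoin R x"
  unfolding adjoin_def using assms
  by (intro image_eqI[of _ _ "[:r:]"]) (auto simp: polys_over_pCons polys_over_def[of R] subr_0 coeff_pCons split: nat.splits)

lemma adjoin_self: assumes "subr R" shows "x \<in> adjoin R x"
  unfolding adjoin_def using assms
  by (intro image_eqI[of _ _ "[:0,1:]"]) (auto simp: polys_over_def[of R] subr_0 subr_1 coeff_pCons split: nat.splits)

lemma adjoin_eq_ring_gen: assumes "subr R" shows "adjoin R x = ring_gen (insert x R)"
proof
  show "ring_gen (insert x R) \<subseteq> adjoin R x"
    using assms by (intro ring_gen_least subr_adjoin) (auto simp: adjoin_base adjoin_self)
  have "polys_over R \<subseteq> polys_over (ring_gen (insert x R))"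
    by (auto simp: polys_over_def intro: ring_gen.base)
  then show "adjoin R x \<subseteq> ring_gen (insert x R)"
    by (auto simp: adjoin_def intro!: poly_in_subr subr_ring_gen intro: ring_gen.base)
qed

text \<open>Lets statements on finitely generated rings be proved by induction on the generators,
  adjoining one element at a time.\<close>

lemma ring_gen_insert: "ring_gen (insert x S) = adjoin (ring_gen S) x"
proof -
  have "ring_gen (insert x S) = ring_gen (insert x (ring_gen S))"
  proof
    show "ring_gen (insert x S) \<subseteq> ring_gen (insert x (ring_gen S))"
      by (intro ring_gen_mono) (auto intro: ring_gen.base)
    show "ring_gen (insert x (ring_gen S)) \<subseteq> ring_gen (insert x S)"
      using ring_gen_mono[of S "insert x S"]
      by (intro ring_gen_least subr_ring_gen) (auto intro: ring_gen.base)
  qed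
  then show ?thesis by (simp add: adjoin_eq_ring_gen subr_ring_gen)
qed

lemma ring_gen_subr: "subr R \<Longrightarrow> ring_gen R = R"
  using ring_gen_least[of R R] by (auto intro: ring_gen.base)

section \<open>Ideals of a subring and the Noetherian property\<close>

inductive_set ideal_gen :: "'b::comm_ring_1 set \<Rightarrow> 'b set \<Rightarrow> 'b set" for R S where
  zero: "0 \<in> ideal_gen R S"
| step: "r \<in> R \<Longrightarrow> s \<in> S \<Longrightarrow> a \<in> ideal_gen R S \<Longrightarrow> r * s + a \<in> ideal_gen R S"

lemma ideal_gen_base: "subr R \<Longrightarrow> s \<in> S \<Longrightarrow> s \<in> ideal_gen R S"
  using ideal_gen.step[of 1 R s S 0] by (auto simp: subr_1 ideal_gen.zero)

lemma ideal_gen_add: "a \<in> ideal_gen R S \<Longrightarrow> b \<in> ideal_gen R S \<Longrightarrow> a + b \<in> ideal_gen R S"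
  by (induction rule: ideal_gen.induct) (auto simp: add.assoc intro: ideal_gen.intros)

lemma ideal_gen_mult: "subr R \<Longrightarrow> a \<in> ideal_gen R S \<Longrightarrow> r \<in> R \<Longrightarrow> r * a \<in> ideal_gen R S"
  by (rotate_tac, induction rule: ideal_gen.induct)
     (auto simp: distrib_left mult.assoc[symmetric] subr_mult intro: ideal_gen.intros)

lemma ideal_gen_diff: "subr R \<Longrightarrow> a \<in> ideal_gen R S \<Longrightarrow> b \<in> ideal_gen R S \<Longrightarrow> a - b \<in> ideal_gen R S"
  using ideal_gen_add[of a R S "- 1 * b"] ideal_gen_mult[of R b S "- 1"] by (simp add: subr_closed)

lemma ideal_gen_sum:
  "subr R \<Longrightarrow> (\<And>i. i \<in> I \<Longrightarrow> r i \<in> R) \<Longrightarrow> (\<And>i. i \<in> I \<Longrightarrow> f i \<in> S) \<Longrightarrow> (\<Sum>i\<in>I. r i * f i) \<in> ideal_gen R S"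
  by (induction I rule: infinite_finite_induct) (auto intro: ideal_gen.intros)

lemma ideal_gen_subset: "subr R \<Longrightarrow> S \<subseteq> ideal_gen R T \<Longrightarrow> ideal_gen R S \<subseteq> ideal_gen R T"
proof
  fix x assume "subr R" "S \<subseteq> ideal_gen R T" "x \<in> ideal_gen R S"
  from this(3) show "x \<in> ideal_gen R T"
    by induction (use \<open>subr R\<close> \<open>S \<subseteq> _\<close> in \<open>auto intro!: ideal_gen_add ideal_gen.zero ideal_gen_mult\<close>)
qed

lemma ideal_gen_mono: "subr R \<Longrightarrow> S \<subseteq> T \<Longrightarrow> ideal_gen R S \<subseteq> ideal_gen R T"
  by (intro ideal_gen_subset) (auto intro: ideal_gen_base)

lemma ideal_gen_finite:
  assumes R: "subr R" and "a \<in> ideal_gen R S"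
  shows "\<exists>F\<subseteq>S. finite F \<and> a \<in> ideal_gen R F"
  using assms(2)
proof induction
  case zero
  then show ?case by (intro exI[of _ "{}"]) (auto intro: ideal_gen.zero)
next
  case (step r s a)
  then obtain F where F: "F \<subseteq> S" "finite F" "a \<in> ideal_gen R F" by auto
  have "ideal_gen R F \<subseteq> ideal_gen R (insert s F)" by (rule ideal_gen_mono[OF R]) auto
  then show ?case using F step
    by (intro exI[of _ "insert s F"]) (auto intro!: ideal_gen.step)
qed

lemma ideal_gen_finite_set:
  assumes R: "subr R" and "finite A" "A \<subseteq> ideal_gen R S"
  shows "\<exists>F\<subseteq>S. finite F \<and> A \<subseteq> ideal_gen R F"
  using assms(2,3)
proof (induction A)
  case empty
  then show ?case by (intro exI[of _ "{}"]) auto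
next
  case (insert a A)
  then obtain F G where "F \<subseteq> S" "finite F" "A \<subseteq> ideal_gen R F" "G \<subseteq> S" "finite G" "a \<in> ideal_gen R G"
    using ideal_gen_finite[OF R, of a S] by auto
  moreover have "ideal_gen R F \<subseteq> ideal_gen R (F \<union> G)" "ideal_gen R G \<subseteq> ideal_gen R (F \<union> G)"
    by (intro ideal_gen_mono[OF R]; simp)+
  ultimately show ?case
    by (intro exI[of _ "F \<union> G"]) auto
qed

lemma ideal_gen_poly:
  assumes "p \<in> ideal_gen (polys_over R) F"
  shows "poly p x \<in> ideal_gen (adjoin R x) ((\<lambda>p. poly p x) ` F)"
  using assms by induction (auto simp: adjoin_def intro: ideal_gen.intros)

lemma ideal_gen_sequence:
  fixes f :: "nat \<Rightarrow> 'b::comm_ring_1"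
  assumes "subr R" "a \<in> ideal_gen R (f ` {..<n})"
  shows "\<exists>q. (\<forall>i<n. q i \<in> R) \<and> a = (\<Sum>i<n. q i * f i)"
  using assms(2)
proof induction
  case zero
  then show ?case by (intro exI[of _ "\<lambda>_. 0"]) (simp add: assms subr_0)
next
  case (step r s a)
  then obtain q j where q: "\<forall>i<n. q i \<in> R" "a = (\<Sum>i<n. q i * f i)" and j: "j < n" "s = f j" by auto
  have "(\<Sum>i<n. (q(j := q j + r)) i * f i) = (\<Sum>i<n. q i * f i + (if i = j then r * f j else 0))"
    by (intro sum.cong) (auto simp: algebra_simps)
  also have "\<dots> = a + r * s" using j q by (subst sum.distrib, subst sum.delta) auto
  finally show ?case using q j step.hyps(1) assms(1)
    by (intro exI[of _ "q(j := q j + r)"]) (auto simp: add.commute subr_add)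
qed

text \<open>The finite subset is found inside the given generators S, which may be any subset and
  not only an ideal; for sequences this yields directly the form in
  \<open>noeth_sequence\<close>.\<close>

definition noeth :: "'b::comm_ring_1 set \<Rightarrow> bool" where
  "noeth R \<longleftrightarrow> (\<forall>S\<subseteq>R. \<exists>F\<subseteq>S. finite F \<and> S \<subseteq> ideal_gen R F)"

text \<open>Finitely many terms, with indices below some N, generate the ideal of the whole
  sequence; so the term with index N already depends on its predecessors. This replaces the
  ascending chain condition.\<close>

lemma noeth_sequence:
  fixes f :: "nat \<Rightarrow> 'b::comm_ring_1"
  assumes "subr R" "noeth R" "\<And>n. f n \<in> R"
  shows "\<exists>N q. (\<forall>i<N. q i \<in> R) \<and> f N = (\<Sum>i<N. q i * f i)"
proof -
  obtain F where F: "F \<subseteq> range f" "finite F" "range f \<subseteq> ideal_gen R F"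
    using assms(2,3) unfolding noeth_def by (meson image_subsetI)
  then obtain I where I: "finite I" "F = f ` I" by (meson finite_subset_image)
  obtain N where "I \<subseteq> {..<N}" using I(1) unfolding finite_nat_iff_bounded by auto
  then have "ideal_gen R F \<subseteq> ideal_gen R (f ` {..<N})"
    using I by (intro ideal_gen_mono assms) auto
  then have "f N \<in> ideal_gen R (f ` {..<N})" using F(3) by blast
  then show ?thesis using ideal_gen_sequence[OF assms(1)] by blast
qed

lemma noeth_field:
  assumes "subr R" "\<And>x. x \<in> R \<Longrightarrow> x \<noteq> 0 \<Longrightarrow> \<exists>y\<in>R. y * x = 1"
  shows "noeth R"
  unfolding noeth_def
proof (intro allI impI)
  fix S assume S: "S \<subseteq> R"
  show "\<exists>F\<subseteq>S. finite F \<and> S \<subseteq> ideal_gen R F"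
  proof (cases "\<exists>s\<in>S. s \<noteq> 0")
    case True
    then obtain s y where s: "s \<in> S" "y \<in> R" "y * s = 1" using assms S by blast
    have "t = (t * y) * s + 0" for t using s by (simp add: mult.assoc)
    then have "t \<in> ideal_gen R {s}" if "t \<in> S" for t
      by (metis S assms(1) ideal_gen.intros insertI1 s(2) subr_mult subsetD that)
    then show ?thesis using s by (intro exI[of _ "{s}"]) auto
  next
    case False
    then show ?thesis by (intro exI[of _ "{}"]) (auto intro: ideal_gen.zero)
  qed
qed

text \<open>Hilbert's basis theorem, for R[x] with x possibly algebraic over R: the argument runs in
  the preimage J, in the polynomial ring, of the ideal spanned by S. If no finite part of S
  suffices, J is not finitely generated, and a sequence of elements of least degree outside the
  ideal of their predecessors leads to a contradiction by cancelling leading terms.\<close>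

theorem noeth_adjoin:
  assumes R: "subr R" and N: "noeth R"
  shows "noeth (adjoin R x)"
  unfolding noeth_def
proof (intro allI impI, rule ccontr)
  fix S assume S: "S \<subseteq> adjoin R x" and no: "\<not> (\<exists>F\<subseteq>S. finite F \<and> S \<subseteq> ideal_gen (adjoin R x) F)"
  note P = subr_polys_over[OF R] and A = subr_adjoin[OF R, of x]
  define J where "J = {p \<in> polys_over R. poly p x \<in> ideal_gen (adjoin R x) S}"
  have J_diff: "p - q * r \<in> J" if "p \<in> J" "r \<in> J" "q \<in> polys_over R" for p q r
  proof -
    have "poly q x \<in> adjoin R x" using that by (auto simp: adjoin_def)
    then show ?thesis using that unfolding J_def
      by (simp add: subr_diff[OF P] subr_mult[OF P] ideal_gen_diff[OF A] ideal_gen_mult[OF A])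
  qed
  have nofin: "\<exists>p. p \<in> J \<and> p \<notin> ideal_gen (polys_over R) F" if F: "finite F" "F \<subseteq> J" for F
  proof (rule ccontr)
    assume "\<not> ?thesis"
    then have sub: "J \<subseteq> ideal_gen (polys_over R) F" by auto
    have "(\<lambda>p. poly p x) ` F \<subseteq> ideal_gen (adjoin R x) S" using F by (auto simp: J_def)
    then obtain G where G: "G \<subseteq> S" "finite G" "(\<lambda>p. poly p x) ` F \<subseteq> ideal_gen (adjoin R x) G"
      using ideal_gen_finite_set[OF A, of "(\<lambda>p. poly p x) ` F" S] F by auto
    have "S \<subseteq> ideal_gen (adjoin R x) G"
    proof
      fix s assume s: "s \<in> S"
      then obtain p where p: "p \<in> polys_over R" "s = poly p x" using S by (auto simp: adjoin_def)
      then have "p \<in> J" using s by (auto simp: J_def ideal_gen_base[OF A])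
      then have "s \<in> ideal_gen (adjoin R x) ((\<lambda>p. poly p x) ` F)"
        using sub p ideal_gen_poly by blast
      then show "s \<in> ideal_gen (adjoin R x) G" using ideal_gen_subset[OF A G(3)] by blast
    qed
    then show False using no G by auto
  qed
  define Q where "Q f n p \<longleftrightarrow> p \<in> J \<and> p \<notin> ideal_gen (polys_over R) (f ` {..<n}) \<and>
    (\<forall>q\<in>J. q \<notin> ideal_gen (polys_over R) (f ` {..<n}) \<longrightarrow> Polynomial.degree p \<le> Polynomial.degree q)"
    for f :: "nat \<Rightarrow> 'a poly" and n p
  have "\<exists>f. \<forall>n. Q f n (f n)"
  proof (rule dependent_wellorder_choice)
    fix r and f g :: "nat \<Rightarrow> 'a poly" and n
    assume "\<And>m. m < n \<Longrightarrow> f m = g m"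
    then have "f ` {..<n} = g ` {..<n}" by (intro image_cong) auto
    then show "Q f n r = Q g n r" by (simp add: Q_def)
  next
    fix n and f :: "nat \<Rightarrow> 'a poly"
    assume "\<And>m. m < n \<Longrightarrow> Q f m (f m)"
    then have "f ` {..<n} \<subseteq> J" by (auto simp: Q_def)
    then obtain p0 where "p0 \<in> J \<and> p0 \<notin> ideal_gen (polys_over R) (f ` {..<n})"
      using nofin[of "f ` {..<n}"] by auto
    from ex_has_least_nat[of "\<lambda>p. p \<in> J \<and> p \<notin> ideal_gen (polys_over R) (f ` {..<n})", OF this, of Polynomial.degree]
    show "\<exists>r. Q f n r" by (auto simp: Q_def)
  qed
  then obtain f where f: "\<And>n. Q f n (f n)" by blast
  have fJ: "f n \<in> J" for n using f[of n] by (simp add: Q_def)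
  define c where "c n = lead_coeff (f n)" for n
  have "c n \<in> R" for n using fJ[of n] by (auto simp: c_def J_def polys_over_def)
  then obtain M q where q: "\<forall>i<M. q i \<in> R" "c M = (\<Sum>i<M. q i * c i)"
    using noeth_sequence[OF R N, of c] by blast
  define d where "d n = Polynomial.degree (f n)" for n
  have ideal_le: "ideal_gen (polys_over R) (f ` {..<i}) \<subseteq> ideal_gen (polys_over R) (f ` {..<M})" if "i \<le> M" for i
    using that by (intro ideal_gen_mono[OF P]) auto
  have d_le: "d i \<le> d M" if "i < M" for i
    using f[of i] f[of M] ideal_le[of i] that unfolding Q_def d_def by (meson less_imp_le_nat subsetD)
  \<comment> \<open>The leading coefficient of \<open>f M\<close> is a combination of earlier ones;
    shifting the earlier polynomials up to degree \<open>d M\<close> turns this into a polynomial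
    with the same coefficient there. The degrees \<open>d i\<close> do not exceed \<open>d M\<close>
    because \<open>f M\<close> was already a candidate at stage i.\<close>
  define h where "h = (\<Sum>i<M. Polynomial.monom (q i) (d M - d i) * f i)"
  define g where "g = f M - h"
  have h_ideal: "h \<in> ideal_gen (polys_over R) (f ` {..<M})"
    unfolding h_def using q by (intro ideal_gen_sum[OF P]) (auto intro: polys_over_monom[OF R])
  have "f M - (\<Sum>i\<in>I. Polynomial.monom (q i) (d M - d i) * f i) \<in> J" if "I \<subseteq> {..<M}" "finite I" for I
    using that(2,1)
  proof (induction I)
    case empty
    then show ?case using fJ by simp
  next
    case (insert i I)
    then have "(f M - (\<Sum>i\<in>I. Polynomial.monom (q i) (d M - d i) * f i)) - Polynomial.monom (q i) (d M - d i) * f i \<in> J"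
      using q by (intro J_diff fJ polys_over_monom[OF R]) auto
    then show ?case using insert by (simp add: algebra_simps)
  qed
  then have gJ: "g \<in> J" unfolding g_def h_def by blast
  have g_not: "g \<notin> ideal_gen (polys_over R) (f ` {..<M})"
  proof
    assume "g \<in> ideal_gen (polys_over R) (f ` {..<M})"
    from ideal_gen_add[OF this h_ideal] have "f M \<in> ideal_gen (polys_over R) (f ` {..<M})"
      by (simp add: g_def)
    then show False using f[of M] by (simp add: Q_def)
  qed
  have "poly.coeff h (d M) = (\<Sum>i<M. q i * c i)"
    unfolding h_def coeff_sum
  proof (rule sum.cong[OF refl])
    fix i assume "i \<in> {..<M}"
    then have "d i \<le> d M" using d_le by auto
    then show "poly.coeff (Polynomial.monom (q i) (d M - d i) * f i) (d M) = q i * c i"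
      by (simp add: coeff_monom_mult c_def d_def)
  qed
  then have lead0: "poly.coeff g (d M) = 0" using q(2) by (simp add: g_def c_def d_def)
  have "Polynomial.degree h \<le> d M"
    unfolding h_def
  proof (rule degree_sum_le)
    fix i assume "i \<in> {..<M}"
    then have "d i \<le> d M" using d_le by auto
    moreover have "Polynomial.degree (Polynomial.monom (q i) (d M - d i) * f i) \<le> (d M - d i) + d i"
      unfolding d_def by (rule order_trans[OF degree_mult_le]) (simp add: degree_monom_le)
    ultimately show "Polynomial.degree (Polynomial.monom (q i) (d M - d i) * f i) \<le> d M" by linarith
  qed simp
  then have "Polynomial.degree g \<le> d M" unfolding g_def d_def using degree_diff_le by blast
  moreover have "d M \<le> Polynomial.degree g" using f[of M] gJ g_not by (auto simp: Q_def d_def)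
  ultimately have "lead_coeff g = 0" using lead0 by simp
  then have "g = 0" by simp
  then show False using g_not ideal_gen.zero by auto
qed

lemma noeth_ring_gen:
  assumes "subr R" "noeth R" "finite F"
  shows "noeth (ring_gen (R \<union> F))"
  using assms(3)
proof induction
  case empty
  then show ?case using assms by (simp add: ring_gen_subr)
next
  case (insert x F)
  then show ?case using noeth_adjoin[OF subr_ring_gen, of "R \<union> F" x]
    by (simp add: ring_gen_insert)
qed

section \<open>Extension of ring homomorphisms\<close>

definition hom_on :: "'b::comm_ring_1 set \<Rightarrow> ('b \<Rightarrow> 'k::field) \<Rightarrow> bool" where
  "hom_on R \<phi> \<longleftrightarrow> \<phi> 1 = 1 \<and> (\<forall>x\<in>R. \<forall>y\<in>R. \<phi> (x + y) = \<phi> x + \<phi> y \<and> \<phi> (x * y) = \<phi> x * \<phi> y)"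

text \<open>Function types have zero divisors as soon as there are two points, so their absence is
  demanded on a subset.\<close>

definition dom_on :: "'b::comm_ring_1 set \<Rightarrow> bool" where
  "dom_on R \<longleftrightarrow> (\<forall>x\<in>R. \<forall>y\<in>R. x * y = 0 \<longrightarrow> x = 0 \<or> y = 0)"

lemma hom_on_1: "hom_on R \<phi> \<Longrightarrow> \<phi> 1 = 1"
  and hom_on_add: "hom_on R \<phi> \<Longrightarrow> x \<in> R \<Longrightarrow> y \<in> R \<Longrightarrow> \<phi> (x + y) = \<phi> x + \<phi> y"
  and hom_on_mult: "hom_on R \<phi> \<Longrightarrow> x \<in> R \<Longrightarrow> y \<in> R \<Longrightarrow> \<phi> (x * y) = \<phi> x * \<phi> y"
  by (auto simp: hom_on_def)

lemma hom_on_0: "subr R \<Longrightarrow> hom_on R \<phi> \<Longrightarrow> \<phi> 0 = 0"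
  using hom_on_add[of R \<phi> 0 0] subr_0[of R] by (metis add.right_neutral add_left_cancel)

lemma hom_on_uminus: "subr R \<Longrightarrow> hom_on R \<phi> \<Longrightarrow> x \<in> R \<Longrightarrow> \<phi> (- x) = - \<phi> x"
  using hom_on_add[of R \<phi> x "- x"] by (simp add: subr_uminus hom_on_0 eq_neg_iff_add_eq_0 add.commute)

lemma hom_on_diff: "subr R \<Longrightarrow> hom_on R \<phi> \<Longrightarrow> x \<in> R \<Longrightarrow> y \<in> R \<Longrightarrow> \<phi> (x - y) = \<phi> x - \<phi> y"
  using hom_on_add[of R \<phi> x "- y"] hom_on_uminus[of R \<phi> y] by (simp add: subr_uminus)

lemma hom_on_sum:
  "subr R \<Longrightarrow> hom_on R \<phi> \<Longrightarrow> (\<And>i. i \<in> I \<Longrightarrow> f i \<in> R) \<Longrightarrow> \<phi> (sum f I) = (\<Sum>i\<in>I. \<phi> (f i))"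
  by (induction I rule: infinite_finite_induct) (simp_all add: hom_on_0 hom_on_add subr_sum)

lemma hom_on_power: "subr R \<Longrightarrow> hom_on R \<phi> \<Longrightarrow> x \<in> R \<Longrightarrow> \<phi> (x ^ n) = \<phi> x ^ n"
  by (induction n) (simp_all add: hom_on_1 hom_on_mult subr_power)

lemma dom_on_subset: "dom_on S \<Longrightarrow> R \<subseteq> S \<Longrightarrow> dom_on R"
  unfolding dom_on_def by blast

lemma dom_on_power: "subr R \<Longrightarrow> dom_on R \<Longrightarrow> x \<in> R \<Longrightarrow> x \<noteq> 0 \<Longrightarrow> x ^ n \<noteq> 0"
proof (induction n)
  case (Suc n)
  then show ?case unfolding dom_on_def power_Suc using subr_power[of R x n] by blast
qed simp

context
  fixes R :: "'b::comm_ring_1 set" and \<phi> :: "'b \<Rightarrow> 'k::field"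
  assumes R: "subr R" and h: "hom_on R \<phi>"
begin

private lemma coeff_map: "poly.coeff (map_poly \<phi> p) i = \<phi> (poly.coeff p i)"
  by (simp add: coeff_map_poly hom_on_0[OF R h])

lemma map_poly_hom_add:
  "p \<in> polys_over R \<Longrightarrow> q \<in> polys_over R \<Longrightarrow> map_poly \<phi> (p + q) = map_poly \<phi> p + map_poly \<phi> q"
  by (intro poly_eqI) (simp add: coeff_map hom_on_add[OF h] polys_over_def)

lemma map_poly_hom_diff:
  "p \<in> polys_over R \<Longrightarrow> q \<in> polys_over R \<Longrightarrow> map_poly \<phi> (p - q) = map_poly \<phi> p - map_poly \<phi> q"
  by (intro poly_eqI) (simp add: coeff_map hom_on_diff[OF R h] polys_over_def)

lemma map_poly_hom_mult:
  assumes "p \<in> polys_over R" "q \<in> polys_over R"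
  shows "map_poly \<phi> (p * q) = map_poly \<phi> p * map_poly \<phi> q"
proof (intro poly_eqI)
  fix n
  have "\<phi> (\<Sum>i\<le>n. poly.coeff p i * poly.coeff q (n - i)) = (\<Sum>i\<le>n. \<phi> (poly.coeff p i) * \<phi> (poly.coeff q (n - i)))"
    using assms by (subst hom_on_sum[OF R h]) (auto simp: polys_over_def subr_mult[OF R] hom_on_mult[OF h])
  then show "poly.coeff (map_poly \<phi> (p * q)) n = poly.coeff (map_poly \<phi> p * map_poly \<phi> q) n"
    by (simp add: coeff_map coeff_mult)
qed

text \<open>R[x] is R[X] modulo the polynomials that vanish at x, so X -> \<xi> extends \<phi> as
  soon as these are sent to polynomials vanishing at \<xi>. This is also what makes the choice by
  \<open>SOME\<close> immaterial.\<close>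

lemma extend_hom:
  assumes ker: "\<And>q. q \<in> polys_over R \<Longrightarrow> poly q x = 0 \<Longrightarrow> poly (map_poly \<phi> q) \<xi> = 0"
  obtains \<psi> where "hom_on (adjoin R x) \<psi>"
    "\<And>q. q \<in> polys_over R \<Longrightarrow> \<psi> (poly q x) = poly (map_poly \<phi> q) \<xi>" "\<And>r. r \<in> R \<Longrightarrow> \<psi> r = \<phi> r"
proof -
  note P = subr_polys_over[OF R]
  define \<psi> where "\<psi> y = poly (map_poly \<phi> (SOME p. p \<in> polys_over R \<and> poly p x = y)) \<xi>" for y
  have \<psi>: "\<psi> (poly q x) = poly (map_poly \<phi> q) \<xi>" if q: "q \<in> polys_over R" for q
  proof -
    define p where "p = (SOME p. p \<in> polys_over R \<and> poly p x = poly q x)"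
    have p: "p \<in> polys_over R \<and> poly p x = poly q x" unfolding p_def by (rule someI[of _ q]) (use q in auto)
    then have "poly (map_poly \<phi> (p - q)) \<xi> = 0" using q by (intro ker subr_diff[OF P]) auto
    then show ?thesis using p q by (simp add: \<psi>_def p_def[symmetric] map_poly_hom_diff)
  qed
  have base: "\<psi> r = \<phi> r" if "r \<in> R" for r
    using \<psi>[of "[:r:]"] that by (simp add: polys_over_def coeff_pCons subr_0[OF R] map_poly_pCons hom_on_0[OF R h] split: nat.splits)
  have "hom_on (adjoin R x) \<psi>"
    unfolding hom_on_def adjoin_def
  proof (intro conjI ballI)
    show "\<psi> 1 = 1" using base[of 1] by (simp add: subr_1[OF R] hom_on_1[OF h])
    fix a b assume "a \<in> (\<lambda>p. poly p x) ` polys_over R" "b \<in> (\<lambda>p. poly p x) ` polys_over R"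
    then obtain p q where p: "p \<in> polys_over R" "a = poly p x" and q: "q \<in> polys_over R" "b = poly q x" by auto
    show "\<psi> (a + b) = \<psi> a + \<psi> b"
      using \<psi>[of "p + q"] \<psi>[of p] \<psi>[of q] p q by (simp add: subr_add[OF P] map_poly_hom_add)
    show "\<psi> (a * b) = \<psi> a * \<psi> b"
      using \<psi>[of "p * q"] \<psi>[of p] \<psi>[of q] p q by (simp add: subr_mult[OF P] map_poly_hom_mult)
  qed
  then show ?thesis using that \<psi> base by blast
qed

end

text \<open>Over a finite field, 1 plus the product of all X - a has no root.\<close>

lemma infinite_UNIV_alg_closed: "infinite (UNIV :: 'k::alg_closed_field set)"
proof
  assume fin: "finite (UNIV :: 'k set)"
  define p :: "'k poly" where "p = (\<Prod>a\<in>UNIV. [:- a, 1:]) + 1"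
  have dg: "Polynomial.degree (\<Prod>a\<in>UNIV. [:- a, 1:] :: 'k poly) = card (UNIV :: 'k set)"
    by (subst degree_prod_eq_sum_degree) auto
  then have "Polynomial.degree p = card (UNIV :: 'k set)"
    unfolding p_def using fin finite_UNIV_card_ge_0[OF fin]
    by (subst degree_add_eq_left) auto
  then have "Polynomial.degree p > 0" using finite_UNIV_card_ge_0[OF fin] by simp
  then obtain z where "poly p z = 0" using alg_closed_imp_poly_has_root by blast
  moreover have "poly (\<Prod>a\<in>UNIV. [:- a, 1:]) z = 0"
    using fin by (auto simp: poly_prod)
  ultimately show False by (simp add: p_def)
qed

text \<open>The leading coefficient of p need not be invertible in R, so q is multiplied by a power
  of it; each reduction step costs one factor.\<close>

lemma pseudo_division_over:
  assumes R: "subr R" and p: "p \<in> polys_over R" "p \<noteq> 0" and "q \<in> polys_over R"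
  shows "\<exists>e u r. u \<in> polys_over R \<and> r \<in> polys_over R \<and> Polynomial.smult (lead_coeff p ^ e) q = u * p + r \<and>
    (r = 0 \<or> Polynomial.degree r < Polynomial.degree p)"
  using assms(4)
proof (induction "Polynomial.degree q" arbitrary: q rule: less_induct)
  case less
  note P = subr_polys_over[OF R]
  define l where "l = lead_coeff p"
  have l: "l \<in> R" using p by (auto simp: l_def polys_over_def)
  show ?case
  proof (cases "q = 0 \<or> Polynomial.degree q < Polynomial.degree p")
    case True
    then show ?thesis using less.prems subr_0[OF P]
      by (intro exI[of _ 0] exI[of _ q]) auto
  next
    case False
    define m where "m = Polynomial.monom (lead_coeff q) (Polynomial.degree q - Polynomial.degree p)"
    define q' where "q' = Polynomial.smult l q - m * p"
    have m: "m \<in> polys_over R" using less.prems by (auto simp: m_def polys_over_def subr_0[OF R])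
    have q': "q' \<in> polys_over R" unfolding q'_def
      by (intro subr_diff[OF P] subr_mult[OF P] polys_over_smult R less.prems m l p)
    have "Polynomial.degree (m * p) \<le> Polynomial.degree q"
      using False unfolding m_def
      by (intro order_trans[OF degree_mult_le] order_trans[OF add_right_mono[OF degree_monom_le]]) auto
    then have deg: "Polynomial.degree q' \<le> Polynomial.degree q"
      unfolding q'_def by (intro degree_diff_le degree_smult_le)
    have "poly.coeff q' (Polynomial.degree q) = 0"
      using False by (simp add: q'_def m_def coeff_monom_mult l_def)
    then have "q' = 0 \<or> Polynomial.degree q' < Polynomial.degree q"
      using deg by (metis leading_coeff_0_iff le_neq_implies_less)
    then have "\<exists>e u r. u \<in> polys_over R \<and> r \<in> polys_over R \<and> Polynomial.smult (l ^ e) q' = u * p + r \<and>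
      (r = 0 \<or> Polynomial.degree r < Polynomial.degree p)"
    proof
      assume "q' = 0"
      then show ?thesis using subr_0[OF P] by (intro exI[of _ 0]) auto
    qed (use less.hyps[OF _ q'] in \<open>simp add: l_def\<close>)
    then obtain e u r where eur: "u \<in> polys_over R" "r \<in> polys_over R" "Polynomial.smult (l ^ e) q' = u * p + r"
      "r = 0 \<or> Polynomial.degree r < Polynomial.degree p" by blast
    have "Polynomial.smult (l ^ Suc e) q = Polynomial.smult (l ^ e) (q' + m * p)"
      by (simp add: q'_def mult.commute)
    also have "\<dots> = (u + Polynomial.smult (l ^ e) m) * p + r"
      by (simp add: smult_add_right eur(3) algebra_simps)
    finally show ?thesis
      using eur m unfolding l_def[symmetric]
      by (intro exI[of _ "Suc e"] exI[of _ "u + Polynomial.smult (l ^ e) m"] exI[of _ r])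
         (auto intro!: subr_add[OF P] polys_over_smult R subr_power l)
  qed
qed


text \<open>The coefficients come from a type with zero divisors, so the usual degree formula has to
  be drawn from \<open>dom_on R\<close>.\<close>

lemma coeff_degree_sum_nonzero:
  assumes "dom_on R" "u \<in> polys_over R" "v \<in> polys_over R" "u \<noteq> 0" "v \<noteq> 0"
  shows "Polynomial.degree (u * v) = Polynomial.degree u + Polynomial.degree v"
proof (rule antisym[OF degree_mult_le])
  have "lead_coeff u * lead_coeff v \<noteq> 0"
    using assms unfolding dom_on_def polys_over_def by (metis (mono_tags) leading_coeff_0_iff mem_Collect_eq)
  then show "Polynomial.degree u + Polynomial.degree v \<le> Polynomial.degree (u * v)"
    by (intro le_degree) (simp add: coeff_mult_degree_sum)
qed

text \<open>R[x] is a polynomial ring, so x may go to any \<xi>. If b = p(x), then a is the leading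
  coefficient of p: where it survives, the image of p is a nonzero polynomial, and \<xi> can be
  taken off its finitely many roots.\<close>

lemma hom_extension_transcendental:
  fixes R :: "'b::comm_ring_1 set"
  assumes R: "subr R"
    and tr: "\<And>p. p \<in> polys_over R \<Longrightarrow> poly p x = 0 \<Longrightarrow> p = 0" and b: "b \<in> adjoin R x" "b \<noteq> 0"
  shows "\<exists>a\<in>R. a \<noteq> 0 \<and> (\<forall>\<phi>::'b \<Rightarrow> 'k::alg_closed_field. hom_on R \<phi> \<and> \<phi> a \<noteq> 0 \<longrightarrow>
    (\<exists>\<psi>. hom_on (adjoin R x) \<psi> \<and> (\<forall>r\<in>R. \<psi> r = \<phi> r) \<and> \<psi> b \<noteq> 0))"
proof -
  obtain p where p: "p \<in> polys_over R" "b = poly p x" using b by (auto simp: adjoin_def)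
  have p0: "p \<noteq> 0" using b p by auto
  show ?thesis
  proof (intro bexI[of _ "lead_coeff p"] conjI allI impI)
    show "lead_coeff p \<in> R" using p by (auto simp: polys_over_def)
    show "lead_coeff p \<noteq> 0" using p0 by simp
    fix \<phi> :: "'b \<Rightarrow> 'k" assume \<phi>: "hom_on R \<phi> \<and> \<phi> (lead_coeff p) \<noteq> 0"
    then have "poly.coeff (map_poly \<phi> p) (Polynomial.degree p) \<noteq> 0"
      by (subst coeff_map_poly) (auto simp: hom_on_0[OF R])
    then have "map_poly \<phi> p \<noteq> 0" by auto
    then have "finite {\<xi>. poly (map_poly \<phi> p) \<xi> = 0}" by (rule poly_roots_finite)
    then obtain \<xi> where \<xi>: "poly (map_poly \<phi> p) \<xi> \<noteq> 0"
      using infinite_UNIV_alg_closed[where ?'k = 'k] by (metis (mono_tags, lifting) UNIV_eq_I mem_Collect_eq)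
    obtain \<psi> where "hom_on (adjoin R x) \<psi>"
      "\<And>q. q \<in> polys_over R \<Longrightarrow> \<psi> (poly q x) = poly (map_poly \<phi> q) \<xi>" "\<And>r. r \<in> R \<Longrightarrow> \<psi> r = \<phi> r"
    proof (rule extend_hom[OF R conjunct1[OF \<phi>], of x \<xi>])
      fix q assume "q \<in> polys_over R" "poly q x = 0"
      then have "q = 0" by (rule tr)
      then show "poly (map_poly \<phi> q) \<xi> = 0" by simp
    qed blast
    then show "\<exists>\<psi>. hom_on (adjoin R x) \<psi> \<and> (\<forall>r\<in>R. \<psi> r = \<phi> r) \<and> \<psi> b \<noteq> 0"
      using \<xi> p by (intro exI[of _ \<psi>]) auto
  qed
qed

text \<open>Here x must go to a root of the image of p, a polynomial of least degree annihilating x.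
  The element a = l c has two tasks: the leading coefficient l of p keeps the degree of the image
  positive and can be cancelled after pseudo-division by p, and c in R is a nonzero multiple of b,
  so that \<open>\<psi> b\<close> cannot vanish.\<close>

lemma hom_extension_algebraic:
  fixes R :: "'b::comm_ring_1 set"
  assumes R: "subr R" and D: "dom_on (adjoin R x)"
    and p0: "p0 \<in> polys_over R" "poly p0 x = 0" "p0 \<noteq> 0" and b: "b \<in> adjoin R x" "b \<noteq> 0"
  shows "\<exists>a\<in>R. a \<noteq> 0 \<and> (\<forall>\<phi>::'b \<Rightarrow> 'k::alg_closed_field. hom_on R \<phi> \<and> \<phi> a \<noteq> 0 \<longrightarrow>
    (\<exists>\<psi>. hom_on (adjoin R x) \<psi> \<and> (\<forall>r\<in>R. \<psi> r = \<phi> r) \<and> \<psi> b \<noteq> 0))"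
proof -
  note P = subr_polys_over[OF R] and A = subr_adjoin[OF R, of x]
  have RA: "R \<subseteq> adjoin R x" using adjoin_base[OF R] by auto
  then have DR: "dom_on R" using D dom_on_subset by blast
  have evA: "poly q x \<in> adjoin R x" if "q \<in> polys_over R" for q using that by (auto simp: adjoin_def)
  from ex_has_least_nat[of "\<lambda>p. p \<in> polys_over R \<and> poly p x = 0 \<and> p \<noteq> 0" p0 Polynomial.degree] p0
  obtain p where p: "p \<in> polys_over R" "poly p x = 0" "p \<noteq> 0"
    and pmin: "\<And>q. q \<in> polys_over R \<Longrightarrow> poly q x = 0 \<Longrightarrow> q \<noteq> 0 \<Longrightarrow> Polynomial.degree p \<le> Polynomial.degree q"
    by blast
  define l where "l = lead_coeff p"
  have l: "l \<in> R" "l \<noteq> 0" using p by (auto simp: l_def polys_over_def)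
  have lpow: "l ^ e \<noteq> 0" for e using dom_on_power[OF R DR l] .
  have deg_pos: "Polynomial.degree p > 0"
  proof (rule ccontr)
    assume "\<not> ?thesis"
    then obtain c where "p = [:c:]" by (auto elim: degree_eq_zeroE)
    then show False using p by simp
  qed
  obtain q0 where q0: "q0 \<in> polys_over R" "b = poly q0 x" using b by (auto simp: adjoin_def)
  \<comment> \<open>The polynomials that represent nonzero multiples of b. One of least degree turns
    out to be constant, which gives the element c.\<close>
  define W where "W d \<longleftrightarrow> d \<in> polys_over R \<and> poly d x \<noteq> 0 \<and> (\<exists>v\<in>adjoin R x. poly d x = v * b)" for d
  have "W q0" using q0 b subr_1[OF A] by (auto simp: W_def intro!: bexI[of _ 1])
  from ex_has_least_nat[of W, OF this, of Polynomial.degree]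
  obtain d where d: "W d" and dmin: "\<And>q. W q \<Longrightarrow> Polynomial.degree d \<le> Polynomial.degree q" by blast
  obtain v where v: "v \<in> adjoin R x" "poly d x = v * b" using d by (auto simp: W_def)
  have dR: "d \<in> polys_over R" "poly d x \<noteq> 0" using d by (auto simp: W_def)
  have d_lt: "Polynomial.degree d < Polynomial.degree p"
  proof -
    obtain e u r where eur: "u \<in> polys_over R" "r \<in> polys_over R" "Polynomial.smult (l ^ e) d = u * p + r"
      "r = 0 \<or> Polynomial.degree r < Polynomial.degree p"
      using pseudo_division_over[OF R p(1,3) dR(1)] unfolding l_def by blast
    from arg_cong[OF eur(3), of "\<lambda>q. poly q x"] have rx: "poly r x = l ^ e * poly d x" using p by simp
    have "l ^ e \<in> adjoin R x" using l RA subr_power[OF R] by blast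
    then have "poly r x \<noteq> 0" using D dR lpow[of e] evA[OF dR(1)] unfolding rx dom_on_def by blast
    moreover have "poly r x = (l ^ e * v) * b" by (simp add: rx v mult.assoc)
    ultimately have "W r" unfolding W_def
      using eur \<open>l ^ e \<in> adjoin R x\<close> v(1) subr_mult[OF A] by blast
    moreover have "r \<noteq> 0" using \<open>poly r x \<noteq> 0\<close> by auto
    ultimately show ?thesis using eur(4) dmin[of r] by auto
  qed
  \<comment> \<open>If d had positive degree, pseudo-division of p by d would leave a remainder that
    represents a multiple of b in smaller degree, hence vanishes at x and is zero; then the quotient
    would annihilate x in a degree below that of p.\<close>
  have deg0: "Polynomial.degree d = 0"
  proof (rule ccontr)
    assume nz: "Polynomial.degree d \<noteq> 0"
    then have d0: "d \<noteq> 0" by auto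
    define m where "m = lead_coeff d"
    have m: "m \<in> R" "m \<noteq> 0" using dR d0 by (auto simp: m_def polys_over_def)
    obtain e u r where eur: "u \<in> polys_over R" "r \<in> polys_over R" "Polynomial.smult (m ^ e) p = u * d + r"
      "r = 0 \<or> Polynomial.degree r < Polynomial.degree d"
      using pseudo_division_over[OF R dR(1) d0 p(1)] unfolding m_def by blast
    from arg_cong[OF eur(3), of "\<lambda>q. poly q x"] have rx: "poly u x * poly d x + poly r x = 0" using p by simp
    then have "poly r x = (- poly u x * v) * b" using v by (simp add: mult.assoc add_eq_0_iff)
    then have "W r" if "poly r x \<noteq> 0"
      unfolding W_def using that eur evA[OF eur(1)] v(1)
      by (auto intro!: bexI[of _ "- poly u x * v"] subr_mult[OF A] subr_uminus[OF A])
    then have "poly r x = 0" using dmin[of r] eur(4) by fastforce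
    then have r0: "r = 0" using pmin[of r] eur(2,4) d_lt by fastforce
    then have "poly u x * poly d x = 0" using rx by simp
    then have ux: "poly u x = 0" using D evA[OF eur(1)] evA[OF dR(1)] dR(2) unfolding dom_on_def by blast
    have me: "m ^ e \<noteq> 0" by (rule dom_on_power[OF R DR m])
    have "m ^ e * l \<noteq> 0" using DR me l subr_power[OF R m(1), of e] unfolding dom_on_def by blast
    then have deq: "Polynomial.degree (Polynomial.smult (m ^ e) p) = Polynomial.degree p"
      by (intro antisym degree_smult_le le_degree) (simp add: l_def)
    then have u0: "u \<noteq> 0" using eur(3) r0 deg_pos by auto
    have "Polynomial.degree p = Polynomial.degree u + Polynomial.degree d"
      using coeff_degree_sum_nonzero[OF DR eur(1) dR(1) u0 d0] eur(3) r0 deq by simp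
    then show False using pmin[OF eur(1) ux u0] nz by simp
  qed
  then obtain c where c: "d = [:c:]" by (auto elim: degree_eq_zeroE)
  have cR: "c \<in> R" "c \<noteq> 0" "c = v * b" using dR v c polys_over_pCons[of c 0 R] by simp_all
  show ?thesis
  proof (intro bexI[of _ "l * c"] conjI allI impI)
    show "l * c \<in> R" using l cR subr_mult[OF R] by blast
    show "l * c \<noteq> 0" using l cR DR unfolding dom_on_def by blast
    fix \<phi> :: "'b \<Rightarrow> 'k" assume "hom_on R \<phi> \<and> \<phi> (l * c) \<noteq> 0"
    then have h: "hom_on R \<phi>" and nz: "\<phi> l \<noteq> 0" "\<phi> c \<noteq> 0"
      using l cR by (auto simp: hom_on_mult)
    have "poly.coeff (map_poly \<phi> p) (Polynomial.degree p) \<noteq> 0"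
      using nz by (subst coeff_map_poly) (auto simp: hom_on_0[OF R h] l_def)
    then have "Polynomial.degree (map_poly \<phi> p) > 0" using deg_pos le_degree[of "map_poly \<phi> p"] by fastforce
    then obtain \<xi> where \<xi>: "poly (map_poly \<phi> p) \<xi> = 0" using alg_closed_imp_poly_has_root by blast
    have ker: "poly (map_poly \<phi> q) \<xi> = 0" if q: "q \<in> polys_over R" "poly q x = 0" for q
    proof -
      obtain e u r where eur: "u \<in> polys_over R" "r \<in> polys_over R" "Polynomial.smult (l ^ e) q = u * p + r"
        "r = 0 \<or> Polynomial.degree r < Polynomial.degree p"
        using pseudo_division_over[OF R p(1,3) q(1)] unfolding l_def by blast
      from arg_cong[OF eur(3), of "\<lambda>q. poly q x"] have "poly r x = 0" using p q by simp
      then have "r = 0" using pmin[of r] eur by fastforce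
      then have eq: "[:l ^ e:] * q = u * p" using eur(3) by simp
      have le: "[:l ^ e:] \<in> polys_over R" using subr_power[OF R l(1)] by (auto simp: polys_over_def subr_0[OF R] coeff_pCons split: nat.splits)
      have "map_poly \<phi> [:l ^ e:] * map_poly \<phi> q = map_poly \<phi> u * map_poly \<phi> p"
        using arg_cong[OF eq, of "map_poly \<phi>"] map_poly_hom_mult[OF R h le q(1)] map_poly_hom_mult[OF R h eur(1) p(1)] by simp
      then have "poly (map_poly \<phi> [:l ^ e:]) \<xi> * poly (map_poly \<phi> q) \<xi> = 0"
        using \<xi> by (metis mult_zero_right poly_mult)
      moreover have "poly (map_poly \<phi> [:l ^ e:]) \<xi> = \<phi> l ^ e"
        using lpow[of e] by (simp add: map_poly_pCons hom_on_0[OF R h] hom_on_power[OF R h l(1)])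
      ultimately show ?thesis using nz by simp
    qed
    obtain \<psi> where \<psi>: "hom_on (adjoin R x) \<psi>" "\<And>r. r \<in> R \<Longrightarrow> \<psi> r = \<phi> r"
      by (rule extend_hom[OF R h, of x \<xi>]) (erule (1) ker, blast)
    have "\<psi> c = \<psi> v * \<psi> b" using \<psi>(1) v(1) b cR(3) by (simp add: hom_on_mult)
    then have "\<psi> b \<noteq> 0" using nz \<psi>(2)[OF cR(1)] by auto
    then show "\<exists>\<psi>. hom_on (adjoin R x) \<psi> \<and> (\<forall>r\<in>R. \<psi> r = \<phi> r) \<and> \<psi> b \<noteq> 0" using \<psi> by blast
  qed
qed

text \<open>The algebraic core of Chevalley's theorem. The element b is carried along for the
  induction: the a' that one adjunction asks not to vanish is the b of the previous stage.\<close>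

theorem hom_extension:
  fixes R :: "'b::comm_ring_1 set"
  assumes R: "subr R" and F: "finite F" and D: "dom_on (ring_gen (R \<union> F))"
    and b: "b \<in> ring_gen (R \<union> F)" "b \<noteq> 0"
  shows "\<exists>a\<in>R. a \<noteq> 0 \<and> (\<forall>\<phi>::'b \<Rightarrow> 'k::alg_closed_field. hom_on R \<phi> \<and> \<phi> a \<noteq> 0 \<longrightarrow>
    (\<exists>\<psi>. hom_on (ring_gen (R \<union> F)) \<psi> \<and> (\<forall>r\<in>R. \<psi> r = \<phi> r) \<and> \<psi> b \<noteq> 0))"
  using F D b
proof (induction F arbitrary: b)
  case empty
  then show ?case using R by (intro bexI[of _ b]) (auto simp: ring_gen_subr)
next
  case (insert x F)
  define S where "S = ring_gen (R \<union> F)"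
  have S: "subr S" by (simp add: S_def subr_ring_gen)
  have eq: "ring_gen (R \<union> insert x F) = adjoin S x" by (simp add: S_def ring_gen_insert)
  have D: "dom_on (adjoin S x)" and b: "b \<in> adjoin S x" "b \<noteq> 0" using insert.prems unfolding eq by blast+
  have DS: "dom_on S" using D adjoin_base[OF S] dom_on_subset by blast
  have RS: "R \<subseteq> S" unfolding S_def by (auto intro: ring_gen.base)
  have "\<exists>a\<in>S. a \<noteq> 0 \<and> (\<forall>\<phi>::'b \<Rightarrow> 'k. hom_on S \<phi> \<and> \<phi> a \<noteq> 0 \<longrightarrow>
    (\<exists>\<psi>. hom_on (adjoin S x) \<psi> \<and> (\<forall>r\<in>S. \<psi> r = \<phi> r) \<and> \<psi> b \<noteq> 0))"
    using hom_extension_transcendental[OF S _ b] hom_extension_algebraic[OF S D _ _ _ b] by blast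
  then obtain a' where a': "a' \<in> S" "a' \<noteq> 0" and ext': "\<And>\<phi>::'b \<Rightarrow> 'k. hom_on S \<phi> \<Longrightarrow> \<phi> a' \<noteq> 0 \<Longrightarrow>
    \<exists>\<psi>. hom_on (adjoin S x) \<psi> \<and> (\<forall>r\<in>S. \<psi> r = \<phi> r) \<and> \<psi> b \<noteq> 0" by blast
  obtain a where a: "a \<in> R" "a \<noteq> 0" and ext: "\<And>\<phi>::'b \<Rightarrow> 'k. hom_on R \<phi> \<Longrightarrow> \<phi> a \<noteq> 0 \<Longrightarrow>
    \<exists>\<psi>. hom_on S \<psi> \<and> (\<forall>r\<in>R. \<psi> r = \<phi> r) \<and> \<psi> a' \<noteq> 0"
    using insert.IH[of a'] DS a' unfolding S_def by blast
  show ?case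
    unfolding eq
  proof (intro bexI[of _ a] conjI allI impI a)
    fix \<phi> :: "'b \<Rightarrow> 'k" assume "hom_on R \<phi> \<and> \<phi> a \<noteq> 0"
    then obtain \<psi> where \<psi>: "hom_on S \<psi>" "\<forall>r\<in>R. \<psi> r = \<phi> r" "\<psi> a' \<noteq> 0" using ext by blast
    from ext'[OF this(1,3)] obtain \<chi> where "hom_on (adjoin S x) \<chi>" "\<forall>r\<in>S. \<chi> r = \<psi> r" "\<chi> b \<noteq> 0" by blast
    then show "\<exists>\<psi>. hom_on (adjoin S x) \<psi> \<and> (\<forall>r\<in>R. \<psi> r = \<phi> r) \<and> \<psi> b \<noteq> 0"
      using \<psi>(2) RS by (intro exI[of _ \<chi>]) auto
  qed
qed

section \<open>The local ring at a point\<close>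

lemmas fun_app = plus_fun_apply times_fun_apply zero_fun_apply one_fun_apply minus_apply uminus_apply

text \<open>The induction methods produce eta-expanded goals, on which these rules would push
  applications inside.\<close>
declare fun_app [simp del]

text \<open>The coordinate ring of the set traced out by the functions \<open>y i\<close>. As it
  consists of functions, the quotient by the vanishing ideal is already taken.\<close>

definition polyfun :: "('n::finite \<Rightarrow> 'x \<Rightarrow> 'k::field) \<Rightarrow> ('x \<Rightarrow> 'k) set" where
  "polyfun y = ring_gen (range (\<lambda>c _. c) \<union> range y)"

lemma subr_polyfun: "subr (polyfun y)"
  by (simp add: polyfun_def subr_ring_gen)

lemma polyfun_const: "(\<lambda>_. c) \<in> polyfun y"
  and polyfun_coord: "y i \<in> polyfun y"
  by (auto simp: polyfun_def intro: ring_gen.base)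

lemma polyfun_induct [consumes 1, case_names const coord uminus add mult]:
  assumes "p \<in> polyfun y" "\<And>c. P (\<lambda>_. c)" "\<And>i. P (y i)" "\<And>p. p \<in> polyfun y \<Longrightarrow> P p \<Longrightarrow> P (- p)"
    "\<And>p q. p \<in> polyfun y \<Longrightarrow> q \<in> polyfun y \<Longrightarrow> P p \<Longrightarrow> P q \<Longrightarrow> P (p + q)"
    "\<And>p q. p \<in> polyfun y \<Longrightarrow> q \<in> polyfun y \<Longrightarrow> P p \<Longrightarrow> P q \<Longrightarrow> P (p * q)"
  shows "P p"
  using assms(1) unfolding polyfun_def
proof induction
  case (base x)
  then show ?case using assms(2,3) by auto
next
  case one
  then show ?case using assms(2)[of 1] by (simp add: one_fun_def)
qed (use assms in \<open>auto simp: polyfun_def\<close>)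

section \<open>Powers of the maximal ideal at a point, and the local ring\<close>

context
  fixes y :: "'n::finite \<Rightarrow> 'x \<Rightarrow> 'k::field" and b :: 'x
begin

text \<open>Membership in the k-th power of the maximal ideal of \<open>polyfun y\<close> at b,
  which is generated by the functions \<open>y i\<close> minus their values at b.\<close>

inductive mpow :: "nat \<Rightarrow> ('x \<Rightarrow> 'k) \<Rightarrow> bool" where
  zero: "mpow k 0"
| poly: "a \<in> polyfun y \<Longrightarrow> mpow 0 a"
| coord: "mpow k a \<Longrightarrow> mpow (Suc k) ((y i - (\<lambda>_. y i b)) * a)"
| add: "mpow k a \<Longrightarrow> mpow k a' \<Longrightarrow> mpow k (a + a')"
| mult: "p \<in> polyfun y \<Longrightarrow> mpow k a \<Longrightarrow> mpow k (p * a)"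

lemmas pf = subr_0[OF subr_polyfun[of y]] subr_1[OF subr_polyfun[of y]]
  subr_add[OF subr_polyfun[of y]] subr_mult[OF subr_polyfun[of y]] subr_diff[OF subr_polyfun[of y]]
  subr_uminus[OF subr_polyfun[of y]] polyfun_const[of _ y] polyfun_coord[of y]

lemma mpow_polyfun: "mpow k a \<Longrightarrow> a \<in> polyfun y"
  by (induction rule: mpow.induct) (auto intro: pf)

lemma mpow_Suc: "mpow (Suc k) a \<Longrightarrow> mpow k a"
proof -
  \<comment> \<open>The index must be a variable for rule induction; truncated subtraction makes the
    case j = 0 harmless.\<close>
  have "mpow j a \<Longrightarrow> mpow (j - 1) a" for j
    by (induction rule: mpow.induct) (auto intro: mpow.intros pf)
  from this[of "Suc k"] show "mpow (Suc k) a \<Longrightarrow> mpow k a" by simp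
qed

lemma mpow_mult: "mpow j a \<Longrightarrow> mpow k a' \<Longrightarrow> mpow (j + k) (a * a')"
  by (induction rule: mpow.induct)
     (auto simp: distrib_right mult.assoc intro: mpow.intros)

lemma mpow_sum: "(\<And>i. i \<in> I \<Longrightarrow> mpow k (f i)) \<Longrightarrow> mpow k (sum f I)"
  by (induction I rule: infinite_finite_induct) (auto intro: mpow.intros)

lemma mpow_vanish: "mpow (Suc k) a \<Longrightarrow> a b = 0"
proof -
  have "mpow j a \<Longrightarrow> 0 < j \<Longrightarrow> a b = 0" for j
    by (induction rule: mpow.induct) (auto simp: fun_app)
  then show "mpow (Suc k) a \<Longrightarrow> a b = 0" by auto
qed

lemma mpow_1:
  assumes "a \<in> polyfun y" "a b = 0"
  shows "mpow 1 a"
proof -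
  \<comment> \<open>The constant a(b) is subtracted to obtain a statement for all a that can be
    proved by induction. Products split as p q - p(b) q(b) = p (q - q(b)) + q(b) (p - p(b)).\<close>
  have "mpow 1 (a - (\<lambda>_. a b))"
    using assms(1)
  proof (induction rule: polyfun_induct)
    case (const c)
    then show ?case using mpow.zero[of 1] by (simp add: zero_fun_def fun_diff_def)
  next
    case (coord i)
    then show ?case using mpow.coord[OF mpow.poly[OF pf(2)], of i] by simp
  next
    case (uminus p)
    have "- p - (\<lambda>_. (- p) b) = (\<lambda>_. - 1) * (p - (\<lambda>_. p b))" by (auto simp: fun_eq_iff fun_app)
    then show ?case using mpow.mult[OF polyfun_const uminus(2)] by simp
  next
    case (add p q)
    have "p + q - (\<lambda>_. (p + q) b) = (p - (\<lambda>_. p b)) + (q - (\<lambda>_. q b))" by (auto simp: fun_eq_iff fun_app)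
    then show ?case using mpow.add[OF add(3,4)] by metis
  next
    case (mult p q)
    have "p * q - (\<lambda>_. (p * q) b) = p * (q - (\<lambda>_. q b)) + (\<lambda>_. q b) * (p - (\<lambda>_. p b))"
      by (auto simp: fun_eq_iff fun_app algebra_simps)
    then show ?case using mpow.add[OF mpow.mult[OF mult(1,4)] mpow.mult[OF polyfun_const mult(3)]] by simp
  qed
  moreover have "a - (\<lambda>_. a b) = a" using assms(2) by (auto simp: fun_eq_iff fun_app)
  ultimately show ?thesis by simp
qed

text \<open>The Rees algebra of the maximal ideal of the base point \<open>b\<close>.\<close>

definition rees :: "('x \<Rightarrow> 'k) poly set" where
  "rees = ring_gen (range (\<lambda>c. [:\<lambda>_. c:]) \<union> (range (\<lambda>i. [:y i:]) \<union>
     range (\<lambda>i. Polynomial.monom (y i - (\<lambda>_. y i b)) 1)))"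

lemma noeth_rees: "noeth rees"
  unfolding rees_def
proof (rule noeth_ring_gen)
  let ?K = "range (\<lambda>c. [:\<lambda>_. c:]) :: ('x \<Rightarrow> 'k) poly set"
  have k: "[:\<lambda>_. c:] + [:\<lambda>_. d:] = [:\<lambda>_. c + d:]" "[:\<lambda>_. c:] * [:\<lambda>_. d:] = [:\<lambda>_. c * d:]"
    "- [:\<lambda>_. c:] = [:\<lambda>_. - c:]" "1 = [:\<lambda>_. 1:]" for c d :: 'k
    by (auto simp: plus_fun_def times_fun_def fun_Compl_def one_pCons one_fun_def)
  show K: "subr ?K" unfolding subr_def by (auto simp only: k)
  show "noeth ?K"
  proof (rule noeth_field[OF K])
    fix x assume "x \<in> ?K" "x \<noteq> 0"
    then obtain c where c: "x = [:\<lambda>_. c:]" "c \<noteq> 0" by (force simp: zero_fun_def)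
    then have "[:\<lambda>_. 1 / c:] * x = 1" unfolding c(1) k by simp
    then show "\<exists>y\<in>?K. y * x = 1" by blast
  qed
qed auto

lemma subr_rees: "subr rees"
  by (simp add: rees_def subr_ring_gen)

text \<open>Together with \<open>rees_mpow\<close>: the coefficients of degree k in the Rees algebra
  form the k-th power of the maximal ideal.\<close>

lemma mpow_rees: "mpow k a \<Longrightarrow> Polynomial.monom a k \<in> rees"
proof (induction rule: mpow.induct)
  case (zero k)
  then show ?case by (simp add: subr_0 subr_rees)
next
  have poly: "Polynomial.monom a 0 \<in> rees" if "a \<in> polyfun y" for a
    using that
  proof (induction rule: polyfun_induct)
    case (uminus p)
    then show ?case using subr_uminus[OF subr_rees uminus(2)] by (simp add: monom_0)
  next
    case (add p q)
    then show ?case using subr_add[OF subr_rees] by (simp add: add_monom[symmetric])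
  next
    case (mult p q)
    then show ?case using subr_mult[OF subr_rees mult(3,4)] by (simp add: mult_monom)
  qed (auto simp: rees_def monom_0 intro!: ring_gen.base)
  case (poly a)
  then show ?case using \<open>\<And>a. a \<in> polyfun y \<Longrightarrow> Polynomial.monom a 0 \<in> rees\<close> by blast
  case (mult p k a)
  then show ?case using \<open>\<And>a. a \<in> polyfun y \<Longrightarrow> Polynomial.monom a 0 \<in> rees\<close>[of p]
      subr_mult[OF subr_rees, of "Polynomial.monom p 0" "Polynomial.monom a k"] by (simp add: mult_monom)
next
  case (coord k a i)
  have "Polynomial.monom (y i - (\<lambda>_. y i b)) 1 \<in> rees" by (auto simp: rees_def intro!: ring_gen.base)
  from subr_mult[OF subr_rees this coord(2)] show ?case by (simp add: mult_monom)
next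
  case (add k a a')
  then show ?case using subr_add[OF subr_rees] by (simp add: add_monom[symmetric])
qed

lemma rees_mpow: "q \<in> rees \<Longrightarrow> mpow j (poly.coeff q j)"
  unfolding rees_def
proof (induction arbitrary: j rule: ring_gen.induct)
  case (base x)
  have *: "mpow j (poly.coeff [:f:] j)" if "f \<in> polyfun y" for f
    using that by (cases j) (auto intro: mpow.poly mpow.zero)
  have "mpow 1 (y i - (\<lambda>_. y i b))" for i
    using mpow.coord[OF mpow.poly[OF pf(2)], of i] by simp
  then show ?case using base by (auto intro!: * pf mpow.zero)
next
  case one
  then show ?case by (cases j) (auto intro!: mpow.poly mpow.zero pf simp: coeff_1)
next
  case (uminus x)
  then show ?case using mpow.mult[OF polyfun_const uminus(2)[of j], of "-1"]
    by (simp add: times_fun_def fun_Compl_def)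
next
  case (add x x')
  then show ?case by (auto intro: mpow.add)
next
  case (mult p q)
  have "mpow j (poly.coeff p i * poly.coeff q (j - i))" if "i \<le> j" for i
    using mpow_mult[OF mult(3)[of i] mult(4)[of "j - i"]] that by simp
  then show ?case unfolding coeff_mult by (auto intro!: mpow_sum)
qed

text \<open>By noetherianity, some term of the sequence \<open>u k * p * t ^ k\<close> in the Rees algebra is a
  combination of the previous ones; compare the coefficients of that degree.\<close>

lemma krull_intersection:
  assumes p: "p \<in> polyfun y" and u: "\<And>k. \<exists>u\<in>polyfun y. u b \<noteq> 0 \<and> mpow k (u * p)"
  shows "\<exists>u\<in>polyfun y. u b \<noteq> 0 \<and> u * p = 0"
proof -
  obtain u where u: "\<And>k. u k \<in> polyfun y" "\<And>k. u k b \<noteq> 0" "\<And>k. mpow k (u k * p)"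
    using u by metis
  obtain N q where q: "\<forall>i<N. q i \<in> rees"
    "Polynomial.monom (u N * p) N = (\<Sum>i<N. q i * Polynomial.monom (u i * p) i)"
    using noeth_sequence[OF subr_rees noeth_rees, of "\<lambda>k. Polynomial.monom (u k * p) k"] mpow_rees[OF u(3)] by blast
  \<comment> \<open>The coefficient of degree N - i in \<open>q i\<close> lies in a positive power
    of the maximal ideal, so it vanishes at b. This makes
    \<open>u N - (\<Sum>i<N. c i * u i)\<close> nonzero at b, while it annihilates p.\<close>
  define c where "c i = poly.coeff (q i) (N - i)" for i
  have c: "mpow (N - i) (c i)" if "i < N" for i
    unfolding c_def using q(1) that rees_mpow by blast
  have c0: "c i b = 0" if "i < N" for i
    using c[OF that] that mpow_vanish[of "N - i - 1" "c i"] by (simp add: Suc_diff_Suc)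
  have "u N * p = (\<Sum>i<N. c i * (u i * p))"
    using arg_cong[OF q(2), of "\<lambda>q. poly.coeff q N"]
    by (simp add: coeff_sum mult.commute[of _ "Polynomial.monom _ _"] coeff_monom_mult)
       (simp add: c_def mult.commute)
  then have "(u N - (\<Sum>i<N. c i * u i)) * p = 0"
    by (simp add: left_diff_distrib sum_distrib_right mult.assoc)
  moreover have "(\<Sum>i<N. c i * u i) b = (\<Sum>i<N. c i b * u i b)"
    by (induction N) (auto simp: fun_app)
  then have "(u N - (\<Sum>i<N. c i * u i)) b \<noteq> 0" using c0 u(2) by (simp add: fun_app)
  moreover have "u N - (\<Sum>i<N. c i * u i) \<in> polyfun y"
    using u c mpow_polyfun by (intro subr_diff subr_sum subr_mult subr_polyfun) blast+
  ultimately show ?thesis by blast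
qed

text \<open>Functions that represent elements of the k-th power of the maximal ideal of the local
  ring at b. The denominator D is multiplied out, so the values of g at the zeros of D do not
  matter.\<close>

definition germ :: "nat \<Rightarrow> ('x \<Rightarrow> 'k) set" where
  "germ k = {g. \<exists>D\<in>polyfun y. D b \<noteq> 0 \<and> mpow k (D * g)}"

lemma germI: "D \<in> polyfun y \<Longrightarrow> D b \<noteq> 0 \<Longrightarrow> mpow k (D * g) \<Longrightarrow> g \<in> germ k"
  by (auto simp: germ_def)

lemma mpow_germ: "mpow k a \<Longrightarrow> a \<in> germ k"
  using germI[of 1 k a] by (simp add: pf fun_app)

lemma polyfun_germ: "a \<in> polyfun y \<Longrightarrow> a \<in> germ 0"
  by (simp add: mpow_germ mpow.poly)

lemma germ_Suc: "g \<in> germ (Suc k) \<Longrightarrow> g \<in> germ k"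
  by (auto simp: germ_def intro: mpow_Suc)

lemma germ_le: "j \<le> k \<Longrightarrow> g \<in> germ k \<Longrightarrow> g \<in> germ j"
  by (induction k rule: dec_induct) (auto dest: germ_Suc)

lemma germ_add: "g \<in> germ k \<Longrightarrow> g' \<in> germ k \<Longrightarrow> g + g' \<in> germ k"
proof -
  assume "g \<in> germ k" "g' \<in> germ k"
  then obtain D D' where D: "D \<in> polyfun y" "D b \<noteq> 0" "mpow k (D * g)" "D' \<in> polyfun y" "D' b \<noteq> 0" "mpow k (D' * g')"
    by (auto simp: germ_def)
  have "mpow k (D' * (D * g) + D * (D' * g'))" by (intro mpow.add mpow.mult D)
  moreover have "D' * (D * g) + D * (D' * g') = (D * D') * (g + g')" by (simp add: algebra_simps)
  ultimately show ?thesis using D by (intro germI[of "D * D'"]) (auto intro: pf simp: fun_app)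
qed

lemma germ_mult: "g \<in> germ j \<Longrightarrow> g' \<in> germ k \<Longrightarrow> g * g' \<in> germ (j + k)"
proof -
  assume "g \<in> germ j" "g' \<in> germ k"
  then obtain D D' where D: "D \<in> polyfun y" "D b \<noteq> 0" "mpow j (D * g)" "D' \<in> polyfun y" "D' b \<noteq> 0" "mpow k (D' * g')"
    by (auto simp: germ_def)
  have "mpow (j + k) ((D * g) * (D' * g'))" by (intro mpow_mult D)
  moreover have "(D * g) * (D' * g') = (D * D') * (g * g')" by (simp add: algebra_simps)
  ultimately show ?thesis using D by (intro germI[of "D * D'"]) (auto intro: pf simp: fun_app)
qed

lemma germ_polyfun_mult: "p \<in> polyfun y \<Longrightarrow> g \<in> germ k \<Longrightarrow> p * g \<in> germ k"
  using germ_mult[OF polyfun_germ] by fastforce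

lemma germ_uminus: "g \<in> germ k \<Longrightarrow> - g \<in> germ k"
  using germ_polyfun_mult[OF polyfun_const[of "-1"]] by (auto simp: times_fun_def fun_Compl_def)

lemma germ_diff: "g \<in> germ k \<Longrightarrow> g' \<in> germ k \<Longrightarrow> g - g' \<in> germ k"
  using germ_add[of g k "- g'"] germ_uminus[of g'] by simp

text \<open>The values of g on the zero set of E disappear when E is put into the
  denominator.\<close>

lemma germ_cong:
  assumes "E \<in> polyfun y" "E b \<noteq> 0" "\<And>x. E x \<noteq> 0 \<Longrightarrow> g x = g' x" "g' \<in> germ k"
  shows "g \<in> germ k"
proof -
  obtain D where D: "D \<in> polyfun y" "D b \<noteq> 0" "mpow k (D * g')" using assms(4) by (auto simp: germ_def)
  have "(E * D) * g = E * (D * g')" using assms(3) by (auto simp: fun_eq_iff fun_app)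
  then show ?thesis using D assms by (intro germI[of "E * D"]) (auto intro: pf mpow.mult simp: fun_app)
qed

lemma germ_inverse:
  assumes "g \<in> germ 0" "g b \<noteq> 0"
  shows "(\<lambda>x. 1 / g x) \<in> germ 0"
proof -
  obtain D where D: "D \<in> polyfun y" "D b \<noteq> 0" "mpow 0 (D * g)" using assms(1) by (auto simp: germ_def)
  let ?a = "D * g"
  have a: "?a \<in> polyfun y" using D mpow_polyfun by blast
  \<comment> \<open>The square makes the equation true everywhere: where g vanishes both sides are
    0, as 1 / 0 = 0. With a single factor \<open>?a\<close> the right side would be D, which may be
    nonzero there.\<close>
  have "(?a * ?a) * (\<lambda>x. 1 / g x) = ?a * D" by (auto simp: fun_eq_iff fun_app)
  then show ?thesis using D a assms
    by (intro germI[of "?a * ?a"]) (auto intro!: mpow.poly intro: pf simp: fun_app)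
qed

lemma germ_vanish:
  assumes "g \<in> germ 0" "g b = 0"
  shows "g \<in> germ 1"
proof -
  obtain D where D: "D \<in> polyfun y" "D b \<noteq> 0" "mpow 0 (D * g)" using assms(1) by (auto simp: germ_def)
  then have "mpow 1 (D * g)" using assms mpow_polyfun by (intro mpow_1) (auto simp: fun_app)
  then show ?thesis using D by (intro germI)
qed

section \<open>A self-map acting as a scalar on the cotangent space at the point\<close>

context
  fixes h :: "'x \<Rightarrow> 'x" and m :: 'k
  assumes cot: "\<And>i. (\<lambda>x. y i (h x) - y i b - m * (y i x - y i b)) \<in> germ 2"
begin

lemma germ_coord_comp: "(\<lambda>x. y i (h x)) \<in> germ 0"
proof -
  have "(\<lambda>x. y i (h x) - y i b - m * (y i x - y i b)) + ((\<lambda>_. y i b) + (\<lambda>_. m) * (y i - (\<lambda>_. y i b))) \<in> germ 0"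
    by (intro germ_add germ_le[OF _ cot] polyfun_germ subr_closed subr_polyfun polyfun_const polyfun_coord) auto
  moreover have "(\<lambda>x. y i (h x) - y i b - m * (y i x - y i b)) + ((\<lambda>_. y i b) + (\<lambda>_. m) * (y i - (\<lambda>_. y i b)))
    = (\<lambda>x. y i (h x))" by (auto simp: fun_eq_iff fun_app)
  ultimately show ?thesis by simp
qed

lemma germ_comp0:
  assumes "p \<in> polyfun y"
  shows "p \<circ> h \<in> germ 0"
  using assms
proof (induction rule: polyfun_induct)
  case (const c)
  then show ?case using polyfun_germ[OF polyfun_const] by (simp add: o_def)
next
  case (coord i)
  then show ?case using germ_coord_comp by (simp add: o_def)
next
  case (uminus p)
  then show ?case using germ_uminus by (fastforce simp: o_def fun_Compl_def)
next
  case (add p q)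
  then show ?case using germ_add[OF add(3,4)] by (simp add: o_def plus_fun_def)
next
  case (mult p q)
  then show ?case using germ_mult[OF mult(3,4)] by (simp add: o_def times_fun_def)
qed

lemma germ_comp1:
  assumes "p \<in> polyfun y"
  shows "(p \<circ> h) - p \<in> germ 1"
proof (rule germ_vanish)
  show "(p \<circ> h) - p \<in> germ 0" using assms by (intro germ_diff germ_comp0 polyfun_germ)
  \<comment> \<open>Elements of the square of the maximal ideal vanish at b, so \<open>cot\<close>
    evaluated at b says that h fixes the coordinates of b.\<close>
  have "y i (h b) = y i b" for i
  proof -
    obtain D where "D b \<noteq> 0" "mpow 2 (D * (\<lambda>x. y i (h x) - y i b - m * (y i x - y i b)))"
      using cot[of i] by (auto simp: germ_def)
    then have "D b * (y i (h b) - y i b) = 0"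
      using mpow_vanish[of 1 "D * (\<lambda>x. y i (h x) - y i b - m * (y i x - y i b))"] by (simp add: numeral_2_eq_2 fun_app)
    then show ?thesis using \<open>D b \<noteq> 0\<close> by simp
  qed
  with assms have "p (h b) = p b" by (induction rule: polyfun_induct) (auto simp: fun_app)
  then show "((p \<circ> h) - p) b = 0" by (simp add: fun_app)
qed

text \<open>Each of the k factors \<open>y i - (\<lambda>_. y i b)\<close> is multiplied by m up to
  terms of second order, and polynomial factors are unchanged up to first order by
  \<open>germ_comp1\<close>.\<close>

lemma germ_comp:
  assumes "mpow k a"
  shows "(a \<circ> h) - (\<lambda>x. m ^ k * a x) \<in> germ (Suc k)"
  using assms
proof (induction rule: mpow.induct)
  case (zero k)
  have "((0 :: 'x \<Rightarrow> 'k) \<circ> h) - (\<lambda>x. m ^ k * (0 :: 'x \<Rightarrow> 'k) x) = 0" by (auto simp: fun_eq_iff fun_app)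
  then show ?case using mpow_germ[OF mpow.zero] by metis
next
  case (poly a)
  then have "(a \<circ> h) - a \<in> germ (Suc 0)" using germ_comp1[of a] by simp
  then show ?case by (simp del: comp_apply)
next
  case (coord k a i)
  \<comment> \<open>With c o h = m c + r, where r has order two, (c a) o h - m^(k+1) c a equals r (a
    o h) + m c (a o h - m^k a). The summands have order 2 + k and 1 + (k + 1).\<close>
  let ?c = "y i - (\<lambda>_. y i b)" and ?r = "\<lambda>x. y i (h x) - y i b - m * (y i x - y i b)"
  have a: "a \<in> germ k" using coord by (simp add: mpow_germ)
  then have "(\<lambda>_. m ^ k) * a \<in> germ k" by (intro germ_polyfun_mult polyfun_const)
  then have "(\<lambda>_. m ^ k) * a + ((a \<circ> h) - (\<lambda>x. m ^ k * a x)) \<in> germ k"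
    using germ_Suc[OF coord(2)] by (intro germ_add)
  then have 1: "?r * ((\<lambda>_. m ^ k) * a + ((a \<circ> h) - (\<lambda>x. m ^ k * a x))) \<in> germ (2 + k)"
    using cot by (intro germ_mult)
  have "?c \<in> germ 1" by (intro germ_vanish polyfun_germ) (auto intro: pf simp: fun_app)
  then have "?c * ((a \<circ> h) - (\<lambda>x. m ^ k * a x)) \<in> germ (1 + Suc k)" using coord(2) by (intro germ_mult)
  then have "(\<lambda>_. m) * (?c * ((a \<circ> h) - (\<lambda>x. m ^ k * a x))) \<in> germ (2 + k)"
    using germ_polyfun_mult[OF polyfun_const] by simp
  from germ_add[OF 1 this] have "?r * ((\<lambda>_. m ^ k) * a + ((a \<circ> h) - (\<lambda>x. m ^ k * a x)))
     + (\<lambda>_. m) * (?c * ((a \<circ> h) - (\<lambda>x. m ^ k * a x))) \<in> germ (2 + k)" .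
  also have "?r * ((\<lambda>_. m ^ k) * a + ((a \<circ> h) - (\<lambda>x. m ^ k * a x))) + (\<lambda>_. m) * (?c * ((a \<circ> h) - (\<lambda>x. m ^ k * a x)))
     = ((?c * a) \<circ> h) - (\<lambda>x. m ^ Suc k * (?c * a) x)"
    by (auto simp: fun_eq_iff fun_app algebra_simps)
  finally show ?case by (simp del: comp_apply)
next
  case (add k a a')
  have "((a + a') \<circ> h) - (\<lambda>x. m ^ k * (a + a') x)
    = ((a \<circ> h) - (\<lambda>x. m ^ k * a x)) + ((a' \<circ> h) - (\<lambda>x. m ^ k * a' x))"
    by (auto simp: fun_eq_iff fun_app algebra_simps)
  then show ?case using germ_add[OF add(3,4)] by (simp del: comp_apply)
next
  case (mult p k a)
  have "((p \<circ> h) - p) * ((\<lambda>_. m ^ k) * a) \<in> germ (1 + k)"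
    using mult by (intro germ_mult germ_comp1 germ_polyfun_mult polyfun_const mpow_germ)
  moreover have "(p \<circ> h) * ((a \<circ> h) - (\<lambda>x. m ^ k * a x)) \<in> germ (0 + Suc k)"
    using mult by (intro germ_mult germ_comp0)
  ultimately have "((p \<circ> h) - p) * ((\<lambda>_. m ^ k) * a) + (p \<circ> h) * ((a \<circ> h) - (\<lambda>x. m ^ k * a x)) \<in> germ (Suc k)"
    by (intro germ_add) simp_all
  also have "((p \<circ> h) - p) * ((\<lambda>_. m ^ k) * a) + (p \<circ> h) * ((a \<circ> h) - (\<lambda>x. m ^ k * a x))
    = ((p * a) \<circ> h) - (\<lambda>x. m ^ k * (p * a) x)"
    by (auto simp: fun_eq_iff fun_app algebra_simps)
  finally show ?case .
qed

text \<open>On the \<open>k\<close>-th graded piece of the local ring, \<open>h\<close> acts as the scalar \<open>m ^ k\<close>, hence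
  injectively.\<close>

theorem comp_injective:
  assumes m: "m \<noteq> 0" and p: "p \<in> polyfun y"
    and E: "E \<in> polyfun y" "E b \<noteq> 0" "\<And>x. E x \<noteq> 0 \<Longrightarrow> p (h x) = 0"
  shows "\<exists>u\<in>polyfun y. u b \<noteq> 0 \<and> u * p = 0"
proof (rule krull_intersection[OF p])
  fix k
  \<comment> \<open>If D p has order k, then m^k D p agrees up to order k + 1 with (D p) o h, which
    is the zero germ because p o h vanishes wherever E does not. Since m is nonzero, the order of D
    p is at least k + 1.\<close>
  have "p \<in> germ k"
  proof (induction k)
    case 0
    then show ?case using p by (rule polyfun_germ)
  next
    case (Suc k)
    then obtain D where D: "D \<in> polyfun y" "D b \<noteq> 0" "mpow k (D * p)" by (auto simp: germ_def)
    have "((D * p) \<circ> h) \<in> germ (Suc k)"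
      using E by (intro germ_cong[of E "(D * p) \<circ> h" 0] mpow_germ mpow.zero) (auto simp: fun_app)
    then have "(\<lambda>_. 1 / m ^ k) * (((D * p) \<circ> h) - (((D * p) \<circ> h) - (\<lambda>x. m ^ k * (D * p) x))) \<in> germ (Suc k)"
      by (intro germ_polyfun_mult germ_diff germ_comp D polyfun_const)
    also have "(\<lambda>_. 1 / m ^ k) * (((D * p) \<circ> h) - (((D * p) \<circ> h) - (\<lambda>x. m ^ k * (D * p) x))) = D * p"
      using m by (auto simp: fun_eq_iff fun_app)
    finally obtain D' where D': "D' \<in> polyfun y" "D' b \<noteq> 0" "mpow (Suc k) (D' * (D * p))"
      by (auto simp: germ_def)
    then show ?case using D by (intro germI[of "D' * D"]) (auto intro: pf simp: mult.assoc fun_app)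
  qed
  then show "\<exists>u\<in>polyfun y. u b \<noteq> 0 \<and> mpow k (u * p)" by (auto simp: germ_def)
qed

end
end

section \<open>Dominant maps\<close>

lemma polyfun_comp: "p \<in> polyfun y \<Longrightarrow> p \<circ> f \<in> polyfun (\<lambda>i. y i \<circ> f)"
proof (induction rule: polyfun_induct)
  case (const c)
  then show ?case using polyfun_const[of c] by (simp add: o_def)
next
  case (coord i)
  then show ?case using polyfun_coord[of "\<lambda>i. y i \<circ> f" i] by (simp add: o_def)
next
  case (uminus p)
  then show ?case using subr_uminus[OF subr_polyfun uminus(2)] by (simp add: o_def fun_Compl_def)
next
  case (add p q)
  then show ?case using subr_add[OF subr_polyfun add(3,4)] by (simp add: o_def plus_fun_def)
next
  case (mult p q)
  then show ?case using subr_mult[OF subr_polyfun mult(3,4)] by (simp add: o_def times_fun_def)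
qed

lemma polyfun_comp_iff: "polyfun (\<lambda>i. y i \<circ> f) = (\<lambda>p. p \<circ> f) ` polyfun y"
proof
  show "(\<lambda>p. p \<circ> f) ` polyfun y \<subseteq> polyfun (\<lambda>i. y i \<circ> f)" using polyfun_comp by blast
  show "polyfun (\<lambda>i. y i \<circ> f) \<subseteq> (\<lambda>p. p \<circ> f) ` polyfun y"
  proof
    fix q assume "q \<in> polyfun (\<lambda>i. y i \<circ> f)"
    then show "q \<in> (\<lambda>p. p \<circ> f) ` polyfun y"
    proof (induction rule: polyfun_induct)
      case (const c)
      show "(\<lambda>_. c) \<in> (\<lambda>p. p \<circ> f) ` polyfun y" by (intro image_eqI[OF _ polyfun_const[of c]]) auto
    next
      case (coord i)
      show "y i \<circ> f \<in> (\<lambda>p. p \<circ> f) ` polyfun y" by (intro image_eqI[OF _ polyfun_coord]) auto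
    next
      case (uminus p)
      then obtain p' where "p = p' \<circ> f" "p' \<in> polyfun y" by blast
      then show "- p \<in> (\<lambda>p. p \<circ> f) ` polyfun y"
        by (intro image_eqI[OF _ subr_uminus[OF subr_polyfun, of p']]) (auto simp: fun_eq_iff fun_app)
    next
      case (add p q)
      then obtain p' q' where "p = p' \<circ> f" "p' \<in> polyfun y" "q = q' \<circ> f" "q' \<in> polyfun y" by blast
      then show "p + q \<in> (\<lambda>p. p \<circ> f) ` polyfun y"
        by (intro image_eqI[OF _ subr_add[OF subr_polyfun, of p' _ q']]) (auto simp: fun_eq_iff fun_app)
    next
      case (mult p q)
      then obtain p' q' where "p = p' \<circ> f" "p' \<in> polyfun y" "q = q' \<circ> f" "q' \<in> polyfun y" by blast
      then show "p * q \<in> (\<lambda>p. p \<circ> f) ` polyfun y"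
        by (intro image_eqI[OF _ subr_mult[OF subr_polyfun, of p' _ q']]) (auto simp: fun_eq_iff fun_app)
    qed
  qed
qed

text \<open>Functions on the open set where E is nonzero are modelled as total functions g with g o
  \<rho> = g, where \<rho> retracts everything to that set. Clearing denominators with powers of E
  brings a zero product back to \<open>polyfun y\<close>.\<close>

lemma dom_on_localization:
  fixes y :: "'n::finite \<Rightarrow> 'x \<Rightarrow> 'k::field"
  assumes D: "dom_on (polyfun y)" and E: "E \<in> polyfun y" "E b \<noteq> 0"
    and \<rho>: "\<rho> = (\<lambda>x. if E x \<noteq> 0 then x else b)"
    and G: "\<And>g. g \<in> G \<Longrightarrow> \<exists>f\<in>polyfun y. \<exists>N. \<forall>x. E x \<noteq> 0 \<longrightarrow> E x ^ N * g x = f x"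
      "\<And>g x. g \<in> G \<Longrightarrow> g (\<rho> x) = g x"
  shows "dom_on (ring_gen G)"
proof -
  have *: "(\<exists>f\<in>polyfun y. \<exists>N. \<forall>x. E x \<noteq> 0 \<longrightarrow> E x ^ N * g x = f x) \<and> (\<forall>x. g (\<rho> x) = g x)"
    if "g \<in> ring_gen G" for g
    using that
  proof (induction)
    case (base x)
    then show ?case using G by blast
  next
    case one
    show ?case by (auto simp: fun_app intro!: bexI[of _ 1] exI[of _ 0] subr_1 subr_polyfun)
  next
    case (uminus g)
    then obtain f N where fN: "f \<in> polyfun y" "\<forall>x. E x \<noteq> 0 \<longrightarrow> E x ^ N * g x = f x" by blast
    have "\<forall>x. E x \<noteq> 0 \<longrightarrow> E x ^ N * (- g) x = (- f) x" using fN by (simp add: fun_app)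
    moreover have "\<forall>x. (- g) (\<rho> x) = (- g) x" using uminus.IH by (simp add: fun_app)
    ultimately show ?case using subr_uminus[OF subr_polyfun fN(1)] by blast
  next
    case (add g g')
    then obtain f N f' N' where fN: "f \<in> polyfun y" "\<forall>x. E x \<noteq> 0 \<longrightarrow> E x ^ N * g x = f x"
      "f' \<in> polyfun y" "\<forall>x. E x \<noteq> 0 \<longrightarrow> E x ^ N' * g' x = f' x" by blast
    have pw: "(E ^ k) x = E x ^ k" for k x by (induction k) (auto simp: fun_app)
    have "\<forall>x. E x \<noteq> 0 \<longrightarrow> E x ^ (N + N') * (g + g') x = (E ^ N' * f + E ^ N * f') x"
      using fN by (auto simp: fun_app pw power_add algebra_simps)
    moreover have "E ^ N' * f + E ^ N * f' \<in> polyfun y"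
      using fN E by (intro subr_closed subr_polyfun)
    moreover have "\<forall>x. (g + g') (\<rho> x) = (g + g') x" using add.IH by (simp add: fun_app)
    ultimately show ?case by blast
  next
    case (mult g g')
    then obtain f N f' N' where fN: "f \<in> polyfun y" "\<forall>x. E x \<noteq> 0 \<longrightarrow> E x ^ N * g x = f x"
      "f' \<in> polyfun y" "\<forall>x. E x \<noteq> 0 \<longrightarrow> E x ^ N' * g' x = f' x" by blast
    have "E x ^ (N + N') * (g * g') x = (f * f') x" if "E x \<noteq> 0" for x
    proof -
      have "E x ^ (N + N') * (g * g') x = (E x ^ N * g x) * (E x ^ N' * g' x)"
        by (simp add: fun_app power_add)
      then show ?thesis using fN that by (simp add: fun_app)
    qed
    moreover have "f * f' \<in> polyfun y" using fN by (intro subr_mult subr_polyfun)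
    moreover have "\<forall>x. (g * g') (\<rho> x) = (g * g') x" using mult.IH by (simp add: fun_app)
    ultimately show ?case by blast
  qed
  show ?thesis
    unfolding dom_on_def
  proof (intro ballI impI)
    fix g g' assume g: "g \<in> ring_gen G" and g': "g' \<in> ring_gen G" and gg: "g * g' = 0"
    obtain f N where f: "f \<in> polyfun y" "\<forall>x. E x \<noteq> 0 \<longrightarrow> E x ^ N * g x = f x" using *[OF g] by blast
    obtain f' N' where f': "f' \<in> polyfun y" "\<forall>x. E x \<noteq> 0 \<longrightarrow> E x ^ N' * g' x = f' x" using *[OF g'] by blast
    have z: "g x = 0 \<or> g' x = 0" for x using fun_cong[OF gg, of x] by (simp add: fun_app)
    \<comment> \<open>The numerators are controlled only where E is nonzero; the extra factor E
      takes care of the other points.\<close>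
    have "f * (f' * E) = 0"
    proof
      fix x show "(f * (f' * E)) x = 0 x"
        using f(2)[rule_format, of x] f'(2)[rule_format, of x] z[of x] by (cases "E x = 0") (auto simp: fun_app)
    qed
    moreover have "f' * E \<in> polyfun y" using f' E by (intro subr_mult subr_polyfun)
    ultimately have "f = 0 \<or> f' * E = 0" using D f(1) unfolding dom_on_def by blast
    then have "f = 0 \<or> f' = 0 \<or> E = 0" using D f'(1) E(1) unfolding dom_on_def by blast
    then have "f = 0 \<or> f' = 0" using E(2) by (auto simp: fun_app)
    then have "(\<forall>x. E x \<noteq> 0 \<longrightarrow> g x = 0) \<or> (\<forall>x. E x \<noteq> 0 \<longrightarrow> g' x = 0)"
      using f(2) f'(2) by (auto simp: fun_app)
    then have "(\<forall>x. g (\<rho> x) = 0) \<or> (\<forall>x. g' (\<rho> x) = 0)" using E(2) by (auto simp: \<rho>)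
    moreover have "\<forall>x. g (\<rho> x) = g x" "\<forall>x. g' (\<rho> x) = g' x" using *[OF g] *[OF g'] by blast+
    ultimately show "g = 0 \<or> g' = 0" by (simp add: fun_eq_iff fun_app)
  qed
qed

text \<open>Below, \<open>\<psi>\<close> is the evaluation at a preimage of \<open>Q\<close>, whose coordinates are \<open>\<psi> (y i)\<close>.\<close>

theorem dominant_image:
  fixes y :: "'n::finite \<Rightarrow> 'x \<Rightarrow> 'k::alg_closed_field"
  assumes D: "dom_on (polyfun y)" and E: "E \<in> polyfun y" "E b \<noteq> 0"
    and F: "\<And>i. F i \<in> polyfun y" and h: "\<And>i x. E x \<noteq> 0 \<Longrightarrow> y i (h x) = F i x / E x"
    and inj: "\<And>p. p \<in> polyfun y \<Longrightarrow> (\<And>x. E x \<noteq> 0 \<Longrightarrow> p (h x) = 0) \<Longrightarrow> p = 0"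
  shows "\<exists>a\<in>polyfun y. a \<noteq> 0 \<and> (\<forall>Q. a Q \<noteq> 0 \<longrightarrow>
    (\<exists>\<psi>. hom_on (polyfun y) \<psi> \<and> (\<forall>c. \<psi> (\<lambda>_. c) = c) \<and> \<psi> E \<noteq> 0 \<and> (\<forall>i. \<psi> (F i) = y i Q * \<psi> E)))"
proof -
  define \<rho> where "\<rho> = (\<lambda>x. if E x \<noteq> 0 then x else b)"
  have \<rho>: "E (\<rho> x) \<noteq> 0" "\<rho> (\<rho> x) = \<rho> x" for x using E by (auto simp: \<rho>_def)
  define e where "e = (\<lambda>x. 1 / E (\<rho> x))"
  \<comment> \<open>R is the image of \<open>polyfun y\<close> under pullback along h. Adding the
    coordinates and 1 / E gives the coordinate ring of the open set where E is nonzero, which is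
    therefore finitely generated over R.\<close>
  define R where "R = polyfun (\<lambda>i. y i \<circ> (h \<circ> \<rho>))"
  define G where "G = range (\<lambda>i. y i \<circ> \<rho>) \<union> {e}"
  let ?S = "ring_gen (R \<union> G)"
  have R: "subr R" by (simp add: R_def subr_polyfun)
  have R_eq: "R = (\<lambda>p. p \<circ> (h \<circ> \<rho>)) ` polyfun y" unfolding R_def by (rule polyfun_comp_iff)
  have S: "subr ?S" by (rule subr_ring_gen)
  have RS: "R \<subseteq> ?S" by (auto intro: ring_gen.base)
  have constR: "(\<lambda>_. c) \<in> R" for c by (simp add: R_def polyfun_const)
  have inj': "p = q" if "p \<in> polyfun y" "q \<in> polyfun y" "p \<circ> (h \<circ> \<rho>) = q \<circ> (h \<circ> \<rho>)" for p q
  proof -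
    have "p - q = 0"
    proof (rule inj)
      show "p - q \<in> polyfun y" using that by (intro subr_diff subr_polyfun)
      fix x assume "E x \<noteq> 0"
      then have "\<rho> x = x" by (simp add: \<rho>_def)
      then show "(p - q) (h x) = 0" using fun_cong[OF that(3), of x] by (simp add: fun_app)
    qed
    then show ?thesis by simp
  qed
  have gen: "(\<exists>f\<in>polyfun y. \<exists>N. \<forall>x. E x \<noteq> 0 \<longrightarrow> E x ^ N * g x = f x) \<and> (\<forall>x. g (\<rho> x) = g x)"
    if g: "g \<in> range (\<lambda>c _. c) \<union> range (\<lambda>i. y i \<circ> (h \<circ> \<rho>)) \<union> G" for g
  proof -
    consider c where "g = (\<lambda>_. c)" | i where "g = y i \<circ> (h \<circ> \<rho>)" | i where "g = y i \<circ> \<rho>" | "g = e"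
      using g unfolding G_def by blast
    then show ?thesis
    proof cases
      case 1
      then show ?thesis by (auto intro!: bexI[of _ "\<lambda>_. c"] exI[of _ 0] polyfun_const)
    next
      case 2
      then show ?thesis by (auto simp: \<rho> intro!: bexI[OF _ F[of i]] exI[of _ 1]) (simp add: \<rho>_def h)
    next
      case 3
      then show ?thesis by (auto simp: \<rho> intro!: bexI[OF _ polyfun_coord[of y i]] exI[of _ 0]) (simp add: \<rho>_def)
    next
      case 4
      then show ?thesis
        by (auto simp: \<rho> e_def intro!: bexI[OF _ polyfun_const[of 1]] exI[of _ 1]) (simp add: \<rho>_def)
    qed
  qed
  have S_eq: "?S = ring_gen (range (\<lambda>c _. c) \<union> range (\<lambda>i. y i \<circ> (h \<circ> \<rho>)) \<union> G)"
  proof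
    show "?S \<subseteq> ring_gen (range (\<lambda>c _. c) \<union> range (\<lambda>i. y i \<circ> (h \<circ> \<rho>)) \<union> G)"
    proof (intro ring_gen_least subr_ring_gen Un_least)
      show "R \<subseteq> ring_gen (range (\<lambda>c _. c) \<union> range (\<lambda>i. y i \<circ> (h \<circ> \<rho>)) \<union> G)"
        unfolding R_def polyfun_def by (intro ring_gen_mono) blast
    qed (auto intro: ring_gen.base)
    show "ring_gen (range (\<lambda>c _. c) \<union> range (\<lambda>i. y i \<circ> (h \<circ> \<rho>)) \<union> G) \<subseteq> ?S"
      unfolding R_def polyfun_def
      by (intro ring_gen_mono) (auto intro: ring_gen.base)
  qed
  have DS: "dom_on ?S"
    unfolding S_eq by (rule dom_on_localization[OF D E \<rho>_def]) (use gen in blast)+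
  have "finite G" by (simp add: G_def)
  from hom_extension[OF R this DS ring_gen.one, where ?'k = 'k]
  obtain a' where a': "a' \<in> R" "a' \<noteq> 0" and ext: "\<And>\<phi>::('x \<Rightarrow> 'k) \<Rightarrow> 'k. hom_on R \<phi> \<Longrightarrow> \<phi> a' \<noteq> 0 \<Longrightarrow>
    \<exists>\<psi>. hom_on ?S \<psi> \<and> (\<forall>r\<in>R. \<psi> r = \<phi> r)" using one_neq_zero by blast
  obtain a where a: "a \<in> polyfun y" "a' = a \<circ> (h \<circ> \<rho>)" using a' R_eq by auto
  have "a \<noteq> 0" using a a'(2) by (auto simp: fun_eq_iff fun_app)
  moreover have "\<exists>\<psi>. hom_on (polyfun y) \<psi> \<and> (\<forall>c. \<psi> (\<lambda>_. c) = c) \<and> \<psi> E \<noteq> 0 \<and> (\<forall>i. \<psi> (F i) = y i Q * \<psi> E)"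
    if Q: "a Q \<noteq> 0" for Q
  proof -
    \<comment> \<open>Evaluation at Q, moved to R: by \<open>inj'\<close> an element of R is the
      pullback of exactly one polynomial function.\<close>
    define \<phi> where "\<phi> r = (THE p. p \<in> polyfun y \<and> r = p \<circ> (h \<circ> \<rho>)) Q" for r
    have \<phi>: "\<phi> (p \<circ> (h \<circ> \<rho>)) = p Q" if "p \<in> polyfun y" for p
    proof -
      have "(THE p'. p' \<in> polyfun y \<and> p \<circ> (h \<circ> \<rho>) = p' \<circ> (h \<circ> \<rho>)) = p"
        using that inj' by (intro the_equality) blast+
      then show ?thesis unfolding \<phi>_def by (rule fun_cong)
    qed
    have "hom_on R \<phi>"
      unfolding hom_on_def R_eq
    proof (intro conjI ballI)
      show "\<phi> 1 = 1" using \<phi>[OF polyfun_const[of 1]] by (simp add: o_def one_fun_def)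
      fix r s assume "r \<in> (\<lambda>p. p \<circ> (h \<circ> \<rho>)) ` polyfun y" "s \<in> (\<lambda>p. p \<circ> (h \<circ> \<rho>)) ` polyfun y"
      then obtain p q where p: "p \<in> polyfun y" "r = p \<circ> (h \<circ> \<rho>)" and q: "q \<in> polyfun y" "s = q \<circ> (h \<circ> \<rho>)"
        by blast
      have "r + s = (p + q) \<circ> (h \<circ> \<rho>)" "r * s = (p * q) \<circ> (h \<circ> \<rho>)"
        using p q by (auto simp: fun_eq_iff fun_app)
      moreover have "p + q \<in> polyfun y" "p * q \<in> polyfun y" using p(1) q(1) by (simp_all add: subr_add[OF subr_polyfun] subr_mult[OF subr_polyfun])
      ultimately show "\<phi> (r + s) = \<phi> r + \<phi> s" "\<phi> (r * s) = \<phi> r * \<phi> s"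
        using \<phi> p q by (simp_all del: o_apply add: fun_app)
    qed
    moreover have "\<phi> a' \<noteq> 0" using \<phi> a Q by simp
    ultimately obtain \<psi> where \<psi>: "hom_on ?S \<psi>" "\<forall>r\<in>R. \<psi> r = \<phi> r" using ext by blast
    have \<psi>c: "\<psi> (\<lambda>_. c) = c" for c
    proof -
      have "\<phi> (\<lambda>_. c) = c" using \<phi>[OF polyfun_const[of c]] by (simp add: o_def)
      then show ?thesis using \<psi>(2) constR by simp
    qed
    have "polyfun (\<lambda>i. y i \<circ> \<rho>) \<subseteq> ?S"
      unfolding polyfun_def using constR
      by (intro ring_gen_least subr_ring_gen) (auto simp: G_def intro: ring_gen.base)
    then have inS: "p \<circ> \<rho> \<in> ?S" if "p \<in> polyfun y" for p using polyfun_comp[OF that, of \<rho>] by blast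
    have "hom_on (polyfun y) (\<lambda>p. \<psi> (p \<circ> \<rho>))"
      unfolding hom_on_def
    proof (intro conjI ballI)
      show "\<psi> (1 \<circ> \<rho>) = 1" using \<psi>c[of 1] by (simp add: o_def fun_app)
      fix p q assume "p \<in> polyfun y" "q \<in> polyfun y"
      then have "p \<circ> \<rho> \<in> ?S" "q \<circ> \<rho> \<in> ?S" by (auto intro: inS)
      moreover have "(p + q) \<circ> \<rho> = (p \<circ> \<rho>) + (q \<circ> \<rho>)" "(p * q) \<circ> \<rho> = (p \<circ> \<rho>) * (q \<circ> \<rho>)"
        by (auto simp: fun_eq_iff fun_app)
      ultimately show "\<psi> ((p + q) \<circ> \<rho>) = \<psi> (p \<circ> \<rho>) + \<psi> (q \<circ> \<rho>)" "\<psi> ((p * q) \<circ> \<rho>) = \<psi> (p \<circ> \<rho>) * \<psi> (q \<circ> \<rho>)"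
        using \<psi>(1) unfolding hom_on_def by auto
    qed
    moreover have "\<psi> (E \<circ> \<rho>) \<noteq> 0"
    proof -
      have "(E \<circ> \<rho>) * e = 1" using \<rho> by (auto simp: fun_eq_iff fun_app e_def)
      moreover have "e \<in> ?S" by (auto simp: G_def intro: ring_gen.base)
      ultimately have "\<psi> (E \<circ> \<rho>) * \<psi> e = 1"
        using hom_on_mult[OF \<psi>(1) inS[OF E(1)], of e] hom_on_1[OF \<psi>(1)] by simp
      then show ?thesis by auto
    qed
    moreover have "\<psi> (F i \<circ> \<rho>) = y i Q * \<psi> (E \<circ> \<rho>)" for i
    proof -
      have "F i \<circ> \<rho> = (y i \<circ> (h \<circ> \<rho>)) * (E \<circ> \<rho>)" using h \<rho> by (auto simp: fun_eq_iff fun_app)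
      moreover have yR: "y i \<circ> (h \<circ> \<rho>) \<in> R" unfolding R_def using polyfun_coord[of "\<lambda>i. y i \<circ> (h \<circ> \<rho>)" i] .
      ultimately have "\<psi> (F i \<circ> \<rho>) = \<psi> (y i \<circ> (h \<circ> \<rho>)) * \<psi> (E \<circ> \<rho>)"
        using hom_on_mult[OF \<psi>(1) _ inS[OF E(1)], of "y i \<circ> (h \<circ> \<rho>)"] RS by auto
      then show ?thesis using \<psi>(2) yR \<phi>[OF polyfun_coord[of y i]] by simp
    qed
    ultimately show ?thesis using \<psi>c by (intro exI[of _ "\<lambda>p. \<psi> (p \<circ> \<rho>)"]) (auto simp: o_def)
  qed
  ultimately show ?thesis using a(1) by blast
qed

section \<open>Polynomial functions on projective varieties\<close>

lemma polyfun_add': "p \<in> polyfun y \<Longrightarrow> q \<in> polyfun y \<Longrightarrow> (\<lambda>x. p x + q x) \<in> polyfun y"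
  using subr_add[OF subr_polyfun] by (fastforce simp: plus_fun_def)

lemma polyfun_mult': "p \<in> polyfun y \<Longrightarrow> q \<in> polyfun y \<Longrightarrow> (\<lambda>x. p x * q x) \<in> polyfun y"
  using subr_mult[OF subr_polyfun] by (fastforce simp: times_fun_def)

lemma polyfun_diff': "p \<in> polyfun y \<Longrightarrow> q \<in> polyfun y \<Longrightarrow> (\<lambda>x. p x - q x) \<in> polyfun y"
  using subr_diff[OF subr_polyfun] by (fastforce simp: fun_diff_def)

lemma polyfun_sum': "(\<And>i. i \<in> I \<Longrightarrow> f i \<in> polyfun y) \<Longrightarrow> (\<lambda>x. \<Sum>i\<in>I. f i x) \<in> polyfun y"
  by (induction I rule: infinite_finite_induct) (auto intro: polyfun_const polyfun_add')

lemma polyfun_prod': "(\<And>i. i \<in> I \<Longrightarrow> f i \<in> polyfun y) \<Longrightarrow> (\<lambda>x. \<Prod>i\<in>I. f i x) \<in> polyfun y"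
  by (induction I rule: infinite_finite_induct) (auto intro: polyfun_const polyfun_mult')

lemma polyfun_power': "p \<in> polyfun y \<Longrightarrow> (\<lambda>x. p x ^ n) \<in> polyfun y"
  by (induction n) (auto intro: polyfun_const polyfun_mult')

lemma polyfun_mp_eval:
  assumes "\<And>k. F k \<in> polyfun y"
  shows "(\<lambda>x. mp_eval f (\<lambda>k. F k x)) \<in> polyfun y"
  unfolding mp_eval_def
  by (intro polyfun_sum' polyfun_mult' polyfun_prod' polyfun_power' polyfun_const assms)

lemma polyfun_hom_eq:
  assumes "hom_on (polyfun y) \<psi>" "\<And>c. \<psi> (\<lambda>_. c) = c" "\<And>i. \<psi> (y i) = y i P" "p \<in> polyfun y"
  shows "\<psi> p = p P"
  using assms(4)
proof (induction rule: polyfun_induct)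
  case (uminus p)
  then show "\<psi> (- p) = (- p) P" using hom_on_uminus[OF subr_polyfun assms(1) uminus(1)] by (simp add: fun_app)
next
  case (add p q)
  then show "\<psi> (p + q) = (p + q) P" using hom_on_add[OF assms(1) add(1,2)] by (simp add: fun_app)
next
  case (mult p q)
  then show "\<psi> (p * q) = (p * q) P" using hom_on_mult[OF assms(1) mult(1,2)] by (simp add: fun_app)
qed (use assms in auto)

text \<open>Applied to the equations of a variety: the values of an algebra homomorphism on the
  coordinates satisfy them, hence form a point.\<close>

lemma polyfun_hom_mp_eval:
  assumes h: "hom_on (polyfun y) \<psi>" and c: "\<And>c. \<psi> (\<lambda>_. c) = c"
  shows "\<psi> (\<lambda>x. mp_eval f (\<lambda>i. y i x)) = mp_eval f (\<lambda>i. \<psi> (y i))"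
proof -
  define w where "w = (\<lambda>i. \<psi> (y i))"
  have pow: "\<psi> (\<lambda>x. y i x ^ n) = w i ^ n" for i n
  proof (induction n)
    case (Suc n)
    then show ?case using hom_on_mult[OF h polyfun_coord[of y i] polyfun_power'[OF polyfun_coord[of y i], of n]]
      by (simp add: times_fun_def w_def)
  qed (simp add: c)
  have prod: "\<psi> (\<lambda>x. \<Prod>i\<in>I. y i x ^ n i) = (\<Prod>i\<in>I. w i ^ n i)" for n I
  proof (induction I rule: infinite_finite_induct)
    case (insert i I)
    have "(\<lambda>x. \<Prod>i\<in>I. y i x ^ n i) \<in> polyfun y" by (intro polyfun_prod' polyfun_power' polyfun_coord)
    then show ?case using insert hom_on_mult[OF h polyfun_power'[OF polyfun_coord[of y i], of "n i"]]
      by (simp add: times_fun_def pow)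
  qed (simp_all add: c)
  have "\<psi> (\<lambda>x. \<Sum>m\<in>M. a m * (\<Prod>i\<in>UNIV. y i x ^ n m i)) = (\<Sum>m\<in>M. a m * (\<Prod>i\<in>UNIV. w i ^ n m i))" for M a n
  proof (induction M rule: infinite_finite_induct)
    case (insert m M)
    have 1: "(\<lambda>x. \<Sum>m\<in>M. a m * (\<Prod>i\<in>UNIV. y i x ^ n m i)) \<in> polyfun y"
      by (intro polyfun_sum' polyfun_mult' polyfun_prod' polyfun_power' polyfun_coord polyfun_const)
    have 2: "(\<lambda>x. \<Prod>i\<in>UNIV. y i x ^ n m i) \<in> polyfun y" by (intro polyfun_prod' polyfun_power' polyfun_coord)
    show ?case using insert hom_on_add[OF h polyfun_mult'[OF polyfun_const[of "a m"] 2] 1]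
        hom_on_mult[OF h polyfun_const[of "a m"] 2]
      by (simp add: times_fun_def plus_fun_def prod c)
  qed (simp_all add: c)
  then show ?thesis by (simp add: mp_eval_def w_def)
qed

section \<open>Homogeneous polynomials as functions\<close>

lemma mp_eval_superset:
  assumes "finite S" "Poly_Mapping.keys f \<subseteq> S"
  shows "mp_eval f v = (\<Sum>m\<in>S. Poly_Mapping.lookup f m * (\<Prod>i\<in>UNIV. v i ^ Poly_Mapping.lookup m i))"
  unfolding mp_eval_def using assms
  by (intro sum.mono_neutral_left) (auto simp: in_keys_iff)

lemma mp_eval_add: "mp_eval (f + g) v = mp_eval f v + mp_eval g v"
proof -
  let ?S = "Poly_Mapping.keys f \<union> Poly_Mapping.keys g"
  have "Poly_Mapping.keys (f + g) \<subseteq> ?S" by (rule keys_add)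
  then show ?thesis
    by (simp add: mp_eval_superset[of ?S] lookup_add distrib_right sum.distrib)
qed

lemma mp_eval_0: "mp_eval 0 v = 0"
  by (simp add: mp_eval_def)

lemma mp_eval_sum: "mp_eval (sum f I) v = (\<Sum>i\<in>I. mp_eval (f i) v)"
  by (induction I rule: infinite_finite_induct) (auto simp: mp_eval_add mp_eval_0)

lemma mp_eval_single: "mp_eval (Poly_Mapping.single m c) v = c * (\<Prod>i\<in>UNIV. v i ^ Poly_Mapping.lookup m i)"
  by (subst mp_eval_superset[of "{m}"]) (auto simp: keys_def lookup_single when_def)

lemma poly_mapping_monomials: "f = (\<Sum>m\<in>Poly_Mapping.keys f. Poly_Mapping.single m (Poly_Mapping.lookup f m))"
proof (rule poly_mapping_eqI)
  fix k
  have "(\<Sum>m\<in>Poly_Mapping.keys f. Poly_Mapping.lookup f m when m = k) = (\<Sum>m\<in>Poly_Mapping.keys f. if m = k then Poly_Mapping.lookup f m else 0)"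
    by (intro sum.cong) (auto simp: when_def)
  then show "Poly_Mapping.lookup f k = Poly_Mapping.lookup (\<Sum>m\<in>Poly_Mapping.keys f. Poly_Mapping.single m (Poly_Mapping.lookup f m)) k"
    by (simp add: lookup_sum lookup_single in_keys_iff)
qed

lemma mp_eval_mult: "mp_eval (f * g) v = mp_eval f v * mp_eval g v"
proof -
  have "f * g = (\<Sum>m\<in>Poly_Mapping.keys f. \<Sum>n\<in>Poly_Mapping.keys g.
      Poly_Mapping.single (m + n) (Poly_Mapping.lookup f m * Poly_Mapping.lookup g n))"
    by (subst poly_mapping_monomials[of f], subst poly_mapping_monomials[of g])
       (simp add: sum_product mult_single)
  then show ?thesis
    by (simp add: mp_eval_sum mp_eval_single lookup_add power_add prod.distrib)
       (simp add: mp_eval_def sum_product algebra_simps)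
qed

definition homfun :: "nat \<Rightarrow> (('n::finite \<Rightarrow> 'a::field) \<Rightarrow> 'a) set" where
  "homfun d = {mp_eval f |f. homogeneous d f}"

lemma homfunI: "homogeneous d f \<Longrightarrow> mp_eval f \<in> homfun d"
  by (auto simp: homfun_def)

lemma homfun_add: "p \<in> homfun d \<Longrightarrow> q \<in> homfun d \<Longrightarrow> (\<lambda>v. p v + q v) \<in> homfun d"
proof -
  assume "p \<in> homfun d" "q \<in> homfun d"
  then obtain f g where fg: "homogeneous d f" "p = mp_eval f" "homogeneous d g" "q = mp_eval g"
    by (auto simp: homfun_def)
  have "homogeneous d (f + g)" using fg keys_add[of f g] unfolding homogeneous_def by blast
  moreover have "mp_eval (f + g) = (\<lambda>v. p v + q v)" by (simp add: fg mp_eval_add fun_eq_iff)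
  ultimately show ?thesis using homfunI by metis
qed

lemma homfun_mult: "p \<in> homfun d \<Longrightarrow> q \<in> homfun e \<Longrightarrow> (\<lambda>v. p v * q v) \<in> homfun (d + e)"
proof -
  assume "p \<in> homfun d" "q \<in> homfun e"
  then obtain f g where fg: "homogeneous d f" "p = mp_eval f" "homogeneous e g" "q = mp_eval g"
    by (auto simp: homfun_def)
  have "homogeneous (d + e) (f * g)"
    unfolding homogeneous_def
  proof
    fix m assume "m \<in> Poly_Mapping.keys (f * g)"
    then obtain a b where "m = a + b" "a \<in> Poly_Mapping.keys f" "b \<in> Poly_Mapping.keys g"
      using keys_mult[of f g] by auto
    then show "(\<Sum>i\<in>UNIV. Poly_Mapping.lookup m i) = d + e"
      using fg by (simp add: homogeneous_def lookup_add sum.distrib)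
  qed
  moreover have "mp_eval (f * g) = (\<lambda>v. p v * q v)" by (simp add: fg mp_eval_mult fun_eq_iff)
  ultimately show ?thesis using homfunI by metis
qed

lemma homfun_const:
  fixes c :: "'a::field"
  shows "(\<lambda>_::'n::finite \<Rightarrow> 'a. c) \<in> homfun 0"
proof -
  let ?f = "Poly_Mapping.single 0 c :: ('n, 'a) mpoly"
  have "homogeneous 0 ?f" by (auto simp: homogeneous_def)
  moreover have "mp_eval ?f = (\<lambda>_. c)" by (simp add: mp_eval_single fun_eq_iff)
  ultimately show ?thesis using homfunI[of 0 ?f] by simp
qed

lemma homfun_coord: "(\<lambda>v::'n::finite \<Rightarrow> 'a::field. v i) \<in> homfun 1"
proof -
  let ?f = "Poly_Mapping.single (Poly_Mapping.single i 1) 1 :: ('n, 'a) mpoly"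
  have "homogeneous 1 ?f" by (auto simp: homogeneous_def lookup_single when_def)
  moreover have "mp_eval ?f = (\<lambda>v. v i)"
  proof
    fix v :: "'n \<Rightarrow> 'a"
    have "(\<Prod>k\<in>UNIV. v k ^ Poly_Mapping.lookup (Poly_Mapping.single i 1) k) = (\<Prod>k\<in>UNIV. if k = i then v i else 1)"
      by (intro prod.cong) (auto simp: lookup_single)
    then show "mp_eval ?f v = v i" by (simp add: mp_eval_single)
  qed
  ultimately show ?thesis using homfunI[of 1 ?f] by simp
qed

lemma homfun_power: "p \<in> homfun d \<Longrightarrow> (\<lambda>v. p v ^ n) \<in> homfun (n * d)"
  by (induction n) (auto intro: homfun_const homfun_mult)

lemma homfun_scale: "p \<in> homfun d \<Longrightarrow> p (\<lambda>i. c * v i) = c ^ d * p v"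
proof -
  assume "p \<in> homfun d"
  then obtain f where f: "homogeneous d f" "p = mp_eval f" by (auto simp: homfun_def)
  have "(\<Prod>i\<in>UNIV. (c * v i) ^ Poly_Mapping.lookup m i) = c ^ d * (\<Prod>i\<in>UNIV. v i ^ Poly_Mapping.lookup m i)"
    if "m \<in> Poly_Mapping.keys f" for m
    using f(1) that by (simp add: homogeneous_def power_mult_distrib prod.distrib power_sum[symmetric])
  then show ?thesis unfolding f(2) mp_eval_def sum_distrib_left
    by (intro sum.cong) (simp_all add: mult.left_commute)
qed

text \<open>On the hyperplane v j = 1 multiplication by powers of v j changes nothing, and it can
  equalize the degrees of summands.\<close>

lemma homogenize:
  assumes "p \<in> polyfun (\<lambda>i v. v i)"
  shows "\<exists>d. \<exists>q\<in>homfun d. \<forall>v. v j = 1 \<longrightarrow> q v = p v"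
  using assms
proof (induction rule: polyfun_induct)
  case (const c)
  show ?case by (intro exI[of _ 0] bexI[OF _ homfun_const[of c]]) simp
next
  case (coord i)
  show ?case by (intro exI[of _ 1] bexI[OF _ homfun_coord[of i]]) simp
next
  case (uminus p)
  then obtain d q where q: "q \<in> homfun d" "\<And>v. v j = 1 \<Longrightarrow> q v = p v" by blast
  show ?case
    by (intro exI[of _ "0 + d"] bexI[OF _ homfun_mult[OF homfun_const[of "-1"] q(1)]])
       (simp add: q fun_app)
next
  case (add p p')
  then obtain d q d' q' where q: "q \<in> homfun d" "\<And>v. v j = 1 \<Longrightarrow> q v = p v"
    "q' \<in> homfun d'" "\<And>v. v j = 1 \<Longrightarrow> q' v = p' v" by blast
  have "(\<lambda>v. q v * v j ^ d' + q' v * v j ^ d) \<in> homfun (d + d')"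
    using homfun_mult[OF q(1) homfun_power[OF homfun_coord[of j], of d']]
      homfun_mult[OF q(3) homfun_power[OF homfun_coord[of j], of d]]
    by (intro homfun_add) (simp_all add: add.commute)
  then show ?case
    by (intro exI[of _ "d + d'"] bexI[of _ "\<lambda>v. q v * v j ^ d' + q' v * v j ^ d"]) (simp_all add: q fun_app)
next
  case (mult p p')
  then obtain d q d' q' where q: "q \<in> homfun d" "\<And>v. v j = 1 \<Longrightarrow> q v = p v"
    "q' \<in> homfun d'" "\<And>v. v j = 1 \<Longrightarrow> q' v = p' v" by blast
  show ?case
    by (intro exI[of _ "d + d'"] bexI[OF _ homfun_mult[OF q(1,3)]]) (simp add: q fun_app)
qed

section \<open>Projective points, affine coordinates and the Zariski topology\<close>

lemma proj_pt_self: "v \<in> proj_pt v"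
  unfolding proj_pt_def by (auto intro!: exI[of _ 1])

lemma proj_pt_eq_iff: "proj_pt v = proj_pt w \<longleftrightarrow> (\<exists>c. c \<noteq> 0 \<and> w = (\<lambda>i. c * v i))"
proof
  assume "proj_pt v = proj_pt w"
  then show "\<exists>c. c \<noteq> 0 \<and> w = (\<lambda>i. c * v i)" using proj_pt_self[of w] by (auto simp: proj_pt_def)
next
  assume "\<exists>c. c \<noteq> 0 \<and> w = (\<lambda>i. c * v i)"
  then obtain c where c: "c \<noteq> 0" "w = (\<lambda>i. c * v i)" by blast
  show "proj_pt v = proj_pt w"
    unfolding proj_pt_def c(2)
  proof (intro Set.set_eqI iffI)
    fix u assume "u \<in> {\<lambda>i. d * v i |d. d \<noteq> 0}"
    then obtain d where "d \<noteq> 0" "u = (\<lambda>i. d * v i)" by blast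
    then show "u \<in> {\<lambda>i. d * (c * v i) |d. d \<noteq> 0}" using c by (auto intro!: exI[of _ "d / c"])
  next
    fix u assume "u \<in> {\<lambda>i. d * (c * v i) |d. d \<noteq> 0}"
    then obtain d where "d \<noteq> 0" "u = (\<lambda>i. d * (c * v i))" by blast
    then show "u \<in> {\<lambda>i. d * v i |d. d \<noteq> 0}" using c by (auto intro!: exI[of _ "d * c"])
  qed
qed

lemma proj_space_mem:
  assumes "P \<in> proj_space" "v \<in> P"
  shows "P = proj_pt v" "v \<noteq> (\<lambda>_. 0)"
proof -
  obtain u where u: "P = proj_pt u" "u \<noteq> (\<lambda>_. 0)" using assms(1) by (auto simp: proj_space_def)
  then obtain c where c: "c \<noteq> 0" "v = (\<lambda>i. c * u i)" using assms(2) by (auto simp: proj_pt_def)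
  then show "P = proj_pt v" using proj_pt_eq_iff u by blast
  show "v \<noteq> (\<lambda>_. 0)" using u c by (auto simp: fun_eq_iff)
qed

lemma proj_space_nonempty: "P \<in> proj_space \<Longrightarrow> \<exists>v. v \<in> P"
  using proj_pt_self by (auto simp: proj_space_def)

lemma proj_space_scale: "P \<in> proj_space \<Longrightarrow> v \<in> P \<Longrightarrow> c \<noteq> 0 \<Longrightarrow> (\<lambda>i. c * v i) \<in> P"
  using proj_space_mem[of P v] by (auto simp: proj_pt_def)

lemma homfun_vanish_iff:
  assumes "P \<in> proj_space" "v \<in> P" "p \<in> homfun d"
  shows "(\<forall>w\<in>P. p w \<noteq> 0) \<longleftrightarrow> p v \<noteq> 0" "(\<forall>w\<in>P. p w = 0) \<longleftrightarrow> p v = 0"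
proof -
  have "p w = 0 \<longleftrightarrow> p v = 0" if "w \<in> P" for w
  proof -
    obtain c where c: "c \<noteq> 0" "w = (\<lambda>i. c * v i)" using proj_space_mem[OF assms(1,2)] \<open>w \<in> P\<close> by (auto simp: proj_pt_def)
    then show ?thesis using homfun_scale[OF assms(3), of c v] by simp
  qed
  then show "(\<forall>w\<in>P. p w \<noteq> 0) \<longleftrightarrow> p v \<noteq> 0" "(\<forall>w\<in>P. p w = 0) \<longleftrightarrow> p v = 0" using assms(2) by blast+
qed

text \<open>The ratio does not depend on the representative. Since 0 / 0 = 0,
  \<open>crd j j P\<close> is 1 if the j-th coordinate of P is nonzero and 0 otherwise, which later
  serves as the test for lying in the chart.\<close>

definition crd :: "'n \<Rightarrow> 'n \<Rightarrow> ('n, 'a::field) pt \<Rightarrow> 'a" where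
  "crd j i P = (let v = SOME v. v \<in> P in v i / v j)"

lemma crd_eq:
  assumes "P \<in> proj_space" "v \<in> P"
  shows "crd j i P = v i / v j"
proof -
  define u where "u = (SOME v. v \<in> P)"
  have "u \<in> P" unfolding u_def using someI[of "\<lambda>v. v \<in> P"] assms(2) by simp
  then obtain c where c: "c \<noteq> 0" "u = (\<lambda>i. c * v i)" using proj_space_mem[OF assms] by (auto simp: proj_pt_def)
  show ?thesis unfolding crd_def Let_def u_def[symmetric] using c by simp
qed

lemma crd_mem:
  assumes "P \<in> proj_space" "v \<in> P" "v j \<noteq> 0"
  shows "(\<lambda>i. crd j i P) \<in> P"
  using proj_space_scale[OF assms(1,2), of "1 / v j"] assms by (simp add: crd_eq[OF assms(1,2)])

lemma topspace_zariski:
  fixes V :: "('n::finite, 'a::field) pt set"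
  assumes V: "V \<subseteq> proj_space"
  shows "topspace (zariski V) = V"
proof -
  let ?one = "Poly_Mapping.single 0 1 :: ('n, 'a) mpoly"
  have "{P \<in> proj_space. \<forall>v\<in>P. mp_eval ?one v \<noteq> 0} = proj_space" by (simp add: mp_eval_single del: single_one)
  moreover have "homogeneous 0 ?one" by (auto simp: homogeneous_def)
  ultimately have "proj_space \<in> {{P \<in> proj_space. \<forall>v\<in>P. mp_eval f v \<noteq> 0} |f. \<exists>d. homogeneous d (f :: ('n, 'a) mpoly)}" by blast
  then show ?thesis using V unfolding zariski_def by (auto simp: topology_generated_by_topspace)
qed

lemma openin_zariski:
  assumes "V \<subseteq> proj_space" "p \<in> homfun d"
  shows "openin (zariski V) {P \<in> V. \<forall>v\<in>P. p v \<noteq> 0}"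
proof -
  obtain f where f: "homogeneous d f" "p = mp_eval f" using assms by (auto simp: homfun_def)
  have "openin (topology_generated_by {{P \<in> proj_space. \<forall>v\<in>P. mp_eval f v \<noteq> 0} |f. \<exists>d. homogeneous d f}) {P \<in> proj_space. \<forall>v\<in>P. p v \<noteq> 0}"
    using f by (intro topology_generated_by_Basis) auto
  moreover have "{P \<in> V. \<forall>v\<in>P. p v \<noteq> 0} = {P \<in> proj_space. \<forall>v\<in>P. p v \<noteq> 0} \<inter> V" using assms by auto
  ultimately show ?thesis unfolding zariski_def by (auto simp: openin_subtopology)
qed

lemma closedin_zariski:
  assumes "V \<subseteq> proj_space" "p \<in> homfun d"
  shows "closedin (zariski V) {P \<in> V. \<forall>v\<in>P. p v = 0}"
proof -
  have "(\<forall>v\<in>P. p v \<noteq> 0) \<longleftrightarrow> \<not> (\<forall>v\<in>P. p v = 0)" if "P \<in> V" for P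
  proof -
    have P: "P \<in> proj_space" using that assms(1) by blast
    then obtain v where v: "v \<in> P" using proj_space_nonempty by blast
    show ?thesis unfolding homfun_vanish_iff[OF P v assms(2)] ..
  qed
  then have "V - {P \<in> V. \<forall>v\<in>P. p v = 0} = {P \<in> V. \<forall>v\<in>P. p v \<noteq> 0}" by auto
  then show ?thesis using openin_zariski[OF assms] by (auto simp: closedin_def topspace_zariski[OF assms(1)])
qed

text \<open>The zero sets of p and q are closed and cover V.\<close>

lemma irreducible_homfun:
  assumes V: "irreducible_closed V" "V \<subseteq> proj_space" and p: "p \<in> homfun d" "q \<in> homfun e"
    and pq: "\<And>P v. P \<in> V \<Longrightarrow> v \<in> P \<Longrightarrow> p v * q v = 0"
  shows "(\<forall>P\<in>V. \<forall>v\<in>P. p v = 0) \<or> (\<forall>P\<in>V. \<forall>v\<in>P. q v = 0)"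
proof -
  have "V = {P \<in> V. \<forall>v\<in>P. p v = 0} \<union> {P \<in> V. \<forall>v\<in>P. q v = 0}"
  proof (intro antisym subsetI)
    fix P assume P: "P \<in> V"
    then obtain v where v: "v \<in> P" using proj_space_nonempty V by blast
    then show "P \<in> {P \<in> V. \<forall>v\<in>P. p v = 0} \<union> {P \<in> V. \<forall>v\<in>P. q v = 0}"
      using pq[OF P v] homfun_vanish_iff(2)[OF _ v p(1)] homfun_vanish_iff(2)[OF _ v p(2)] P V(2) by auto
  qed auto
  then have "{P \<in> V. \<forall>v\<in>P. p v = 0} = V \<or> {P \<in> V. \<forall>v\<in>P. q v = 0} = V"
    using V(1) closedin_zariski[OF V(2) p(1)] closedin_zariski[OF V(2) p(2)] unfolding irreducible_closed_def by blast
  then show ?thesis by blast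
qed

section \<open>Divisibility of the group of points\<close>

text \<open>The image of the tensor square of \<open>polyfun y\<close> among the functions of two
  points; the local formulas for the group law lie in it.\<close>

inductive_set bif :: "('n::finite \<Rightarrow> 'x \<Rightarrow> 'k::field) \<Rightarrow> ('x \<Rightarrow> 'x \<Rightarrow> 'k) set" for y where
  prod: "\<alpha> \<in> polyfun y \<Longrightarrow> \<beta> \<in> polyfun y \<Longrightarrow> (\<lambda>P Q. \<alpha> P * \<beta> Q) \<in> bif y"
| add: "F \<in> bif y \<Longrightarrow> G \<in> bif y \<Longrightarrow> (\<lambda>P Q. F P Q + G P Q) \<in> bif y"

lemma bif_mult:
  assumes "\<alpha> \<in> polyfun y" "\<beta> \<in> polyfun y" "F \<in> bif y"
  shows "(\<lambda>P Q. \<alpha> P * \<beta> Q * F P Q) \<in> bif y"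
  using assms(3)
proof induction
  case (prod \<alpha>' \<beta>')
  have "(\<lambda>P Q. (\<alpha> P * \<alpha>' P) * (\<beta> Q * \<beta>' Q)) \<in> bif y"
    using assms prod by (intro bif.prod polyfun_mult')
  then show ?case by (simp add: ac_simps)
next
  case (add F G)
  from bif.add[OF add.IH] show ?case by (simp add: distrib_left)
qed

lemma bif_mult_left: "\<alpha> \<in> polyfun y \<Longrightarrow> F \<in> bif y \<Longrightarrow> (\<lambda>P Q. \<alpha> P * F P Q) \<in> bif y"
  using bif_mult[OF _ polyfun_const[of 1]] by fastforce

lemma bif_mult_right: "\<beta> \<in> polyfun y \<Longrightarrow> F \<in> bif y \<Longrightarrow> (\<lambda>P Q. \<beta> Q * F P Q) \<in> bif y"
  using bif_mult[OF polyfun_const[of 1]] by fastforce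

lemma bif_diff: "F \<in> bif y \<Longrightarrow> G \<in> bif y \<Longrightarrow> (\<lambda>P Q. F P Q - G P Q) \<in> bif y"
  using bif.add[of F y "\<lambda>P Q. - 1 * G P Q"] bif_mult_left[OF polyfun_const[of "- 1" y], of G] by simp

lemma bif_0: "(\<lambda>P Q. 0) \<in> bif y"
  using bif.prod[OF polyfun_const[of 0] polyfun_const[of 0]] by simp

lemma bif_sum: "(\<And>i. i \<in> I \<Longrightarrow> F i \<in> bif y) \<Longrightarrow> (\<lambda>P Q. \<Sum>i\<in>I. F i P Q) \<in> bif y"
  by (induction I rule: infinite_finite_induct) (auto intro: bif_0 bif.add)

lemma bif_mp_eval:
  fixes y :: "'n::finite \<Rightarrow> 'x \<Rightarrow> 'k::field"
  shows "(\<lambda>P Q. mp_eval f (case_sum (\<lambda>i. y i P) (\<lambda>i. y i Q))) \<in> bif y"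
proof -
  have *: "(\<lambda>P Q. c * ((\<Prod>i\<in>UNIV. y i P ^ n i) * (\<Prod>i\<in>UNIV. y i Q ^ n' i))) \<in> bif y" for c n n'
    by (intro bif_mult_left polyfun_const bif.prod polyfun_prod' polyfun_power' polyfun_coord)
  have "(\<Prod>s\<in>UNIV. case_sum v w s ^ Poly_Mapping.lookup m s) =
      (\<Prod>i\<in>UNIV. v i ^ Poly_Mapping.lookup m (Inl i)) * (\<Prod>i\<in>UNIV. w i ^ Poly_Mapping.lookup m (Inr i))"
    for v w :: "'n \<Rightarrow> 'k" and m
    by (subst UNIV_Plus_UNIV[symmetric], subst prod.Plus) auto
  then show ?thesis unfolding mp_eval_def by (auto intro!: bif_sum *)
qed

lemma polyfun_bif_left: "F \<in> bif y \<Longrightarrow> (\<lambda>P. F P Q) \<in> polyfun y"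
  by (induction rule: bif.induct) (auto intro: polyfun_add' polyfun_mult' polyfun_const)

lemma polyfun_bif_right: "F \<in> bif y \<Longrightarrow> (\<lambda>Q. F P Q) \<in> polyfun y"
  by (induction rule: bif.induct) (auto intro: polyfun_add' polyfun_mult' polyfun_const)

lemma germ_bif_comp:
  fixes y :: "'n::finite \<Rightarrow> 'x \<Rightarrow> 'k::field"
  assumes cot: "\<And>i. (\<lambda>x. y i (h x) - y i b - m * (y i x - y i b)) \<in> germ y b 2" and F: "F \<in> bif y"
  shows "(\<lambda>P. F (h P) P) \<in> germ y b 0"
  using F
proof induction
  case (prod \<alpha> \<beta>)
  have "(\<alpha> \<circ> h) * \<beta> \<in> germ y b (0 + 0)"
    using prod by (intro germ_mult germ_comp0[OF cot] polyfun_germ)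
  then show ?case by (simp add: times_fun_def)
next
  case (add F G)
  from germ_add[OF add.IH] show ?case by (simp add: plus_fun_def)
qed

text \<open>For a product of \<alpha> and \<beta> the expression is (\<alpha>(h P) - \<alpha>(b))
  (\<beta>(P) - \<beta>(b)), of order 1 + 1. In particular, a function of two points that vanishes
  whenever one of them is b has order two along P -> (h P, P).\<close>

lemma germ_bif:
  fixes y :: "'n::finite \<Rightarrow> 'x \<Rightarrow> 'k::field"
  assumes cot: "\<And>i. (\<lambda>x. y i (h x) - y i b - m * (y i x - y i b)) \<in> germ y b 2" and hb: "h b = b"
    and F: "F \<in> bif y"
  shows "(\<lambda>P. F (h P) P - F (h P) b - F b P + F b b) \<in> germ y b 2"
  using F
proof induction
  case (prod \<alpha> \<beta>)
  have "(\<lambda>P. \<alpha> (h P) - \<alpha> b) \<in> germ y b 1"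
  proof (rule germ_vanish)
    have "(\<alpha> \<circ> h) - (\<lambda>_. \<alpha> b) \<in> germ y b 0"
      using prod by (intro germ_diff germ_comp0[OF cot] polyfun_germ polyfun_const)
    then show "(\<lambda>P. \<alpha> (h P) - \<alpha> b) \<in> germ y b 0" by (simp add: fun_diff_def)
  qed (simp add: hb)
  moreover have "(\<lambda>P. \<beta> P - \<beta> b) \<in> germ y b 1"
    using prod by (intro germ_vanish polyfun_germ polyfun_diff' polyfun_const) auto
  ultimately have "(\<lambda>P. \<alpha> (h P) - \<alpha> b) * (\<lambda>P. \<beta> P - \<beta> b) \<in> germ y b (1 + 1)"
    by (rule germ_mult)
  moreover have "(\<lambda>P. \<alpha> (h P) - \<alpha> b) * (\<lambda>P. \<beta> P - \<beta> b) =
      (\<lambda>P. \<alpha> (h P) * \<beta> P - \<alpha> (h P) * \<beta> b - \<alpha> b * \<beta> P + \<alpha> b * \<beta> b)"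
    by (auto simp: fun_eq_iff fun_app algebra_simps)
  ultimately show ?case by (simp add: numeral_2_eq_2)
next
  case (add F G)
  from germ_add[OF add.IH] show ?case by (simp add: plus_fun_def algebra_simps)
qed

lemma (in abelian_variety) mult_local:
  assumes "P \<in> carrier A" "Q \<in> carrier A"
  shows "\<exists>f :: 'n \<Rightarrow> ('n + 'n, 'a) mpoly.
    (\<forall>v\<in>P. \<forall>w\<in>Q. (\<lambda>k. mp_eval (f k) (case_sum v w)) \<noteq> (\<lambda>_. 0)) \<and>
    (\<forall>P\<in>carrier A. \<forall>Q\<in>carrier A. \<forall>v\<in>P. \<forall>w\<in>Q. (\<lambda>k. mp_eval (f k) (case_sum v w)) \<noteq> (\<lambda>_. 0) \<longrightarrow>
      P \<otimes> Q = proj_pt (\<lambda>k. mp_eval (f k) (case_sum v w))) \<and> (\<forall>k. coeffs_in F (f k))"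
  using bspec[OF bspec[OF mult_regular[unfolded regular_map2_def] assms(1)] assms(2)]
  by (elim exE conjE) (intro exI conjI, assumption, assumption, blast)

section \<open>The affine chart around the identity, and surjectivity of [m]\<close>

locale av_chart = abelian_variety F A
  for F :: "'a::alg_closed_field set" and A :: "('n::finite, 'a) pt monoid" (structure) +
  fixes j :: 'n
  assumes j: "\<exists>v\<in>\<one>. v j \<noteq> 0"
begin

definition chart :: "('n, 'a) pt \<Rightarrow> bool" where
  "chart P \<longleftrightarrow> P \<in> carrier A \<and> crd j j P \<noteq> 0"

text \<open>A retraction to the chart that sends all other points to the identity. It makes the
  coordinates \<open>y\<close> total functions whose values are always the coordinates of a genuine
  point of A, so that polynomial identities between them hold without side conditions.\<close>

definition rho :: "('n, 'a) pt \<Rightarrow> ('n, 'a) pt" where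
  "rho P = (if chart P then P else \<one>)"

definition y :: "'n \<Rightarrow> ('n, 'a) pt \<Rightarrow> 'a" where
  "y i P = crd j i (rho P)"

lemma carrier_sub: "carrier A \<subseteq> proj_space"
  using closed unfolding closed_over_def by blast

lemma chart_iff:
  assumes "P \<in> carrier A" "v \<in> P"
  shows "chart P \<longleftrightarrow> v j \<noteq> 0"
proof -
  have "crd j j P = v j / v j" using assms carrier_sub by (intro crd_eq) auto
  then show ?thesis using assms by (auto simp: chart_def)
qed

lemma chart_one: "chart \<one>"
  using j by (auto simp: chart_iff)

lemma rho: "chart (rho P)" "rho P \<in> carrier A" "chart P \<Longrightarrow> rho P = P" "rho (rho P) = rho P"
  using chart_one by (auto simp: rho_def chart_def)

lemma y_mem: "(\<lambda>i. y i P) \<in> rho P"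
proof -
  have P: "rho P \<in> proj_space" using rho carrier_sub by blast
  then obtain v where "v \<in> rho P" using proj_space_nonempty by blast
  then show ?thesis unfolding y_def using crd_mem[OF P] rho chart_iff by blast
qed

lemma rho_eq: "rho P = proj_pt (\<lambda>i. y i P)"
  using proj_space_mem(1)[OF _ y_mem] rho carrier_sub by blast

lemma y_eq:
  assumes "chart P" "v \<in> P"
  shows "y i P = v i / v j"
  using assms crd_eq[of P v j i] carrier_sub by (auto simp: y_def rho chart_def)

lemma y_j: "y j P = 1"
proof -
  have "y j (rho P) = y j P" by (simp add: y_def rho)
  then show ?thesis using y_eq[OF rho(1) y_mem, of j P] chart_iff[OF rho(2) y_mem, of P] rho(1) by auto
qed

lemma y_rho: "y i (rho P) = y i P"
  by (simp add: y_def rho)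

lemma y_proj_pt:
  assumes "proj_pt w \<in> carrier A" "w j \<noteq> 0"
  shows "chart (proj_pt w)" "y i (proj_pt w) = w i / w j"
  using chart_iff[OF assms(1) proj_pt_self] assms(2) y_eq[OF _ proj_pt_self] by auto

text \<open>Passes from affine functions on the chart to forms on all of A, to which the Zariski
  topology and irreducibility apply.\<close>

lemma polyfun_lift:
  assumes "p \<in> polyfun y"
  shows "\<exists>d. \<exists>q\<in>homfun d. (\<forall>P\<in>carrier A. \<forall>v\<in>P. v j \<noteq> 0 \<longrightarrow> q v = v j ^ d * p P) \<and>
    (\<forall>P. p P = q (\<lambda>i. y i P))"
proof -
  have "p \<in> (\<lambda>p. p \<circ> (\<lambda>P i. y i P)) ` polyfun (\<lambda>i v. v i)"
    using assms polyfun_comp_iff[of "\<lambda>i v. v i" "\<lambda>P i. y i P"] by (simp add: o_def)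
  then obtain p' where p': "p = p' \<circ> (\<lambda>P i. y i P)" "p' \<in> polyfun (\<lambda>i v. v i)" by (rule imageE)
  obtain d q where q: "q \<in> homfun d" "\<And>v. v j = 1 \<Longrightarrow> q v = p' v" using homogenize[OF p'(2)] by blast
  have p: "p P = q (\<lambda>i. y i P)" for P using q(2) p'(1) y_j by simp
  have "q v = v j ^ d * p P" if P: "P \<in> carrier A" "v \<in> P" "v j \<noteq> 0" for P v
  proof -
    have "v = (\<lambda>i. v j * y i P)" using P y_eq[of P v] chart_iff[of P v] by simp
    then have "q v = q (\<lambda>i. v j * y i P)" by simp
    then show ?thesis by (simp add: homfun_scale[OF q(1)] p)
  qed
  then show ?thesis using p q(1) by (intro exI[of _ d] bexI[of _ q]) auto
qed

lemma dom_polyfun: "dom_on (polyfun y)"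
  unfolding dom_on_def
proof (intro ballI impI)
  fix p p' assume p: "p \<in> polyfun y" and p': "p' \<in> polyfun y" and pp: "p * p' = 0"
  from polyfun_lift[OF p] obtain d q where lq0: "q \<in> homfun d"
    "\<forall>P\<in>carrier A. \<forall>v\<in>P. v j \<noteq> 0 \<longrightarrow> q v = v j ^ d * p P" "\<forall>P. p P = q (\<lambda>i. y i P)"
    by (elim exE bexE conjE) (rule that)
  note q = lq0(1) lq0(2)[rule_format] lq0(3)[rule_format]
  from polyfun_lift[OF p'] obtain d' q' where lq'0: "q' \<in> homfun d'"
    "\<forall>P\<in>carrier A. \<forall>v\<in>P. v j \<noteq> 0 \<longrightarrow> q' v = v j ^ d' * p' P" "\<forall>P. p' P = q' (\<lambda>i. y i P)"
    by (elim exE bexE conjE) (rule that)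
  note q' = lq'0(1) lq'0(2)[rule_format] lq'0(3)[rule_format]
  note irr = irreducible_homfun[OF irred carrier_sub]
  \<comment> \<open>The forms are tied to p and p' only on the chart; the factor \<open>v j\<close>
    covers its complement.\<close>
  have "q v * (q' v * v j) = 0" if "P \<in> carrier A" "v \<in> P" for P v
    using fun_cong[OF pp, of P] q(2)[OF that] q'(2)[OF that] by (cases "v j = 0") (auto simp: fun_app)
  then have "(\<forall>P\<in>carrier A. \<forall>v\<in>P. q v = 0) \<or> (\<forall>P\<in>carrier A. \<forall>v\<in>P. q' v * v j = 0)"
    using irr[OF q(1) homfun_mult[OF q'(1) homfun_coord[of j]]] by blast
  then show "p = 0 \<or> p' = 0"
  proof
    assume "\<forall>P\<in>carrier A. \<forall>v\<in>P. q v = 0"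
    then show ?thesis using rho(2) y_mem by (auto simp: q(3) fun_eq_iff fun_app)
  next
    assume "\<forall>P\<in>carrier A. \<forall>v\<in>P. q' v * v j = 0"
    then have "q' (\<lambda>i. y i P) * y j P = 0" for P using rho(2) y_mem by blast
    then show ?thesis by (auto simp: q'(3) fun_eq_iff fun_app y_j)
  qed
qed

text \<open>The group law near the pair of identities. There the vector of forms represents the
  identity, which lies in the chart, so its j-th entry is nonzero and can serve as the
  denominator.\<close>

lemma mult_chart:
  "\<exists>g. (\<forall>k. g k \<in> bif y) \<and> g j \<one> \<one> \<noteq> 0 \<and> (\<forall>P Q. g j P Q \<noteq> 0 \<longrightarrow> chart (rho P \<otimes> rho Q)) \<and>
    (\<forall>P Q k. g j P Q \<noteq> 0 \<longrightarrow> y k (rho P \<otimes> rho Q) = g k P Q / g j P Q)"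
proof -
  from mult_local[OF one_closed one_closed] obtain f :: "'n \<Rightarrow> ('n + 'n, 'a) mpoly" where
    f1: "\<forall>v\<in>\<one>. \<forall>w\<in>\<one>. (\<lambda>k. mp_eval (f k) (case_sum v w)) \<noteq> (\<lambda>_. 0)"
    and f2: "\<forall>P\<in>carrier A. \<forall>Q\<in>carrier A. \<forall>v\<in>P. \<forall>w\<in>Q. (\<lambda>k. mp_eval (f k) (case_sum v w)) \<noteq> (\<lambda>_. 0) \<longrightarrow>
      P \<otimes> Q = proj_pt (\<lambda>k. mp_eval (f k) (case_sum v w))"
    by (elim exE conjE) (rule that)
  note f2 = f2[rule_format]
  define g where "g k P Q = mp_eval (f k) (case_sum (\<lambda>i. y i P) (\<lambda>i. y i Q))" for k P Q
  have 1: "rho P \<otimes> rho Q = proj_pt (\<lambda>k. g k P Q)" if "(\<lambda>k. g k P Q) \<noteq> (\<lambda>_. 0)" for P Q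
    using f2[OF rho(2) rho(2) y_mem y_mem, of P Q] that unfolding g_def by blast
  have cl: "rho P \<otimes> rho Q \<in> carrier A" for P Q using rho(2) by auto
  have "(\<lambda>k. g k \<one> \<one>) \<noteq> (\<lambda>_. 0)"
    using f1 y_mem[of \<one>] chart_one by (simp add: g_def rho)
  from 1[OF this] have "\<one> = proj_pt (\<lambda>k. g k \<one> \<one>)" by (simp add: rho chart_one)
  then have g1: "g j \<one> \<one> \<noteq> 0" using chart_iff[of \<one> "\<lambda>k. g k \<one> \<one>"] chart_one proj_pt_self by fastforce
  show ?thesis
  proof (intro exI[of _ g] conjI allI impI)
    show "g k \<in> bif y" for k unfolding g_def by (rule bif_mp_eval)
    show "g j \<one> \<one> \<noteq> 0" by (rule g1)
    fix P Q k assume nz: "g j P Q \<noteq> 0"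
    then have eq: "rho P \<otimes> rho Q = proj_pt (\<lambda>k. g k P Q)" by (intro 1) (auto simp: fun_eq_iff)
    show "chart (rho P \<otimes> rho Q)" "y k (rho P \<otimes> rho Q) = g k P Q / g j P Q"
      using y_proj_pt[of "\<lambda>k. g k P Q"] cl[of P Q] nz unfolding eq by auto
  qed
qed

text \<open>\<open>[m]\<close> acts on the cotangent space at the identity as multiplication by \<open>m\<close>.\<close>

lemma pow_cotangent:
  shows "\<exists>D\<in>polyfun y. D \<one> \<noteq> 0 \<and> (\<forall>P. D P \<noteq> 0 \<longrightarrow> chart (rho P [^] m))"
    and "\<And>i. (\<lambda>P. y i (rho P [^] m) - y i \<one> - of_nat m * (y i P - y i \<one>)) \<in> germ y \<one> 2"
proof (induction m)
  case 0
  {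
    case 1
    then show ?case using chart_one by (intro bexI[OF _ polyfun_const[of 1]]) auto
  next
    case 2
    have "0 \<in> germ y \<one> 2" by (intro mpow_germ mpow.zero)
    then show ?case by (simp add: zero_fun_def)
  }
next
  case (Suc m)
  define h where "h P = rho P [^] m" for P
  have h1: "h \<one> = \<one>" by (simp add: h_def rho chart_one)
  have cot: "(\<lambda>P. y i (h P) - y i \<one> - of_nat m * (y i P - y i \<one>)) \<in> germ y \<one> 2" for i
    using Suc(2) by (simp add: h_def)
  obtain D where D: "D \<in> polyfun y" "D \<one> \<noteq> 0" "\<And>P. D P \<noteq> 0 \<Longrightarrow> chart (h P)"
    using Suc(1) by (auto simp: h_def)
  from mult_chart obtain g where g0: "\<forall>k. g k \<in> bif y" "g j \<one> \<one> \<noteq> 0"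
    "\<forall>P Q. g j P Q \<noteq> 0 \<longrightarrow> chart (rho P \<otimes> rho Q)"
    "\<forall>P Q k. g j P Q \<noteq> 0 \<longrightarrow> y k (rho P \<otimes> rho Q) = g k P Q / g j P Q"
    by (elim exE conjE) (rule that)
  note g = g0(1)[rule_format] g0(2) g0(3,4)[rule_format]
  have gj: "(\<lambda>P. g j (h P) P) \<in> germ y \<one> 0" by (rule germ_bif_comp[OF cot g(1)])
  then obtain D' where D': "D' \<in> polyfun y" "D' \<one> \<noteq> 0" "mpow y \<one> 0 (D' * (\<lambda>P. g j (h P) P))"
    by (auto simp: germ_def)
  \<comment> \<open>Where E is nonzero, h P lies in the chart and the formula for the product of h P
    and P is valid; the factor D' makes E a polynomial function.\<close>
  define E where "E = D * (D' * (\<lambda>P. g j (h P) P))"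
  have E: "E \<in> polyfun y" "E \<one> \<noteq> 0"
    using D D' g(2) mpow_polyfun[OF D'(3)] by (auto simp: E_def h1 fun_app intro!: subr_mult subr_polyfun)
  have Enz: "D P \<noteq> 0" "g j (h P) P \<noteq> 0" if "E P \<noteq> 0" for P
    using that by (auto simp: E_def fun_app)
  have hS: "rho P [^] Suc m = rho (h P) \<otimes> rho P" if "E P \<noteq> 0" for P
    using D(3)[OF Enz(1)[OF that]] by (simp add: h_def rho)
  {
    case 1
    show ?case using E hS g(3)[OF Enz(2)] by (intro bexI[OF _ E(1)]) auto
  next
    case (2 i)
    \<comment> \<open>The deviation of \<open>y i\<close> from additivity on a product, multiplied
      by the denominator. It vanishes if one of the points is the identity, so
      \<open>germ_bif\<close> shows it to be of order two along P -> (h P, P).\<close>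
    define N where "N P Q = g i P Q - (y i P + y i Q - y i \<one>) * g j P Q" for P Q
    have Nbif: "N \<in> bif y"
    proof -
      have "(\<lambda>P Q. g i P Q - ((y i P * g j P Q + y i Q * g j P Q) - y i \<one> * g j P Q)) \<in> bif y"
        by (intro bif_diff bif.add g bif_mult_left[OF polyfun_coord, of _ y] bif_mult_right[OF polyfun_coord, of _ y]
            bif_mult_left[OF polyfun_const])
      then show ?thesis by (simp add: N_def[abs_def] algebra_simps)
    qed
    have left: "N P \<one> = 0" for P
    proof -
      \<comment> \<open>The formula for the product is known only where its denominator is nonzero.
        As \<open>polyfun y\<close> has no zero divisors and \<open>g j \<one> \<one>\<close> is not
        0, the vanishing of N extends to all P.\<close>
      have "N P \<one> * g j P \<one> = 0" for P
      proof (cases "g j P \<one> = 0")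
        case False
        have "y i P = g i P \<one> / g j P \<one>"
          using g(4)[OF False, of i] rho(2)[of P] by (simp add: rho(3)[OF chart_one] y_rho)
        then show ?thesis using False by (simp add: N_def)
      qed simp
      then have "(\<lambda>P. N P \<one>) * (\<lambda>P. g j P \<one>) = 0" by (simp add: fun_eq_iff fun_app)
      then have "(\<lambda>P. N P \<one>) = 0 \<or> (\<lambda>P. g j P \<one>) = 0"
        using dom_polyfun polyfun_bif_left[OF Nbif] polyfun_bif_left[OF g(1)] unfolding dom_on_def by blast
      then show ?thesis using g(2) by (auto simp: fun_eq_iff fun_app)
    qed
    have right: "N \<one> P = 0" for P
    proof -
      have "N \<one> P * g j \<one> P = 0" for P
      proof (cases "g j \<one> P = 0")
        case False
        have "y i P = g i \<one> P / g j \<one> P"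
          using g(4)[OF False, of i] rho(2)[of P] by (simp add: rho(3)[OF chart_one] y_rho)
        then show ?thesis using False by (simp add: N_def)
      qed simp
      then have "(\<lambda>P. N \<one> P) * (\<lambda>P. g j \<one> P) = 0" by (simp add: fun_eq_iff fun_app)
      then have "(\<lambda>P. N \<one> P) = 0 \<or> (\<lambda>P. g j \<one> P) = 0"
        using dom_polyfun polyfun_bif_right[OF Nbif] polyfun_bif_right[OF g(1)] unfolding dom_on_def by blast
      then show ?thesis using g(2) by (auto simp: fun_eq_iff fun_app)
    qed
    have "(\<lambda>P. N (h P) P) \<in> germ y \<one> 2" using germ_bif[OF cot h1 Nbif] by (simp add: left right)
    from germ_mult[OF this germ_inverse[OF gj]]
    have "(\<lambda>P. N (h P) P) * (\<lambda>P. 1 / g j (h P) P) \<in> germ y \<one> 2" using g(2) by (simp add: h1)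
    from germ_add[OF this cot[of i]]
    show ?case
    proof (rule germ_cong[OF E, rotated])
      fix P assume P: "E P \<noteq> 0"
      have "y i (rho P [^] Suc m) = g i (h P) P / g j (h P) P"
        unfolding hS[OF P] by (rule g(4)[OF Enz(2)[OF P]])
      then show "y i (rho P [^] Suc m) - y i \<one> - of_nat (Suc m) * (y i P - y i \<one>) =
        ((\<lambda>P. N (h P) P) * (\<lambda>P. 1 / g j (h P) P) + (\<lambda>P. y i (h P) - y i \<one> - of_nat m * (y i P - y i \<one>))) P"
        using Enz(2)[OF P] by (simp add: fun_app N_def field_simps)
    qed
  }
qed

text \<open>Injectivity of the pullback along [m], from \<open>comp_injective\<close>, feeds
  \<open>dominant_image\<close>; the homomorphism obtained there is evaluation at a point, which is
  the wanted m-th root.\<close>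

lemma pow_image_open:
  assumes m: "(of_nat m :: 'a) \<noteq> 0"
  shows "\<exists>a\<in>polyfun y. a \<noteq> 0 \<and> (\<forall>Q. a Q \<noteq> 0 \<longrightarrow> rho Q \<in> (\<lambda>P. P [^] m) ` carrier A)"
proof -
  define h where "h P = rho P [^] m" for P
  have cot: "(\<lambda>P. y i (h P) - y i \<one> - of_nat m * (y i P - y i \<one>)) \<in> germ y \<one> 2" for i
    using pow_cotangent(2) by (simp add: h_def)
  obtain D where D: "D \<in> polyfun y" "D \<one> \<noteq> 0" "\<And>P. D P \<noteq> 0 \<Longrightarrow> chart (h P)"
    using pow_cotangent(1)[of m] by (auto simp: h_def)
  have "\<exists>d. d \<in> polyfun y \<and> d \<one> \<noteq> 0 \<and> d * (\<lambda>P. y i (h P)) \<in> polyfun y" for i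
  proof -
    obtain d where "d \<in> polyfun y" "d \<one> \<noteq> 0" "mpow y \<one> 0 (d * (\<lambda>P. y i (h P)))"
      using germ_coord_comp[OF cot, of i] by (auto simp: germ_def)
    then show ?thesis using mpow_polyfun by (intro exI[of _ d]) simp
  qed
  then obtain d where d: "\<And>i. d i \<in> polyfun y" "\<And>i. d i \<one> \<noteq> 0" "\<And>i. d i * (\<lambda>P. y i (h P)) \<in> polyfun y"
    by metis
  \<comment> \<open>One denominator for all coordinates of h P, which also keeps h P inside the
    chart.\<close>
  define E where "E P = D P * (\<Prod>i\<in>UNIV. d i P)" for P
  define G where "G i P = E P * y i (h P)" for i P
  have E: "E \<in> polyfun y" unfolding E_def using D d by (intro polyfun_mult' polyfun_prod')
  have E1: "E \<one> \<noteq> 0" using D d by (simp add: E_def)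
  have G: "G i \<in> polyfun y" for i
  proof -
    have "(\<lambda>P. D P * ((\<Prod>i\<in>UNIV - {i}. d i P) * (d i * (\<lambda>P. y i (h P))) P)) \<in> polyfun y"
      using D d by (intro polyfun_mult' polyfun_prod')
    moreover have "G i = (\<lambda>P. D P * ((\<Prod>i\<in>UNIV - {i}. d i P) * (d i * (\<lambda>P. y i (h P))) P))"
    proof
      fix P
      show "G i P = D P * ((\<Prod>i\<in>UNIV - {i}. d i P) * (d i * (\<lambda>P. y i (h P))) P)"
        using prod.remove[of UNIV i "\<lambda>i. d i P"] by (simp add: fun_app G_def E_def mult_ac)
    qed
    ultimately show ?thesis by simp
  qed
  have inj: "p = 0" if p: "p \<in> polyfun y" "\<And>P. E P \<noteq> 0 \<Longrightarrow> p (h P) = 0" for p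
  proof -
    have "\<exists>u\<in>polyfun y. u \<one> \<noteq> 0 \<and> u * p = 0" by (rule comp_injective[OF cot m p(1) E E1 p(2)])
    then obtain u where u: "u \<in> polyfun y" "u \<one> \<noteq> 0 \<and> u * p = 0"
      by (elim bexE)
    then have "u = 0 \<or> p = 0" using dom_polyfun p(1) unfolding dom_on_def by blast
    then show ?thesis using u by (auto simp: fun_app)
  qed
  have Gh: "y i (h P) = G i P / E P" if "E P \<noteq> 0" for i P using that by (simp add: G_def)
  have "\<exists>a\<in>polyfun y. a \<noteq> 0 \<and> (\<forall>Q. a Q \<noteq> 0 \<longrightarrow>
      (\<exists>\<psi>. hom_on (polyfun y) \<psi> \<and> (\<forall>c. \<psi> (\<lambda>_. c) = c) \<and> \<psi> E \<noteq> 0 \<and> (\<forall>i. \<psi> (G i) = y i Q * \<psi> E)))"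
    by (rule dominant_image[OF dom_polyfun E E1 G Gh inj])
  then obtain a where a: "a \<in> polyfun y" "a \<noteq> 0 \<and> (\<forall>Q. a Q \<noteq> 0 \<longrightarrow>
      (\<exists>\<psi>. hom_on (polyfun y) \<psi> \<and> (\<forall>c. \<psi> (\<lambda>_. c) = c) \<and> \<psi> E \<noteq> 0 \<and> (\<forall>i. \<psi> (G i) = y i Q * \<psi> E)))"
    by (elim bexE)
  show ?thesis
  proof (intro bexI[OF _ a(1)] conjI allI impI)
    show "a \<noteq> 0" using a(2) by blast
    fix Q assume "a Q \<noteq> 0"
    with a(2) have "\<exists>\<psi>. hom_on (polyfun y) \<psi> \<and> (\<forall>c. \<psi> (\<lambda>_. c) = c) \<and> \<psi> E \<noteq> 0 \<and> (\<forall>i. \<psi> (G i) = y i Q * \<psi> E)"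
      by blast
    then obtain \<psi> where \<psi>0: "hom_on (polyfun y) \<psi>" "\<forall>c. \<psi> (\<lambda>_. c) = c" "\<psi> E \<noteq> 0" "\<forall>i. \<psi> (G i) = y i Q * \<psi> E"
      by (elim exE conjE)
    note \<psi> = \<psi>0(1) \<psi>0(2)[rule_format] \<psi>0(3) \<psi>0(4)[rule_format]
    \<comment> \<open>The point with these coordinates lies on A: a form that vanishes on A becomes
      the zero function in the chart coordinates, and \<psi> sends that to 0.\<close>
    define w where "w i = \<psi> (y i)" for i
    have "y j = (\<lambda>_. 1)" using y_j by auto
    then have wj: "w j = 1" using \<psi>(2) by (simp add: w_def)
    obtain S where S: "\<And>f. f \<in> S \<Longrightarrow> \<exists>d. homogeneous d f" "carrier A = {P \<in> proj_space. \<forall>f\<in>S. \<forall>v\<in>P. mp_eval f v = 0}"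
      using closed unfolding closed_over_def by blast
    have wA: "proj_pt w \<in> carrier A"
    proof (subst S(2), intro CollectI conjI ballI)
      have "w \<noteq> (\<lambda>_. 0)" using wj by auto
      then show P: "proj_pt w \<in> proj_space" unfolding proj_space_def by blast
      fix f v assume f: "f \<in> S" and v: "v \<in> proj_pt w"
      have "mp_eval f (\<lambda>i. y i P) = 0" for P
      proof -
        have "rho P \<in> {P \<in> proj_space. \<forall>f\<in>S. \<forall>v\<in>P. mp_eval f v = 0}" using rho(2)[of P] by (simp only: S(2))
        then show ?thesis using y_mem[of P] f by blast
      qed
      then have "mp_eval f w = \<psi> (\<lambda>_. 0)"
        using polyfun_hom_mp_eval[OF \<psi>(1,2), of f] by (simp add: w_def[abs_def])
      then have "mp_eval f w = 0" by (simp add: \<psi>)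
      then show "mp_eval f v = 0"
        using homfun_vanish_iff(2)[OF P proj_pt_self homfunI] S(1)[OF f] v by blast
    qed
    define P where "P = proj_pt w"
    have P: "P \<in> carrier A" "chart P" "y i P = w i" for i
      using y_proj_pt[OF wA] wj wA by (auto simp: P_def)
    have ev: "\<psi> p = p P" if "p \<in> polyfun y" for p
      using polyfun_hom_eq[OF \<psi>(1,2) _ that, of P] P by (simp add: w_def)
    have EP: "E P \<noteq> 0" using \<psi>(3) ev[OF E] by simp
    have yy: "y i (h P) = y i Q" for i
      using \<psi>(4)[of i] ev[OF G] ev[OF E] EP by (simp add: G_def)
    have "chart (h P)" using D(3)[of P] EP by (auto simp: E_def)
    then have "h P = rho (h P)" by (simp add: rho)
    also have "\<dots> = rho Q" by (simp add: rho_eq yy)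
    finally have "rho Q = P [^] m" using P by (simp add: h_def rho)
    then show "rho Q \<in> (\<lambda>P. P [^] m) ` carrier A" using P by blast
  qed
qed

text \<open>Continuity of translation by \<open>Q0\<close>, for one basic open set. Near a point
  \<open>Q1\<close> the translation is given by polynomials; the composite equation is restricted to
  w l = 1 for a coordinate l that is nonzero at \<open>Q1\<close>, and homogenized again.\<close>

lemma openin_translate:
  assumes q: "q \<in> homfun d" and Q0: "Q0 \<in> carrier A"
  shows "openin (zariski (carrier A)) {Q \<in> carrier A. \<forall>v\<in>Q0 \<otimes> Q. q v * v j \<noteq> 0}"
proof (subst openin_subopen, intro ballI)
  fix Q1 assume "Q1 \<in> {Q \<in> carrier A. \<forall>v\<in>Q0 \<otimes> Q. q v * v j \<noteq> 0}"
  then have Q1: "Q1 \<in> carrier A" "\<forall>v\<in>Q0 \<otimes> Q1. q v * v j \<noteq> 0" by auto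
  have hq: "(\<lambda>v. q v * v j) \<in> homfun (d + 1)" by (intro homfun_mult q homfun_coord)
  from mult_local[OF Q0 Q1(1)] obtain f :: "'n \<Rightarrow> ('n + 'n, 'a) mpoly" where
    f1: "\<forall>v\<in>Q0. \<forall>w\<in>Q1. (\<lambda>k. mp_eval (f k) (case_sum v w)) \<noteq> (\<lambda>_. 0)"
    and f2: "\<forall>P\<in>carrier A. \<forall>Q\<in>carrier A. \<forall>v\<in>P. \<forall>w\<in>Q. (\<lambda>k. mp_eval (f k) (case_sum v w)) \<noteq> (\<lambda>_. 0) \<longrightarrow>
      P \<otimes> Q = proj_pt (\<lambda>k. mp_eval (f k) (case_sum v w))"
    by (elim exE conjE) (rule that)
  note f2 = f2[rule_format]
  obtain v0 where v0: "v0 \<in> Q0" using proj_space_nonempty Q0 carrier_sub by blast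
  obtain v1 where v1: "v1 \<in> Q1" using proj_space_nonempty Q1 carrier_sub by blast
  have "v1 \<noteq> (\<lambda>_. 0)" using proj_space_mem(2)[OF _ v1] Q1 carrier_sub by blast
  then obtain l where l: "v1 l \<noteq> 0" by auto
  define p where "p w = q (\<lambda>k. mp_eval (f k) (case_sum v0 w)) * mp_eval (f j) (case_sum v0 w)" for w
  have pf: "(\<lambda>w. mp_eval (f k) (case_sum v0 w)) \<in> polyfun (\<lambda>i v. v i)" for k
  proof -
    have "(\<lambda>w. case s of Inl i \<Rightarrow> v0 i | Inr i \<Rightarrow> w i) \<in> polyfun (\<lambda>i v. v i)" for s
      using polyfun_const polyfun_coord[of "\<lambda>i v. v i"] by (cases s) auto
    then show ?thesis
      by (rule polyfun_mp_eval[of "\<lambda>s w. case s of Inl i \<Rightarrow> v0 i | Inr i \<Rightarrow> w i"])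
  qed
  obtain q' where q': "q = mp_eval q'" using q by (auto simp: homfun_def)
  have "p \<in> polyfun (\<lambda>i v. v i)"
    unfolding p_def q' by (intro polyfun_mult' polyfun_mp_eval pf)
  then obtain d' r where r: "r \<in> homfun d'" "\<And>v. v l = 1 \<Longrightarrow> r v = p v" using homogenize by blast
  have rl: "(\<lambda>v. r v * v l) \<in> homfun (d' + 1)" by (intro homfun_mult r homfun_coord)
  define T where "T = {Q \<in> carrier A. \<forall>v\<in>Q. r v * v l \<noteq> 0}"
  have "openin (zariski (carrier A)) T" unfolding T_def by (rule openin_zariski[OF carrier_sub rl])
  moreover have key: "(r v * v l \<noteq> 0) \<longleftrightarrow> p (\<lambda>i. v i / v l) \<noteq> 0" if "v l \<noteq> 0" for v
    using homfun_scale[OF r(1), of "v l" "\<lambda>i. v i / v l"] that r(2)[of "\<lambda>i. v i / v l"] by simp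
  have norm: "(\<lambda>i. v i / v l) \<in> Q" if "Q \<in> carrier A" "v \<in> Q" "v l \<noteq> 0" for Q v
    using proj_space_scale[of Q v "1 / v l"] that carrier_sub by auto
  have "Q1 \<in> T"
  proof -
    let ?w = "\<lambda>i. v1 i / v1 l"
    have w: "?w \<in> Q1" using norm Q1 v1 l by blast
    have "(\<lambda>k. mp_eval (f k) (case_sum v0 ?w)) \<noteq> (\<lambda>_. 0)" using f1 v0 w by blast
    from f2[OF Q0 Q1(1) v0 w this] have "(\<lambda>k. mp_eval (f k) (case_sum v0 ?w)) \<in> Q0 \<otimes> Q1"
      using proj_pt_self by simp
    then have "p ?w \<noteq> 0" using Q1(2) by (auto simp: p_def)
    then have "r v1 * v1 l \<noteq> 0" using key l by blast
    then show ?thesis using homfun_vanish_iff(1)[OF _ v1 rl] Q1(1) carrier_sub by (auto simp: T_def)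
  qed
  moreover have "T \<subseteq> {Q \<in> carrier A. \<forall>v\<in>Q0 \<otimes> Q. q v * v j \<noteq> 0}"
  proof
    fix Q assume "Q \<in> T"
    then have Q: "Q \<in> carrier A" "\<forall>v\<in>Q. r v * v l \<noteq> 0" by (auto simp: T_def)
    obtain v where v: "v \<in> Q" using proj_space_nonempty Q carrier_sub by blast
    let ?w = "\<lambda>i. v i / v l"
    have w: "?w \<in> Q" "p ?w \<noteq> 0" using norm[OF Q(1) v] key[of v] Q(2) v by auto
    let ?u = "\<lambda>k. mp_eval (f k) (case_sum v0 ?w)"
    \<comment> \<open>This gives more than the inequality: \<open>?u\<close> is not the zero vector,
      so the local formula is valid here and \<open>?u\<close> represents the product.\<close>
    have u: "q ?u * ?u j \<noteq> 0" using w(2) by (simp add: p_def)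
    then have "?u \<noteq> (\<lambda>_. 0)" by (auto simp: fun_eq_iff)
    from f2[OF Q0 Q(1) v0 w(1) this] have "?u \<in> Q0 \<otimes> Q" using proj_pt_self by simp
    moreover have "Q0 \<otimes> Q \<in> proj_space" using Q0 Q(1) carrier_sub by blast
    ultimately show "Q \<in> {Q \<in> carrier A. \<forall>v\<in>Q0 \<otimes> Q. q v * v j \<noteq> 0}"
      using homfun_vanish_iff(1)[OF _ _ hq] u Q(1) by blast
  qed
  ultimately show "\<exists>T. openin (zariski (carrier A)) T \<and> Q1 \<in> T \<and> T \<subseteq> {Q \<in> carrier A. \<forall>v\<in>Q0 \<otimes> Q. q v * v j \<noteq> 0}"
    by blast
qed

text \<open>The image H of [m] is a subgroup that contains a nonempty open set U. If
  \<open>Q0\<close> were outside H, then U and its translate by the inverse of \<open>Q0\<close>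
  would lie in different cosets of H, hence be disjoint nonempty open sets, against
  irreducibility.\<close>

theorem pow_surj_chart:
  assumes m: "(of_nat m :: 'a) \<noteq> 0"
  shows "(\<lambda>P. P [^] m) ` carrier A = carrier A"
proof (rule ccontr)
  let ?H = "(\<lambda>P. P [^] m) ` carrier A"
  assume "?H \<noteq> carrier A"
  moreover have "?H \<subseteq> carrier A" by auto
  ultimately obtain Q0 where Q0: "Q0 \<in> carrier A" "Q0 \<notin> ?H" by blast
  from pow_image_open[OF m] obtain a where a0: "a \<in> polyfun y" "a \<noteq> 0 \<and> (\<forall>Q. a Q \<noteq> 0 \<longrightarrow> rho Q \<in> ?H)"
    by (elim bexE)
  note a = a0(1) conjunct1[OF a0(2)] conjunct2[OF a0(2), rule_format]
  from polyfun_lift[OF a(1)] obtain d q where lq0: "q \<in> homfun d"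
    "\<forall>P\<in>carrier A. \<forall>v\<in>P. v j \<noteq> 0 \<longrightarrow> q v = v j ^ d * a P" "\<forall>P. a P = q (\<lambda>i. y i P)"
    by (elim exE bexE conjE) (rule that)
  note q = lq0(1) lq0(2)[rule_format] lq0(3)[rule_format]
  define U where "U = {Q \<in> carrier A. \<forall>v\<in>Q. q v * v j \<noteq> 0}"
  define U' where "U' = {Q \<in> carrier A. \<forall>v\<in>Q0 \<otimes> Q. q v * v j \<noteq> 0}"
  have hq: "(\<lambda>v. q v * v j) \<in> homfun (d + 1)" by (intro homfun_mult q homfun_coord)
  have UH: "Q \<in> ?H" if "Q \<in> U" for Q
  proof -
    have Q: "Q \<in> carrier A" "\<forall>v\<in>Q. q v * v j \<noteq> 0" using that by (auto simp: U_def)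
    then obtain v where v: "v \<in> Q" using proj_space_nonempty carrier_sub by blast
    then have "v j \<noteq> 0" "a Q \<noteq> 0" using q(2)[OF Q(1) v] Q(2) by auto
    then show ?thesis using a(3)[of Q] chart_iff[OF Q(1) v] rho(3)[of Q] by simp
  qed
  have U'_iff: "Q \<in> U' \<longleftrightarrow> Q0 \<otimes> Q \<in> U" if "Q \<in> carrier A" for Q
    using that Q0 by (auto simp: U_def U'_def)
  have disj: "U \<inter> U' = {}"
  proof (rule ccontr)
    assume "U \<inter> U' \<noteq> {}"
    then obtain Q where Q: "Q \<in> U" "Q \<in> U'" by blast
    then have Qc: "Q \<in> carrier A" by (simp add: U_def)
    then have "Q0 \<otimes> Q \<in> ?H" "Q \<in> ?H" using UH Q U'_iff by blast+
    then obtain P P' where P: "P \<in> carrier A" "Q = P [^] m" "P' \<in> carrier A" "Q0 \<otimes> Q = P' [^] m" by blast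
    have "Q0 = (Q0 \<otimes> Q) \<otimes> inv Q" using Q0 Qc by (simp add: m_assoc)
    also have "\<dots> = (P' \<otimes> inv P) [^] m" using P by (simp add: nat_pow_distrib nat_pow_inv)
    finally show False using Q0(2) P by blast
  qed
  have "closedin (zariski (carrier A)) (carrier A - U)" "closedin (zariski (carrier A)) (carrier A - U')"
    using openin_zariski[OF carrier_sub hq] openin_translate[OF q(1) Q0(1)]
    unfolding U_def[symmetric] U'_def[symmetric]
    by (auto simp: closedin_def topspace_zariski[OF carrier_sub] U_def U'_def double_diff)
  moreover have "carrier A = (carrier A - U) \<union> (carrier A - U')" using disj by blast
  ultimately have "carrier A - U = carrier A \<or> carrier A - U' = carrier A"
    using irred unfolding irreducible_closed_def by blast
  then have "U = {} \<or> U' = {}" by (auto simp: U_def U'_def)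
  moreover obtain P where P: "a P \<noteq> 0" using a(2) by (auto simp: fun_eq_iff fun_app)
  have "rho P \<in> U"
  proof -
    have "q (\<lambda>i. y i P) * y j P \<noteq> 0" using P q(3) by (simp add: y_j)
    moreover have "rho P \<in> proj_space" using rho(2) carrier_sub by blast
    ultimately show ?thesis using homfun_vanish_iff(1)[OF _ y_mem hq] rho(2) by (auto simp: U_def)
  qed
  moreover have "inv Q0 \<otimes> rho P \<in> U'"
    using \<open>rho P \<in> U\<close> Q0 rho(2)[of P] by (subst U'_iff) (auto simp: m_assoc[symmetric])
  ultimately show False by blast
qed

end

theorem (in abelian_variety) pow_surj:
  assumes "(of_nat m :: 'a) \<noteq> 0"
  shows "(\<lambda>P. P [^] m) ` carrier A = carrier A"
proof -
  have "\<one> \<in> proj_space" using closed one_closed unfolding closed_over_def by blast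
  then obtain v where v: "v \<in> \<one>" "v \<noteq> (\<lambda>_. 0)" using proj_space_nonempty proj_space_mem(2) by blast
  then obtain j where "v j \<noteq> 0" by auto
  then interpret av_chart F A j by unfold_locales (use v in blast)
  show ?thesis by (rule pow_surj_chart[OF assms])
qed

section \<open>The Tate module\<close>

lemma residue_mod: "0 < n \<Longrightarrow> m dvd n \<Longrightarrow> residue z n mod int m = residue z m"
  using residue[of z] by blast

lemma residue_range: "0 < n \<Longrightarrow> residue z n \<in> {0..<int n}"
  using residue_mod[of n n z] pos_mod_bound[of "int n" "residue z n"] pos_mod_sign[of "int n" "residue z n"] by simp

lemma residue_of_nat: "residue (of_nat a) m = (if m = 0 then 0 else int a mod int m)"
  by (induction a) (auto simp: zero_zhat.rep_eq plus_zhat.rep_eq one_zhat.rep_eq mod_simps)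

lemma residue_of_int: "residue (of_int a) m = (if m = 0 then 0 else a mod int m)"
proof (cases a)
  case (nonneg n)
  then show ?thesis by (simp add: residue_of_nat)
next
  case (neg n)
  then have "of_int a = - (of_nat (Suc n) :: zhat)" by simp
  then show ?thesis unfolding neg by (simp add: uminus_zhat.rep_eq residue_of_nat mod_simps del: of_nat_Suc)
qed

section \<open>The Tate module, level by level\<close>

context comm_group
begin

lemma int_pow_cong:
  assumes "x \<in> carrier G" "x [^] (m::nat) = \<one>" "a mod int m = b mod int m"
  shows "x [^] (a::int) = x [^] b"
proof -
  obtain q where "a - b = int m * q" using assms(3) by (metis mod_eq_dvd_iff dvd_def)
  then have "x [^] (a - b) = (x [^] int m) [^] q" using assms(1) by (simp add: int_pow_pow)
  also have "\<dots> = \<one>" using assms by (simp add: int_pow_int)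
  finally have "x [^] (a - b) = \<one>" .
  moreover have "x [^] a = x [^] (a - b) \<otimes> x [^] b" using assms(1) by (simp add: int_pow_mult[symmetric])
  ultimately show ?thesis using assms(1) by simp
qed

lemma finprod_nat_pow:
  "finite I \<Longrightarrow> f \<in> I \<rightarrow> carrier G \<Longrightarrow> (\<Otimes>i\<in>I. f i) [^] (k::nat) = (\<Otimes>i\<in>I. f i [^] k)"
  by (induction I rule: finite_induct) (auto simp: nat_pow_distrib Pi_iff)

lemma torsion_of_iff: "x \<in> torsion_of m G \<longleftrightarrow> x \<in> carrier G \<and> x [^] m = \<one>"
  by (auto simp: torsion_of_def)

lemma tate_carrier:
  "t \<in> carrier (tate_module G) \<longleftrightarrow> t \<in> extensional {1..} \<and>
    (\<forall>m\<ge>1. t m \<in> carrier G \<and> t m [^] m = \<one>) \<and> (\<forall>m\<ge>1. \<forall>k\<ge>1. t (m * k) [^] k = t m)"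
  by (auto simp: tate_module_def PiE_def Pi_iff torsion_of_iff)

lemma tate_mem: "t \<in> carrier (tate_module G) \<Longrightarrow> 1 \<le> m \<Longrightarrow> t m \<in> carrier G"
  and tate_torsion: "t \<in> carrier (tate_module G) \<Longrightarrow> 1 \<le> m \<Longrightarrow> t m [^] m = \<one>"
  and tate_compat: "t \<in> carrier (tate_module G) \<Longrightarrow> 1 \<le> m \<Longrightarrow> 1 \<le> k \<Longrightarrow> t (m * k) [^] k = t m"
  by (simp_all add: tate_carrier)

lemma tate_eqI:
  assumes "t \<in> extensional {1..}" "s \<in> extensional {1..}" "\<And>m. 1 \<le> m \<Longrightarrow> t m = s m"
  shows "t = s"
  using assms by (intro extensionalityI[of _ "{1..}"]) auto

text \<open>\<open>lin_comb\<close> is a \<open>finsum\<close>, that is, a \<open>finprod\<close> in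
  the additive monoid; this makes it computable.\<close>

lemma tate_comm_monoid: "comm_monoid (add_monoid (tate_module G))"
proof (rule comm_monoidI)
  show "\<one>\<^bsub>add_monoid (tate_module G)\<^esub> \<in> carrier (add_monoid (tate_module G))"
    using tate_carrier[of "\<lambda>m\<in>{1..}. \<one>"] by (auto simp: tate_module_def)
  fix s t assume s: "s \<in> carrier (add_monoid (tate_module G))" and t: "t \<in> carrier (add_monoid (tate_module G))"
  then have st: "s \<in> carrier (tate_module G)" "t \<in> carrier (tate_module G)" by auto
  have "(\<lambda>m\<in>{1..}. s m \<otimes> t m) \<in> carrier (tate_module G)"
    unfolding tate_carrier
    using tate_mem[OF st(1)] tate_mem[OF st(2)] tate_torsion[OF st(1)] tate_torsion[OF st(2)]
      tate_compat[OF st(1)] tate_compat[OF st(2)]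
    by (auto simp: nat_pow_distrib)
  then show "s \<otimes>\<^bsub>add_monoid (tate_module G)\<^esub> t \<in> carrier (add_monoid (tate_module G))"
    by (simp add: tate_module_def)
  show "s \<otimes>\<^bsub>add_monoid (tate_module G)\<^esub> t = t \<otimes>\<^bsub>add_monoid (tate_module G)\<^esub> s"
    using tate_mem[OF st(1)] tate_mem[OF st(2)] by (auto simp: tate_module_def m_comm intro!: restrict_ext)
  fix u assume "u \<in> carrier (add_monoid (tate_module G))"
  then have u: "u \<in> carrier (tate_module G)" by simp
  show "(s \<otimes>\<^bsub>add_monoid (tate_module G)\<^esub> t) \<otimes>\<^bsub>add_monoid (tate_module G)\<^esub> u =
      s \<otimes>\<^bsub>add_monoid (tate_module G)\<^esub> (t \<otimes>\<^bsub>add_monoid (tate_module G)\<^esub> u)"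
    using tate_mem[OF st(1)] tate_mem[OF st(2)] tate_mem[OF u]
    by (auto simp: tate_module_def m_assoc intro!: restrict_ext)
next
  fix t assume "t \<in> carrier (add_monoid (tate_module G))"
  then have t: "t \<in> carrier (tate_module G)" by simp
  then show "\<one>\<^bsub>add_monoid (tate_module G)\<^esub> \<otimes>\<^bsub>add_monoid (tate_module G)\<^esub> t = t"
    using tate_mem[OF t] by (intro tate_eqI) (auto simp: tate_module_def PiE_def)
qed

lemma tate_smult_closed:
  assumes t: "t \<in> carrier (tate_module G)"
  shows "z \<odot>\<^bsub>tate_module G\<^esub> t \<in> carrier (tate_module G)"
proof -
  have "(\<lambda>m\<in>{1..}. t m [^] residue z m) \<in> carrier (tate_module G)"
    unfolding tate_carrier
  proof (intro conjI allI impI)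
    fix m :: nat assume m: "1 \<le> m"
    show "(\<lambda>m\<in>{1..}. t m [^] residue z m) m \<in> carrier G" using m tate_mem[OF t] by simp
    show "(\<lambda>m\<in>{1..}. t m [^] residue z m) m [^] m = \<one>"
      using m tate_mem[OF t m] tate_torsion[OF t m]
      by (simp add: int_pow_int[symmetric] int_pow_pow mult.commute[of "residue z m"])
         (simp add: int_pow_pow[symmetric])
    fix k :: nat assume k: "1 \<le> k"
    have c: "t (m * k) \<in> carrier G" using m k by (intro tate_mem[OF t]) (simp add: Suc_le_eq)
    have "(t (m * k) [^] residue z (m * k)) [^] k = (t (m * k) [^] k) [^] residue z (m * k)"
      using c by (simp add: int_pow_int[symmetric] int_pow_pow mult.commute)
    also have "\<dots> = t m [^] residue z (m * k)" by (simp add: tate_compat[OF t m k])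
    also have "\<dots> = t m [^] residue z m"
      using m k residue_mod[of "m * k" m z] residue_mod[of m m z] by (intro int_pow_cong[of _ m] tate_mem[OF t] tate_torsion[OF t]) auto
    finally show "(\<lambda>m\<in>{1..}. t m [^] residue z m) (m * k) [^] k = (\<lambda>m\<in>{1..}. t m [^] residue z m) m"
      using m k by (auto simp: Suc_le_eq)
  qed simp
  then show ?thesis by (simp add: tate_module_def)
qed

text \<open>Replaces the combination over the profinite integers by integer powers at each level, so
  that the later calculations take place in the groups of m-torsion.\<close>

lemma lin_comb_eq:
  assumes e: "e ` {..<r} \<subseteq> carrier (tate_module G)"
  shows "lin_comb (tate_module G) r z e = (\<lambda>m\<in>{1..}. \<Otimes>i\<in>{..<r}. e i m [^] residue (z i) m)"
proof -
  interpret T: comm_monoid "add_monoid (tate_module G)" by (rule tate_comm_monoid)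
  have "finprod (add_monoid (tate_module G)) (\<lambda>i. z i \<odot>\<^bsub>tate_module G\<^esub> e i) I =
      (\<lambda>m\<in>{1..}. \<Otimes>i\<in>I. e i m [^] residue (z i) m)" if "I \<subseteq> {..<r}" for I
    using finite_subset[OF that finite_lessThan] that
  proof (induction I rule: finite_induct)
    case empty
    show ?case by (subst T.finprod_empty) (simp add: tate_module_def)
  next
    case (insert i I)
    have cl: "(\<lambda>i. z i \<odot>\<^bsub>tate_module G\<^esub> e i) \<in> I \<rightarrow> carrier (add_monoid (tate_module G))"
      "z i \<odot>\<^bsub>tate_module G\<^esub> e i \<in> carrier (add_monoid (tate_module G))"
      using insert.prems e by (auto intro!: tate_smult_closed)
    have mem: "e l m \<in> carrier G" if "l \<in> insert i I" "1 \<le> m" for l m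
      using tate_mem[of "e l"] that insert.prems e by auto
    have "finprod (add_monoid (tate_module G)) (\<lambda>i. z i \<odot>\<^bsub>tate_module G\<^esub> e i) (insert i I) =
      (z i \<odot>\<^bsub>tate_module G\<^esub> e i) \<oplus>\<^bsub>tate_module G\<^esub> (\<lambda>m\<in>{1..}. \<Otimes>i\<in>I. e i m [^] residue (z i) m)"
    proof -
      have "I \<subseteq> {..<r}" using insert.prems by simp
      from insert.IH[OF this] show ?thesis by (subst T.finprod_insert[OF insert.hyps cl]) (simp only: monoid.simps)
    qed
    also have "\<dots> = (\<lambda>m\<in>{1..}. \<Otimes>i\<in>insert i I. e i m [^] residue (z i) m)"
      using insert.hyps mem by (auto simp: tate_module_def finprod_insert Pi_iff intro!: restrict_ext)
    finally show ?case .
  qed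
  then show ?thesis by (simp add: lin_comb_def finsum_def)
qed

end

text \<open>Varieties are left behind here: the argument on coordinates is carried by an abstract
  divisible abelian group with a basis of its Tate module.\<close>

locale tate_basis = comm_group G for G (structure) +
  fixes e :: "nat \<Rightarrow> nat \<Rightarrow> 'a" and r :: nat
  assumes divisible: "\<And>m. 1 \<le> m \<Longrightarrow> (\<lambda>x. x [^] (m::nat)) ` carrier G = carrier G"
    and basis: "is_basis (tate_module G) r e"
begin

lemma basis_sub: "e ` {..<r} \<subseteq> carrier (tate_module G)"
  using basis by (simp add: is_basis_def)

lemma basis_mem: "i < r \<Longrightarrow> e i \<in> carrier (tate_module G)"
  using basis_sub by auto

lemma basis_level: "i < r \<Longrightarrow> 1 \<le> m \<Longrightarrow> e i m \<in> carrier G" "i < r \<Longrightarrow> 1 \<le> m \<Longrightarrow> e i m [^] m = \<one>"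
  using tate_mem[OF basis_mem] tate_torsion[OF basis_mem] by auto

lemma lin_comb_cong: "(\<And>i. i < r \<Longrightarrow> z i = z' i) \<Longrightarrow> lin_comb (tate_module G) r z e = lin_comb (tate_module G) r z' e"
  unfolding lin_comb_eq[OF basis_sub]
  by (intro restrict_ext finprod_cong') (auto simp: Pi_iff intro!: int_pow_closed basis_level simp del: One_nat_def)

lemma basis_repr:
  assumes "t \<in> carrier (tate_module G)"
  obtains z where "t = lin_comb (tate_module G) r z e"
  using basis assms unfolding is_basis_def by blast

lemma basis_unique:
  assumes "lin_comb (tate_module G) r z e = lin_comb (tate_module G) r z' e"
    "lin_comb (tate_module G) r z e \<in> carrier (tate_module G)" "i < r"
  shows "z i = z' i"
proof -
  \<comment> \<open>Uniqueness in \<open>is_basis\<close> concerns extensional families of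
    coefficients, so both families are first cut down to the indices below r.\<close>
  let ?R = "\<lambda>z. restrict z {..<r}"
  have R: "lin_comb (tate_module G) r (?R w) e = lin_comb (tate_module G) r w e" for w
    by (rule lin_comb_cong) simp
  have "\<exists>!w. w \<in> extensional {..<r} \<and> lin_comb (tate_module G) r z e = lin_comb (tate_module G) r w e"
    using basis assms(2) unfolding is_basis_def by blast
  then have "?R z = ?R z'" using R[of z] R[of z'] assms(1) by (metis restrict_extensional)
  then show ?thesis using assms(3) by (metis lessThan_iff restrict_apply')
qed

lemma lin_comb_closed: "lin_comb (tate_module G) r z e \<in> carrier (tate_module G)"
proof -
  interpret T: comm_monoid "add_monoid (tate_module G)" by (rule tate_comm_monoid)
  have "finprod (add_monoid (tate_module G)) (\<lambda>i. z i \<odot>\<^bsub>tate_module G\<^esub> e i) {..<r} \<in> carrier (add_monoid (tate_module G))"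
    using basis_mem tate_smult_closed by (intro T.finprod_closed) auto
  then show ?thesis by (simp add: lin_comb_def finsum_def)
qed

text \<open>Roots of a torsion point are chosen compatibly along the factorials.\<close>

lemma tate_lift:
  assumes P: "P \<in> torsion_of m G" and m: "1 \<le> m"
  shows "\<exists>t\<in>carrier (tate_module G). t m = P"
proof -
  have Pc: "P \<in> carrier G" "P [^] m = \<one>" using P by (auto simp: torsion_of_iff)
  have "\<exists>Q. Q 0 = P \<and> (\<forall>i. Q i \<in> carrier G \<and> Q (Suc i) [^] Suc i = Q i)"
  proof -
    have "\<exists>Q. Q 0 = P \<and> (\<forall>i. Q i \<in> carrier G) \<and> (\<forall>i. Q (Suc i) [^] Suc i = Q i)"
    proof -
      have ex: "\<exists>x'. x' \<in> carrier G \<and> x' [^] Suc i = x" if "x \<in> carrier G" for x i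
        using divisible[of "Suc i"] that by (metis imageE le_add1 plus_1_eq_Suc)
      have "\<exists>Q. \<forall>n. (Q n \<in> carrier G \<and> (n = 0 \<longrightarrow> Q n = P)) \<and> Q (Suc n) [^] Suc n = Q n"
        by (rule dependent_nat_choice) (use Pc ex in auto)
      then show ?thesis by metis
    qed
    then show ?thesis by blast
  qed
  then obtain Q where Q: "Q 0 = P" "\<And>i. Q i \<in> carrier G" "\<And>i. Q (Suc i) [^] Suc i = Q i" by blast
  have Qpow: "Q (i + k) [^] (fact (i + k) div fact i :: nat) = Q i" for i k
  proof (induction k)
    case (Suc k)
    have "fact (i + Suc k) div fact i = Suc (i + k) * (fact (i + k) div fact i :: nat)"
      by (simp add: div_mult_swap fact_dvd mult.commute del: mult_Suc mult_Suc_right)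
    then have "Q (i + Suc k) [^] (fact (i + Suc k) div fact i :: nat) = (Q (Suc (i + k)) [^] Suc (i + k)) [^] (fact (i + k) div fact i :: nat)"
      by (simp only: nat_pow_pow[OF Q(2)] add_Suc_right)
    then show ?case using Q(3)[of "i + k"] Suc by simp
  qed (use Q in auto)
  \<comment> \<open>\<open>Q k\<close> is a root of P of exponent k!, so in additive notation
    \<open>t k\<close> is (m / k) P. Hence \<open>t m\<close> is P, and k times \<open>t k\<close>
    is m P, which is trivial.\<close>
  define t where "t = (\<lambda>k\<in>{1..}. Q k [^] (m * (fact k div k) :: nat))"
  have kd: "k dvd fact k" if "1 \<le> k" for k :: nat using that by (intro dvd_fact) auto
  have "t \<in> carrier (tate_module G)"
    unfolding tate_carrier
  proof (intro conjI allI impI)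
    fix k :: nat assume k: "1 \<le> k"
    show "t k \<in> carrier G" using k Q(2) by (simp add: t_def)
    have "m * (fact k div k) * k = fact k * m"
      using kd[OF k] by (metis dvd_div_mult_self mult.assoc mult.commute)
    moreover have "t k [^] k = Q k [^] (m * (fact k div k) * k)"
      using k Q(2) by (simp add: t_def nat_pow_pow)
    ultimately have "t k [^] k = Q k [^] (fact k * m)" by (simp only:)
    also have "\<dots> = (Q k [^] (fact k :: nat)) [^] m" using Q(2) by (simp add: nat_pow_pow)
    also have "\<dots> = \<one>" using Qpow[of 0 k] Q(1) Pc by simp
    finally show "t k [^] k = \<one>" .
    fix l :: nat assume l: "1 \<le> l"
    have kl: "1 \<le> k * l" using k l by (simp add: Suc_le_eq)
    define s where "s = k * l - k"
    have s: "k * l = k + s" using l by (simp add: s_def)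
    have "t (k * l) [^] l = Q (k * l) [^] (m * (fact (k * l) div (k * l)) * l)"
      using kl Q(2) by (simp add: t_def nat_pow_pow)
    also have "m * (fact (k * l) div (k * l)) * l = (fact (k * l) div fact k) * (m * (fact k div k))"
    proof -
      obtain a where a: "fact (k * l) = (k * l) * a" using kd[OF kl] by (auto simp: dvd_def)
      obtain b where b: "fact k = k * b" using kd[OF k] by (auto simp: dvd_def)
      have "(fact k :: nat) dvd fact (k * l)" using l by (intro fact_dvd) simp
      then obtain c where c: "(fact (k * l) :: nat) = fact k * c" by (auto simp: dvd_def)
      have k0: "k \<noteq> 0" "l \<noteq> 0" using k l by auto
      have "k * (l * a) = k * (b * c)" using a b c by (metis mult.assoc)
      then have "l * a = b * c" by (simp only: mult_left_cancel[OF k0(1)])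
      moreover have "fact (k * l) div (k * l) = a" using a k0 by simp
      moreover have "fact k div k = b" using b k0 by simp
      moreover have "fact (k * l) div fact k = c" using c by simp
      ultimately show ?thesis by (simp add: mult_ac)
    qed
    also have "Q (k * l) [^] \<dots> = (Q (k * l) [^] (fact (k * l) div fact k :: nat)) [^] (m * (fact k div k))"
      using Q(2) by (simp add: nat_pow_pow)
    also have "\<dots> = t k" using Qpow[of k s] k by (simp add: s t_def)
    finally show "t (k * l) [^] l = t k" .
  qed (simp add: t_def)
  moreover have "t m = P"
    using m kd[OF m] Qpow[of 0 m] Q(1) by (simp add: t_def)
  ultimately show ?thesis by blast
qed

lemma torsion_repr:
  assumes "P \<in> torsion_of m G" "1 \<le> m"
  obtains c where "\<And>i. c i \<in> {0..<int m}" "P = (\<Otimes>i\<in>{..<r}. e i m [^] c i)"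
proof -
  obtain t where t: "t \<in> carrier (tate_module G)" "t m = P" using tate_lift[OF assms] by blast
  obtain z where "t = lin_comb (tate_module G) r z e" using basis_repr[OF t(1)] by blast
  then have "P = (\<Otimes>i\<in>{..<r}. e i m [^] residue (z i) m)" using t assms(2) by (simp add: lin_comb_eq[OF basis_sub])
  then show ?thesis using residue_range[of m] assms(2) by (intro that[of "\<lambda>i. residue (z i) m"]) auto
qed

lemma finite_torsion_of:
  assumes "1 \<le> m"
  shows "finite (torsion_of m G)"
proof (rule finite_subset)
  show "torsion_of m G \<subseteq> (\<lambda>c. \<Otimes>i\<in>{..<r}. e i m [^] c i) ` ({..<r} \<rightarrow>\<^sub>E {0..<int m})"
  proof
    fix P assume "P \<in> torsion_of m G"
    then obtain c where c: "\<And>i. c i \<in> {0..<int m}" "P = (\<Otimes>i\<in>{..<r}. e i m [^] c i)"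
      using torsion_repr assms by blast
    have "P = (\<Otimes>i\<in>{..<r}. e i m [^] restrict c {..<r} i)"
      unfolding c(2) using basis_level(1)[OF _ assms] by (intro finprod_cong) (auto simp: simp_implies_def)
    then show "P \<in> (\<lambda>c. \<Otimes>i\<in>{..<r}. e i m [^] c i) ` ({..<r} \<rightarrow>\<^sub>E {0..<int m})"
      using c(1) by (intro image_eqI[of _ _ "restrict c {..<r}"]) auto
  qed
qed (intro finite_imageI finite_PiE; simp)

text \<open>The Tate vector t with coefficients \<open>c i\<close> is trivial at level m. Then
  \<open>s k = t (m * k)\<close> defines a Tate vector s with m s = t, and comparing the
  coefficients of t and s shows that each \<open>c i\<close> is divisible by m.\<close>

lemma basis_independent:
  assumes m: "1 \<le> m" and c: "(\<Otimes>i\<in>{..<r}. e i m [^] (c i :: int)) = \<one>" and i: "i < r"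
  shows "int m dvd c i"
proof -
  define t where "t = lin_comb (tate_module G) r (\<lambda>i. of_int (c i)) e"
  have t: "t \<in> carrier (tate_module G)" by (simp add: t_def lin_comb_closed)
  have "t m = (\<Otimes>i\<in>{..<r}. e i m [^] (c i mod int m))"
    using m by (simp add: t_def lin_comb_eq[OF basis_sub] residue_of_int)
  also have "\<dots> = (\<Otimes>i\<in>{..<r}. e i m [^] c i)"
    using m by (intro finprod_cong) (auto simp: simp_implies_def basis_level intro!: int_pow_cong[of _ m])
  finally have tm: "t m = \<one>" using c by simp
  define s where "s = (\<lambda>k\<in>{1..}. t (m * k))"
  have s: "s \<in> carrier (tate_module G)"
    unfolding tate_carrier
  proof (intro conjI allI impI)
    fix k :: nat assume k: "1 \<le> k"
    then have mk: "1 \<le> m * k" using m by (simp add: Suc_le_eq)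
    show "s k \<in> carrier G" using k mk tate_mem[OF t] by (simp add: s_def)
    show "s k [^] k = \<one>" using k tate_compat[OF t m k] tm by (simp add: s_def)
    fix l :: nat assume l: "1 \<le> l"
    have "1 \<le> k * l" using k l by (simp add: Suc_le_eq)
    then show "s (k * l) [^] l = s k" using tate_compat[OF t mk l] k by (simp add: s_def mult.assoc)
  qed (simp add: s_def)
  obtain z where z: "s = lin_comb (tate_module G) r z e" using basis_repr[OF s] by blast
  have "t = lin_comb (tate_module G) r (\<lambda>i. of_nat m * z i) e"
  proof (rule tate_eqI)
    show "t \<in> extensional {1..}" using t by (simp add: tate_carrier)
    show "lin_comb (tate_module G) r (\<lambda>i. of_nat m * z i) e \<in> extensional {1..}"
      by (simp add: lin_comb_eq[OF basis_sub])
    fix k :: nat assume k: "1 \<le> k"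
    have "t k = s k [^] m" using tate_compat[OF t k m] k by (simp add: s_def mult.commute)
    also have "\<dots> = (\<Otimes>i\<in>{..<r}. (e i k [^] residue (z i) k) [^] m)"
      using k basis_level(1)[OF _ k] by (subst z) (auto simp: lin_comb_eq[OF basis_sub] intro!: finprod_nat_pow)
    also have "\<dots> = (\<Otimes>i\<in>{..<r}. e i k [^] residue (of_nat m * z i) k)"
    proof (rule finprod_cong')
      show "(\<lambda>i. e i k [^] residue (of_nat m * z i) k) \<in> {..<r} \<rightarrow> carrier G" using basis_level(1)[OF _ k] by auto
      fix i assume "i \<in> {..<r}"
      then have i: "e i k \<in> carrier G" "e i k [^] k = \<one>" using basis_level k by auto
      have "(e i k [^] residue (z i) k) [^] m = e i k [^] (residue (z i) k * int m)"
        using i by (simp add: int_pow_int[symmetric] int_pow_pow)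
      also have "\<dots> = e i k [^] residue (of_nat m * z i) k"
        using k by (intro int_pow_cong[OF i]) (simp add: times_zhat.rep_eq residue_of_nat mod_simps mult.commute)
      finally show "(e i k [^] residue (z i) k) [^] m = e i k [^] residue (of_nat m * z i) k" .
    qed simp
    finally show "t k = lin_comb (tate_module G) r (\<lambda>i. of_nat m * z i) e k"
      using k by (simp add: lin_comb_eq[OF basis_sub])
  qed
  then have "of_int (c i) = of_nat m * z i"
    using basis_unique[OF _ _ i, of "\<lambda>i. of_int (c i)" "\<lambda>i. of_nat m * z i"] t by (simp add: t_def)
  then have "residue (of_int (c i)) m = residue (of_nat m * z i) m" by simp
  then have "c i mod int m = 0" using m by (simp add: residue_of_int times_zhat.rep_eq residue_of_nat)
  then show ?thesis by auto
qed

end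

section \<open>Transvections in the image of the adelic representation\<close>

lemma (in comm_group) hom_finprod:
  assumes s: "s \<in> hom G G" and "finite I" "f \<in> I \<rightarrow> carrier G"
  shows "s (\<Otimes>i\<in>I. f i) = (\<Otimes>i\<in>I. s (f i))"
proof -
  interpret group_hom G G s by unfold_locales (rule s)
  show ?thesis using assms(2,3)
    by (induction I rule: finite_induct) (auto simp: Pi_iff)
qed

text \<open>In additive notation: if s = 1 + N and N (N P) = 0, then s^k P = P + k N P.\<close>

lemma (in comm_group) hom_funpow_mult:
  assumes s: "s \<in> hom G G" and "P \<in> carrier G" "\<delta> \<in> carrier G" "s P = P \<otimes> \<delta>" "s \<delta> = \<delta>"
  shows "(s ^^ k) P = P \<otimes> \<delta> [^] k"
proof (induction k)
  case (Suc k)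
  interpret group_hom G G s by unfold_locales (rule s)
  have "s (\<delta> [^] k) = \<delta> [^] k" using assms by (simp add: hom_nat_pow)
  then show ?case using Suc assms by (simp add: m_assoc m_comm)
qed (use assms in auto)

lemma (in comm_group) finprod_single:
  "finite I \<Longrightarrow> l \<in> I \<Longrightarrow> x \<in> carrier G \<Longrightarrow> (\<Otimes>i\<in>I. if i = l then x else \<one>) = x"
  using finprod_singleton[of l I "\<lambda>_. x"] by (simp add: eq_commute[of l])

context tate_basis
begin

text \<open>Covers both unipotent elements at once: the vectors with index i in I are moved along
  those with index \<pi>(i), which s fixes. So s^k displaces the given point by the combination of
  the latter with coefficients k a c(i), which is trivial if the point is fixed;
  \<open>basis_independent\<close> concludes.\<close>

lemma transvection_fixed:
  fixes a :: int and c :: "nat \<Rightarrow> int"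
  assumes m: "1 \<le> m" and s: "s \<in> hom G G" and I: "I \<subseteq> {..<r}" and \<pi>: "inj_on \<pi> I" "\<pi> ` I \<subseteq> {..<r} - I"
    and fix_out: "\<And>i. i < r \<Longrightarrow> i \<notin> I \<Longrightarrow> s (e i m) = e i m"
    and act: "\<And>i. i \<in> I \<Longrightarrow> s (e i m) = e i m \<otimes> e (\<pi> i) m [^] a"
    and P: "(s ^^ k) (\<Otimes>i\<in>{..<r}. e i m [^] c i) = (\<Otimes>i\<in>{..<r}. e i m [^] c i)"
    and i: "i \<in> I"
  shows "int m dvd int k * a * c i"
proof -
  interpret s: group_hom G G s by unfold_locales (rule s)
  have finI: "finite I" using I finite_subset by blast
  have eG: "e i m \<in> carrier G" if "i < r" for i using basis_level(1)[OF that m] .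
  have \<pi>r: "\<pi> i < r" "\<pi> i \<notin> I" if "i \<in> I" for i using \<pi>(2) that by auto
  define Q where "Q = (\<Otimes>i\<in>{..<r}. e i m [^] c i)"
  define \<delta> where "\<delta> = (\<Otimes>i\<in>I. e (\<pi> i) m [^] (a * c i))"
  have QG: "Q \<in> carrier G" and \<delta>G: "\<delta> \<in> carrier G" using eG \<pi>r by (auto simp: Q_def \<delta>_def Pi_iff)
  have \<delta>': "\<delta> = (\<Otimes>i\<in>{..<r}. if i \<in> I then e (\<pi> i) m [^] (a * c i) else \<one>)"
    unfolding \<delta>_def using I eG \<pi>r finI by (subst finprod_mono_neutral_cong_right[of "{..<r}" I]) auto
  have "s Q = (\<Otimes>i\<in>{..<r}. s (e i m [^] c i))"
    unfolding Q_def using eG by (intro hom_finprod s) auto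
  also have "\<dots> = (\<Otimes>i\<in>{..<r}. e i m [^] c i \<otimes> (if i \<in> I then e (\<pi> i) m [^] (a * c i) else \<one>))"
  proof (rule finprod_cong')
    fix i assume "i \<in> {..<r}"
    then show "s (e i m [^] c i) = e i m [^] c i \<otimes> (if i \<in> I then e (\<pi> i) m [^] (a * c i) else \<one>)"
      using eG \<pi>r[of i] fix_out[of i] act[of i]
      by (auto simp: s.hom_int_pow int_pow_distrib int_pow_pow)
  qed (use eG \<pi>r in auto)
  also have "\<dots> = Q \<otimes> \<delta>"
    unfolding Q_def \<delta>' using eG \<pi>r by (intro finprod_multf) auto
  finally have sQ: "s Q = Q \<otimes> \<delta>" .
  have "s \<delta> = (\<Otimes>i\<in>I. s (e (\<pi> i) m [^] (a * c i)))"
    unfolding \<delta>_def using eG \<pi>r finI by (intro hom_finprod s) auto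
  also have "\<dots> = \<delta>"
    unfolding \<delta>_def using eG \<pi>r fix_out by (intro finprod_cong') (auto simp: s.hom_int_pow)
  finally have "(s ^^ k) Q = Q \<otimes> \<delta> [^] k" by (intro hom_funpow_mult s QG \<delta>G sQ)
  then have "Q \<otimes> \<delta> [^] k = Q" using P by (simp add: Q_def)
  then have "\<delta> [^] k = \<one>" using QG \<delta>G by (simp add: r_cancel_one)
  moreover have "\<delta> [^] k = (\<Otimes>i\<in>I. e (\<pi> i) m [^] (int k * a * c i))"
    unfolding \<delta>_def using eG \<pi>r finI
    by (subst finprod_nat_pow) (auto simp: int_pow_int[symmetric] int_pow_pow mult_ac intro!: finprod_cong')
  ultimately have 1: "(\<Otimes>i\<in>I. e (\<pi> i) m [^] (int k * a * c i)) = \<one>" by simp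
  \<comment> \<open>\<open>basis_independent\<close> wants coefficients for all indices below r:
    those of the displacement are carried along \<pi> and set to 0 elsewhere.\<close>
  define d where "d l = (if l \<in> \<pi> ` I then int k * a * c (the_inv_into I \<pi> l) else 0)" for l
  have d: "d (\<pi> i) = int k * a * c i" if "i \<in> I" for i
    using that \<pi>(1) by (simp add: d_def the_inv_into_f_f)
  have "(\<Otimes>l\<in>{..<r}. e l m [^] d l) = (\<Otimes>l\<in>\<pi> ` I. e l m [^] d l)"
    using \<pi> eG finI by (intro finprod_mono_neutral_cong_left[symmetric]) (auto simp: d_def)
  also have "\<dots> = (\<Otimes>i\<in>I. e (\<pi> i) m [^] d (\<pi> i))"
    using \<pi> eG by (intro finprod_reindex) auto
  also have "\<dots> = (\<Otimes>i\<in>I. e (\<pi> i) m [^] (int k * a * c i))"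
    using eG \<pi>r d by (intro finprod_cong') auto
  finally have "int m dvd d (\<pi> i)" using 1 \<pi>r[OF i] by (intro basis_independent[OF m]) auto
  then show ?thesis using d[OF i] by simp
qed

text \<open>The map s restricts the coordinates from g on, s' those below g. As k is invertible
  modulo m, each of a and b annihilates one half, and their product annihilates both.\<close>

lemma two_transvections:
  fixes a b :: nat
  assumes r: "r = 2 * g" and m: "1 \<le> m" and s: "s \<in> hom G G" and s': "s' \<in> hom G G"
    and s_fix: "\<And>i. i < g \<Longrightarrow> s (e i m) = e i m"
    and s_act: "\<And>i. i < g \<Longrightarrow> s (e (i + g) m) = e (i + g) m \<otimes> e i m [^] int a"
    and s'_fix: "\<And>i. i < g \<Longrightarrow> s' (e (i + g) m) = e (i + g) m"
    and s'_act: "\<And>i. i < g \<Longrightarrow> s' (e i m) = e i m \<otimes> e (i + g) m [^] int b"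
    and P: "P \<in> torsion_of m G" "(s ^^ k) P = P" "(s' ^^ k) P = P" and cop: "coprime k m"
  shows "P [^] (a * b) = \<one>"
proof -
  obtain c where c: "P = (\<Otimes>i\<in>{..<r}. e i m [^] (c i :: int))" using torsion_repr[OF P(1) m] by blast
  have eG: "e i m \<in> carrier G" if "i < r" for i using basis_level(1)[OF that m] .
  have 1: "int m dvd int k * int a * c i" if "i \<in> {g..<r}" for i
  proof (rule transvection_fixed[OF m s, where \<pi> = "\<lambda>i. i - g" and I = "{g..<r}"])
    show "(s ^^ k) (\<Otimes>i\<in>{..<r}. e i m [^] c i) = (\<Otimes>i\<in>{..<r}. e i m [^] c i)" using P c by simp
    show "s (e i m) = e i m \<otimes> e (i - g) m [^] int a" if "i \<in> {g..<r}" for i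
      using s_act[of "i - g"] that r by auto
  qed (use that r s_fix in \<open>auto simp: inj_on_def\<close>)
  have 2: "int m dvd int k * int b * c i" if "i \<in> {..<g}" for i
  proof (rule transvection_fixed[OF m s', where \<pi> = "\<lambda>i. i + g" and I = "{..<g}"])
    show "(s' ^^ k) (\<Otimes>i\<in>{..<r}. e i m [^] c i) = (\<Otimes>i\<in>{..<r}. e i m [^] c i)" using P c by simp
    show "s' (e i m) = e i m" if "i < r" "i \<notin> {..<g}" for i
      using s'_fix[of "i - g"] that r by auto
  qed (use that r s'_act in \<open>auto simp: inj_on_def\<close>)
  have dv: "int m dvd c i * int (a * b)" if "i < r" for i
  proof -
    have "int m dvd int k * (c i * int (a * b))"
    proof (cases "i < g")
      case True
      then have "int m dvd (int k * int b * c i) * int a" using 2[of i] True by (intro dvd_mult2[of _ "int k * int b * c i"]) simp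
      then show ?thesis by (simp add: mult_ac)
    next
      case False
      then have "int m dvd (int k * int a * c i) * int b" using 1[of i] that False by (intro dvd_mult2[of _ "int k * int a * c i"]) simp
      then show ?thesis by (simp add: mult_ac)
    qed
    moreover have "coprime (int m) (int k)" using cop by (simp add: coprime_commute)
    ultimately show ?thesis using coprime_dvd_mult_right_iff by blast
  qed
  have "P [^] (a * b) = (\<Otimes>i\<in>{..<r}. (e i m [^] c i) [^] (a * b))"
    unfolding c using eG by (intro finprod_nat_pow) auto
  also have "\<dots> = (\<Otimes>i\<in>{..<r}. \<one>)"
  proof (rule finprod_cong')
    fix i assume "i \<in> {..<r}"
    then have i: "i < r" by simp
    have "(e i m [^] c i) [^] (a * b) = e i m [^] (c i * int (a * b))"
      using eG[OF i] by (simp add: int_pow_int[symmetric] int_pow_pow)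
    also have "\<dots> = e i m [^] (0::int)"
      using dv[OF i] by (intro int_pow_cong[of _ m] eG[OF i] basis_level(2)[OF i m]) simp
    finally show "(e i m [^] c i) [^] (a * b) = \<one>" by simp
  qed auto
  finally show ?thesis by simp
qed

end

text \<open>The columns of \<open>adelic_rep\<close> are the images of the basis vectors, so the
  upper matrix fixes the first g vectors and moves the others; the lower one does the
  opposite.\<close>

definition upper_transvection :: "nat \<Rightarrow> int \<Rightarrow> 'r::comm_ring_1 mat" where
  "upper_transvection g a = four_block_mat (1\<^sub>m g) (of_int a \<cdot>\<^sub>m 1\<^sub>m g) (0\<^sub>m g g) (1\<^sub>m g)"

definition lower_transvection :: "nat \<Rightarrow> int \<Rightarrow> 'r::comm_ring_1 mat" where
  "lower_transvection g a = four_block_mat (1\<^sub>m g) (0\<^sub>m g g) (of_int a \<cdot>\<^sub>m 1\<^sub>m g) (1\<^sub>m g)"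

lemma transvection_carrier:
  "upper_transvection g a \<in> carrier_mat (2 * g) (2 * g)" "lower_transvection g a \<in> carrier_mat (2 * g) (2 * g)"
  by (auto simp: upper_transvection_def lower_transvection_def)

lemma transvection_0:
  "upper_transvection g 0 = 1\<^sub>m (2 * g)" "lower_transvection g 0 = 1\<^sub>m (2 * g)"
  by (auto simp: upper_transvection_def lower_transvection_def intro!: eq_matI)

lemma smult_one_mat_add: "(of_int a \<cdot>\<^sub>m 1\<^sub>m g :: 'r::comm_ring_1 mat) + of_int b \<cdot>\<^sub>m 1\<^sub>m g = of_int (a + b) \<cdot>\<^sub>m 1\<^sub>m g"
  by (intro eq_matI) auto

lemma transvection_add:
  "upper_transvection g (a + b) = upper_transvection g a * (upper_transvection g b :: 'r::comm_ring_1 mat)"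
  "lower_transvection g (a + b) = lower_transvection g a * (lower_transvection g b :: 'r::comm_ring_1 mat)"
  unfolding upper_transvection_def lower_transvection_def
  by (subst mult_four_block_mat[where ?nr1.0 = g and ?n1.0 = g and ?n2.0 = g and ?nr2.0 = g and ?nc1.0 = g and ?nc2.0 = g];
      auto simp: smult_one_mat_add add.commute[of b] simp del: of_int_add)+

lemma transvection_entry:
  assumes "i < 2 * g" "j < 2 * g"
  shows "upper_transvection g a $$ (i, j) = (if i = j then 1 else if j = i + g then of_int a else 0)"
    and "lower_transvection g a $$ (i, j) = (if i = j then 1 else if i = j + g then of_int a else 0)"
  using assms by (auto simp: upper_transvection_def lower_transvection_def)

text \<open>Transposition exchanges the two kinds because the off-diagonal block is a scalar matrix;
  the rest is block multiplication.\<close>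

lemma transvection_Sp:
  "(upper_transvection g a :: 'r::comm_ring_1 mat) \<in> carrier (Sp g)"
  "(lower_transvection g a :: 'r::comm_ring_1 mat) \<in> carrier (Sp g)"
proof -
  note mult = mult_four_block_mat[where ?nr1.0 = g and ?n1.0 = g and ?n2.0 = g and ?nr2.0 = g and ?nc1.0 = g and ?nc2.0 = g]
  let ?a = "of_int a \<cdot>\<^sub>m 1\<^sub>m g :: 'r mat" and ?O = "0\<^sub>m g g :: 'r mat" and ?I = "1\<^sub>m g :: 'r mat"
  have neg: "- ?a + ?a = ?O" "?a + - ?a = ?O" "- ?I * ?a = - ?a" "?a * - ?I = - ?a"
    by (auto intro!: eq_matI simp: scalar_prod_def)
  have tr: "transpose_mat (upper_transvection g a) = (lower_transvection g a :: 'r mat)"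
    "transpose_mat (lower_transvection g a) = (upper_transvection g a :: 'r mat)"
    unfolding upper_transvection_def lower_transvection_def by (auto intro!: eq_matI)
  have "(lower_transvection g a :: 'r mat) * symp_form g = four_block_mat ?O ?I (- ?I) ?a"
    unfolding lower_transvection_def symp_form_def by (subst mult) (auto simp: neg)
  moreover have "four_block_mat ?O ?I (- ?I) ?a * upper_transvection g a = symp_form g"
    unfolding upper_transvection_def symp_form_def by (subst mult) (auto simp: neg)
  ultimately show "(upper_transvection g a :: 'r mat) \<in> carrier (Sp g)"
    using transvection_carrier(1) by (simp add: Sp_def tr)
  have "(upper_transvection g a :: 'r mat) * symp_form g = four_block_mat (- ?a) ?I (- ?I) ?O"
    unfolding upper_transvection_def symp_form_def by (subst mult) (auto simp: neg)
  moreover have "four_block_mat (- ?a) ?I (- ?I) ?O * lower_transvection g a = symp_form g"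
    unfolding lower_transvection_def symp_form_def by (subst mult) (auto simp: neg)
  ultimately show "(lower_transvection g a :: 'r mat) \<in> carrier (Sp g)"
    using transvection_carrier(2) by (simp add: Sp_def tr)
qed

text \<open>By the pigeonhole principle, two members of the family lie in the same coset of \<open>H\<close>.\<close>

lemma finite_index_power:
  fixes V :: "int \<Rightarrow> 'r::comm_ring_1 mat"
  assumes V: "V 0 = 1\<^sub>m (2 * g)" "\<And>a b. V (a + b) = V a * V b" "\<And>a. V a \<in> carrier (Sp g)"
    and H: "H \<subseteq> carrier (Sp g)" "1\<^sub>m (2 * g) \<in> H" "finite (rcosets\<^bsub>Sp g\<^esub> H)"
  shows "\<exists>n::nat. 0 < n \<and> V (int n) \<in> H"
proof -
  have carr: "M \<in> carrier_mat (2 * g) (2 * g)" if "M \<in> carrier (Sp g)" for M :: "'r mat"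
    using that by (simp add: Sp_def)
  define C where "C i = H #>\<^bsub>Sp g\<^esub> V (int i)" for i :: nat
  have "C i \<in> rcosets\<^bsub>Sp g\<^esub> H" for i using V(3) by (auto simp: C_def RCOSETS_def)
  then have "finite (range C)" using H(3) by (meson finite_subset image_subsetI)
  then have "\<not> inj C" using finite_imageD infinite_UNIV_nat by blast
  then obtain i j where ij: "i < j" "C i = C j" unfolding inj_def by (metis linorder_neqE_nat)
  have "1\<^sub>m (2 * g) * V (int j) \<in> C j" unfolding C_def r_coset_def using H(2) by (auto simp: Sp_def)
  moreover have "1\<^sub>m (2 * g) * V (int j) = V (int j)" by (rule left_mult_one_mat[OF carr[OF V(3)]])
  \<comment> \<open>The identity lies in H, so V(j) lies in its own coset, which is that of V(i).
    Thus V(j) = h V(i) with h in H, and additivity of V in the exponent gives h = V(j - i).\<close>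
  ultimately have "V (int j) \<in> C i" using ij by simp
  then obtain h where h: "h \<in> H" "V (int j) = h * V (int i)" unfolding C_def r_coset_def by (auto simp: Sp_def)
  have hc: "h \<in> carrier_mat (2 * g) (2 * g)" using carr h(1) H(1) by blast
  have "h = h * V (int i + - int i)" using V(1) right_mult_one_mat[OF hc] by simp
  also have "\<dots> = (h * V (int i)) * V (- int i)"
    unfolding V(2) by (rule assoc_mult_mat[OF hc carr[OF V(3)] carr[OF V(3)], symmetric])
  also have "\<dots> = V (int j + - int i)" by (simp only: h(2)[symmetric] V(2))
  also have "int j + - int i = int (j - i)" using ij by simp
  finally show ?thesis using h(1) ij by (intro exI[of _ "j - i"]) auto
qed

section \<open>The matrices of Galois elements on the Tate module\<close>

context tate_basis
begin

lemma lin_comb_unit: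
  assumes "j < r" "1 \<le> m"
  shows "lin_comb (tate_module G) r (\<lambda>i. if i = j then 1 else 0) e m = e j m"
proof -
  have "lin_comb (tate_module G) r (\<lambda>i. if i = j then 1 else 0) e m =
      (\<Otimes>i\<in>{..<r}. if i = j then e j m else \<one>)"
    using assms(2) unfolding lin_comb_eq[OF basis_sub]
  proof (simp, intro finprod_cong')
    fix i assume "i \<in> {..<r}"
    \<comment> \<open>For m = 1 the residue of 1 is 0, so the exponents agree only modulo m, which
      is enough on m-torsion.\<close>
    then have "e i m [^] (1 mod int m) = e i m [^] (1::int)"
      using assms(2) by (intro int_pow_cong[of _ m] basis_level) auto
    then show "e i m [^] residue (if i = j then 1 else 0) m = (if i = j then e j m else \<one>)"
      using assms basis_level(1)[OF assms] by (auto simp: one_zhat.rep_eq zero_zhat.rep_eq int_pow_1)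
  qed (use basis_level(1)[OF assms] in auto)
  then show ?thesis using basis_level(1)[OF assms] assms by (simp add: finprod_single)
qed

lemma lin_comb_transvection:
  assumes "j < r" "l < r" "j \<noteq> l" "1 \<le> m"
  shows "lin_comb (tate_module G) r (\<lambda>i. if i = j then 1 else if i = l then of_int a else 0) e m =
    e j m \<otimes> e l m [^] a"
proof -
  have eG: "e j m \<in> carrier G" "e l m \<in> carrier G" using basis_level(1) assms by auto
  have "lin_comb (tate_module G) r (\<lambda>i. if i = j then 1 else if i = l then of_int a else 0) e m =
      (\<Otimes>i\<in>{..<r}. (if i = j then e j m else \<one>) \<otimes> (if i = l then e l m [^] a else \<one>))"
    using assms(4) unfolding lin_comb_eq[OF basis_sub]
  proof (simp, intro finprod_cong')
    fix i assume "i \<in> {..<r}"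
    then have i: "i < r" by simp
    have "e i m [^] (1 mod int m) = e i m [^] (1::int)" "e i m [^] (a mod int m) = e i m [^] a"
      using i assms(4) by (intro int_pow_cong[of _ m] basis_level; simp)+
    then show "e i m [^] residue (if i = j then 1 else if i = l then of_int a else 0) m =
      (if i = j then e j m else \<one>) \<otimes> (if i = l then e l m [^] a else \<one>)"
      using assms eG by (auto simp: one_zhat.rep_eq zero_zhat.rep_eq residue_of_int int_pow_1)
  qed (use eG in auto)
  also have "\<dots> = (\<Otimes>i\<in>{..<r}. if i = j then e j m else \<one>) \<otimes> (\<Otimes>i\<in>{..<r}. if i = l then e l m [^] a else \<one>)"
    using eG by (intro finprod_multf) auto
  finally show ?thesis using eG assms by (simp add: finprod_single)
qed

end

text \<open>Gives the \<open>THE\<close> in \<open>adelic_rep\<close> its meaning: the matrix exists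
  because \<sigma> commutes with the transition maps and so preserves the Tate module, and it is
  unique by the basis property.\<close>

lemma adelic_rep_column:
  assumes "tate_basis A e (2 * g)" and \<sigma>: "gal_pt \<sigma> \<in> hom A A"
  shows "adelic_rep A g e \<sigma> \<in> carrier_mat (2 * g) (2 * g)"
    and "\<And>j. j < 2 * g \<Longrightarrow> gal_tate \<sigma> (e j) = lin_comb (tate_module A) (2 * g) (\<lambda>i. adelic_rep A g e \<sigma> $$ (i, j)) e"
    and "\<And>M. M \<in> carrier_mat (2 * g) (2 * g) \<Longrightarrow>
      (\<And>j. j < 2 * g \<Longrightarrow> gal_tate \<sigma> (e j) = lin_comb (tate_module A) (2 * g) (\<lambda>i. M $$ (i, j)) e) \<Longrightarrow>
      adelic_rep A g e \<sigma> = M"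
proof -
  interpret tate_basis A e "2 * g" by fact
  interpret s: group_hom A A "gal_pt \<sigma>" by unfold_locales (rule \<sigma>)
  have cl: "gal_tate \<sigma> t \<in> carrier (tate_module A)" if t: "t \<in> carrier (tate_module A)" for t
    unfolding tate_carrier
  proof (intro conjI allI impI)
    fix m :: nat assume m: "1 \<le> m"
    show "gal_tate \<sigma> t m \<in> carrier A" using m tate_mem[OF t] by (simp add: gal_tate_def)
    show "gal_tate \<sigma> t m [^]\<^bsub>A\<^esub> m = \<one>\<^bsub>A\<^esub>"
      using m tate_mem[OF t m] tate_torsion[OF t m] by (simp add: gal_tate_def s.hom_nat_pow[symmetric])
    fix k :: nat assume k: "1 \<le> k"
    have mk: "1 \<le> m * k" using m k by (simp add: Suc_le_eq)
    show "gal_tate \<sigma> t (m * k) [^]\<^bsub>A\<^esub> k = gal_tate \<sigma> t m"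
      using m mk tate_mem[OF t mk] tate_compat[OF t m k] by (simp add: gal_tate_def s.hom_nat_pow[symmetric] del: One_nat_def)
  qed (simp add: gal_tate_def)
  have "\<forall>j\<in>{..<2 * g}. \<exists>z. gal_tate \<sigma> (e j) = lin_comb (tate_module A) (2 * g) z e"
  proof
    fix j assume "j \<in> {..<2 * g}"
    then have "gal_tate \<sigma> (e j) \<in> carrier (tate_module A)" using cl basis_mem by simp
    then show "\<exists>z. gal_tate \<sigma> (e j) = lin_comb (tate_module A) (2 * g) z e"
      by (rule basis_repr) (rule exI)
  qed
  from bchoice[OF this] obtain z where
    z: "\<forall>j\<in>{..<2 * g}. gal_tate \<sigma> (e j) = lin_comb (tate_module A) (2 * g) (z j) e" ..
  let ?P = "\<lambda>M. M \<in> carrier_mat (2 * g) (2 * g) \<and>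
     (\<forall>j<2 * g. gal_tate \<sigma> (e j) = lin_comb (tate_module A) (2 * g) (\<lambda>i. M $$ (i, j)) e)"
  have ex: "?P (mat (2 * g) (2 * g) (\<lambda>(i, j). z j i))"
    using z by (auto intro!: lin_comb_cong)
  have uniq: "M = M'" if M: "?P M" and M': "?P M'" for M M'
  proof (rule eq_matI)
    fix i j assume "i < dim_row M'" "j < dim_col M'"
    then have ij: "i < 2 * g" "j < 2 * g" using M' by auto
    show "M $$ (i, j) = M' $$ (i, j)"
      using basis_unique[OF _ lin_comb_closed ij(1), of "\<lambda>i. M $$ (i, j)" "\<lambda>i. M' $$ (i, j)"] M M' ij(2) by auto
  qed (use M M' in auto)
  have eq: "adelic_rep A g e \<sigma> = M" if "?P M" for M
    unfolding adelic_rep_def using that uniq by (intro the_equality) blast+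
  then have "?P (adelic_rep A g e \<sigma>)" using ex by metis
  then show "adelic_rep A g e \<sigma> \<in> carrier_mat (2 * g) (2 * g)"
    "\<And>j. j < 2 * g \<Longrightarrow> gal_tate \<sigma> (e j) = lin_comb (tate_module A) (2 * g) (\<lambda>i. adelic_rep A g e \<sigma> $$ (i, j)) e"
    by blast+
  show "\<And>M. M \<in> carrier_mat (2 * g) (2 * g) \<Longrightarrow>
      (\<And>j. j < 2 * g \<Longrightarrow> gal_tate \<sigma> (e j) = lin_comb (tate_module A) (2 * g) (\<lambda>i. M $$ (i, j)) e) \<Longrightarrow>
      adelic_rep A g e \<sigma> = M"
    using eq by blast
qed

text \<open>Both families of matrices lie in Sp and turn sums into products, so finite index forces
  a member with positive parameter into the image; its columns are then read off at every level
  m.\<close>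

lemma big_image_transvections:
  assumes T: "tate_basis A e (2 * g)" and hom: "\<And>\<sigma>. \<sigma> \<in> Gal UNIV F \<Longrightarrow> gal_pt \<sigma> \<in> hom A A"
    and big: "has_big_image F A g e"
  shows "\<exists>\<sigma>\<in>Gal UNIV F. \<exists>n::nat. 0 < n \<and> (\<forall>m\<ge>1. \<forall>i<g. gal_pt \<sigma> (e i m) = e i m \<and>
      gal_pt \<sigma> (e (i + g) m) = e (i + g) m \<otimes>\<^bsub>A\<^esub> e i m [^]\<^bsub>A\<^esub> int n)" (is ?upper)
    and "\<exists>\<sigma>\<in>Gal UNIV F. \<exists>n::nat. 0 < n \<and> (\<forall>m\<ge>1. \<forall>i<g. gal_pt \<sigma> (e (i + g) m) = e (i + g) m \<and>
      gal_pt \<sigma> (e i m) = e i m \<otimes>\<^bsub>A\<^esub> e (i + g) m [^]\<^bsub>A\<^esub> int n)" (is ?lower)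
proof -
  interpret tate_basis A e "2 * g" by fact
  let ?H = "adelic_rep A g e ` Gal UNIV F \<inter> carrier (Sp g)"
  have id: "id \<in> Gal UNIV F" by (auto simp: Gal_def)
  have gid: "gal_pt id P = P" for P :: "('a, 'b) pt" by (auto simp: gal_pt_def)
  have "adelic_rep A g e id = 1\<^sub>m (2 * g)"
  proof (rule adelic_rep_column(3)[OF T hom[OF id]])
    fix j assume j: "j < 2 * g"
    show "gal_tate id (e j) = lin_comb (tate_module A) (2 * g) (\<lambda>i. 1\<^sub>m (2 * g) $$ (i, j)) e"
    proof (rule tate_eqI)
      fix m :: nat assume m: "1 \<le> m"
      have "lin_comb (tate_module A) (2 * g) (\<lambda>i. 1\<^sub>m (2 * g) $$ (i, j)) e =
        lin_comb (tate_module A) (2 * g) (\<lambda>i. if i = j then 1 else 0) e"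
        using j by (intro lin_comb_cong) auto
      then show "gal_tate id (e j) m = lin_comb (tate_module A) (2 * g) (\<lambda>i. 1\<^sub>m (2 * g) $$ (i, j)) e m"
        using lin_comb_unit[OF j m] m by (simp add: gal_tate_def gid)
    qed (auto simp: gal_tate_def lin_comb_eq[OF basis_sub])
  qed simp
  moreover have "1\<^sub>m (2 * g) \<in> carrier (Sp g :: zhat mat monoid)" using transvection_Sp(1)[of g 0] by (simp add: transvection_0)
  ultimately have 1: "1\<^sub>m (2 * g) \<in> ?H" using id by (metis IntI imageI)
  have fin: "finite (rcosets\<^bsub>Sp g\<^esub> ?H)" using big by (simp add: has_big_image_def)
  have col: "gal_pt \<sigma> (e j m) = lin_comb (tate_module A) (2 * g) z e m"
    if "\<sigma> \<in> Gal UNIV F" "j < 2 * g" "1 \<le> m" "\<And>i. i < 2 * g \<Longrightarrow> adelic_rep A g e \<sigma> $$ (i, j) = z i" for \<sigma> j m z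
  proof -
    have "gal_pt \<sigma> (e j m) = gal_tate \<sigma> (e j) m" using that(3) by (simp add: gal_tate_def)
    also have "\<dots> = lin_comb (tate_module A) (2 * g) (\<lambda>i. adelic_rep A g e \<sigma> $$ (i, j)) e m"
      using adelic_rep_column(2)[OF T hom[OF that(1)] that(2)] by simp
    finally show ?thesis using lin_comb_cong[of "\<lambda>i. adelic_rep A g e \<sigma> $$ (i, j)" z] that(4) by simp
  qed
  show ?upper
  proof -
    obtain n where n: "0 < n" "upper_transvection g (int n) \<in> ?H"
      using finite_index_power[OF transvection_0(1) transvection_add(1) transvection_Sp(1) _ 1 fin] by blast
    then obtain \<sigma> where \<sigma>: "\<sigma> \<in> Gal UNIV F" "adelic_rep A g e \<sigma> = upper_transvection g (int n)" by auto
    show ?thesis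
    proof (intro bexI[OF _ \<sigma>(1)] exI[of _ n] conjI allI impI n(1))
      fix m i :: nat assume m: "1 \<le> m" and i: "i < g"
      show "gal_pt \<sigma> (e i m) = e i m"
        using col[OF \<sigma>(1) _ m, of i "\<lambda>l. if l = i then 1 else 0"] lin_comb_unit[of i m] i m
        by (simp add: \<sigma>(2) transvection_entry)
      show "gal_pt \<sigma> (e (i + g) m) = e (i + g) m \<otimes>\<^bsub>A\<^esub> e i m [^]\<^bsub>A\<^esub> int n"
        using col[OF \<sigma>(1) _ m, of "i + g" "\<lambda>l. if l = i + g then 1 else if l = i then of_int (int n) else 0"]
          lin_comb_transvection[of "i + g" i m "int n"] i m
        by (simp add: \<sigma>(2) transvection_entry)
    qed
  qed
  show ?lower
  proof -
    obtain n where n: "0 < n" "lower_transvection g (int n) \<in> ?H"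
      using finite_index_power[OF transvection_0(2) transvection_add(2) transvection_Sp(2) _ 1 fin] by blast
    then obtain \<sigma> where \<sigma>: "\<sigma> \<in> Gal UNIV F" "adelic_rep A g e \<sigma> = lower_transvection g (int n)" by auto
    show ?thesis
    proof (intro bexI[OF _ \<sigma>(1)] exI[of _ n] conjI allI impI n(1))
      fix m i :: nat assume m: "1 \<le> m" and i: "i < g"
      show "gal_pt \<sigma> (e (i + g) m) = e (i + g) m"
        using col[OF \<sigma>(1) _ m, of "i + g" "\<lambda>l. if l = i + g then 1 else 0"] lin_comb_unit[of "i + g" m] i m
        by (simp add: \<sigma>(2) transvection_entry)
      show "gal_pt \<sigma> (e i m) = e i m \<otimes>\<^bsub>A\<^esub> e (i + g) m [^]\<^bsub>A\<^esub> int n"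
        using col[OF \<sigma>(1) _ m, of i "\<lambda>l. if l = i then 1 else if l = i + g then of_int (int n) else 0"]
          lin_comb_transvection[of i "i + g" m "int n"] i m
        by (simp add: \<sigma>(2) transvection_entry)
    qed
  qed
qed

section \<open>Galois action on rational points\<close>

text \<open>Subfields in terms of the type-class operations; as inverse 0 = 0, zero is no
  exception.\<close>

definition sfield :: "'a::field set \<Rightarrow> bool" where
  "sfield E \<longleftrightarrow> subr E \<and> (\<forall>x\<in>E. inverse x \<in> E)"

lemma sfield_divide: "sfield E \<Longrightarrow> x \<in> E \<Longrightarrow> y \<in> E \<Longrightarrow> x / y \<in> E"
  using subr_mult[of E x "inverse y"] by (simp add: sfield_def divide_inverse)

lemma sfield_UNIV: "sfield UNIV"
  by (simp add: sfield_def subr_def)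

lemma subfield_imp_sfield:
  fixes E :: "'a::field set"
  assumes "subfield E ring_of_type_algebra"
  shows "sfield E"
proof -
  interpret R: field "ring_of_type_algebra :: 'a ring" by (rule field_from_type_algebra)
  note sr = subringE[OF subfieldE(1)[OF assms]]
  have z: "\<zero>\<^bsub>ring_of_type_algebra\<^esub> = (0::'a)" "\<one>\<^bsub>ring_of_type_algebra\<^esub> = (1::'a)"
    "(\<otimes>\<^bsub>ring_of_type_algebra\<^esub>) = ((*) :: 'a \<Rightarrow> 'a \<Rightarrow> 'a)" "(\<oplus>\<^bsub>ring_of_type_algebra\<^esub>) = ((+) :: 'a \<Rightarrow> 'a \<Rightarrow> 'a)"
    "carrier (ring_of_type_algebra :: 'a ring) = UNIV"
    by (auto simp: ring_of_type_algebra_def)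
  have neg: "\<ominus>\<^bsub>ring_of_type_algebra\<^esub> x = - x" for x :: 'a
    using R.minus_equality[of "- x" x] by (simp add: z)
  have "subr E" unfolding subr_def using sr by (auto simp: z neg)
  moreover have "inverse x \<in> E" if "x \<in> E" for x
  proof (cases "x = 0")
    case False
    then have x: "x \<in> E - {\<zero>\<^bsub>ring_of_type_algebra\<^esub>}" using that by (simp add: z)
    have "x * inv\<^bsub>ring_of_type_algebra\<^esub> x = 1" using R.subfield_m_inv(2)[OF assms x] by (simp add: z)
    then have "inv\<^bsub>ring_of_type_algebra\<^esub> x = inverse x" by (metis inverse_unique)
    then show ?thesis using R.subfield_m_inv(1)[OF assms x] by simp
  qed (use that in simp)
  ultimately show ?thesis by (simp add: sfield_def)
qed

lemma hom_on_prod: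
  "subr R \<Longrightarrow> hom_on R \<phi> \<Longrightarrow> (\<And>i. i \<in> I \<Longrightarrow> f i \<in> R) \<Longrightarrow> \<phi> (prod f I) = (\<Prod>i\<in>I. \<phi> (f i))"
  by (induction I rule: infinite_finite_induct) (simp_all add: hom_on_1 hom_on_mult subr_prod)

lemma hom_on_poly_eval:
  assumes "subr R" "hom_on R \<phi>" "p \<in> polys_over R" "x \<in> R"
  shows "\<phi> (poly p x) = poly (map_poly \<phi> p) (\<phi> x)"
  using assms(3)
proof (induction p)
  case (pCons a p)
  then have "a \<in> R" "p \<in> polys_over R" by (auto simp: polys_over_pCons)
  then show ?case using pCons assms poly_in_subr[OF assms(1) _ assms(4), of p]
    by (simp add: map_poly_pCons hom_on_0 hom_on_add hom_on_mult subr_mult)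
qed (use assms in \<open>simp add: hom_on_0\<close>)

lemma mp_eval_closed:
  assumes "subr E" "F \<subseteq> E" "coeffs_in F f" "range v \<subseteq> E"
  shows "mp_eval f v \<in> E"
  unfolding mp_eval_def using assms by (intro subr_closed) (auto simp: coeffs_in_def)

lemma hom_mp_eval:
  assumes E: "subr E" and \<tau>: "hom_on E \<tau>" "\<And>x. x \<in> F \<Longrightarrow> \<tau> x = x" and F: "F \<subseteq> E"
    and f: "coeffs_in F f" and v: "range v \<subseteq> E"
  shows "\<tau> (mp_eval f v) = mp_eval f (\<lambda>i. \<tau> (v i))"
proof -
  have c: "Poly_Mapping.lookup f m \<in> F" for m using f by (simp add: coeffs_in_def)
  have vE: "v i \<in> E" for i using v by auto
  have m: "(\<Prod>i\<in>UNIV. v i ^ Poly_Mapping.lookup m i) \<in> E" for m using vE by (intro subr_closed E) auto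
  have "\<tau> (Poly_Mapping.lookup f m * (\<Prod>i\<in>UNIV. v i ^ Poly_Mapping.lookup m i)) =
      Poly_Mapping.lookup f m * (\<Prod>i\<in>UNIV. \<tau> (v i) ^ Poly_Mapping.lookup m i)" for m
    using hom_on_mult[OF \<tau>(1) _ m, of "Poly_Mapping.lookup f m" m] c[of m] F \<tau>(2)
      hom_on_prod[OF E \<tau>(1), of UNIV "\<lambda>i. v i ^ Poly_Mapping.lookup m i"] vE
    by (auto simp: subr_power[OF E] hom_on_power[OF E \<tau>(1)])
  moreover have "Poly_Mapping.lookup f m * (\<Prod>i\<in>UNIV. v i ^ Poly_Mapping.lookup m i) \<in> E" for m
    using subr_mult[OF E _ m] c F by blast
  ultimately show ?thesis unfolding mp_eval_def by (simp add: hom_on_sum[OF E \<tau>(1)])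
qed

lemma Gal_closed: "\<tau> \<in> Gal E F \<Longrightarrow> x \<in> E \<Longrightarrow> \<tau> x \<in> E"
  by (auto simp: Gal_def bij_betw_def)

lemma Gal_fixes: "\<tau> \<in> Gal E F \<Longrightarrow> x \<in> F \<Longrightarrow> \<tau> x = x"
  by (auto simp: Gal_def)

lemma Gal_hom_on: "\<tau> \<in> Gal E F \<Longrightarrow> 1 \<in> F \<Longrightarrow> hom_on E \<tau>"
  by (auto simp: Gal_def hom_on_def)

lemma Gal_nonzero:
  assumes "\<tau> \<in> Gal E F" "sfield F" "F \<subseteq> E" "x \<in> E" "x \<noteq> 0"
  shows "\<tau> x \<noteq> 0"
proof -
  have "0 \<in> F" using assms(2) subr_0 by (auto simp: sfield_def)
  then have "\<tau> 0 = 0" "0 \<in> E" using Gal_fixes[OF assms(1)] assms(3) by auto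
  then show ?thesis using assms unfolding Gal_def bij_betw_def inj_on_def by force
qed

text \<open>An element of \<open>Gal E F\<close> is meaningful only on E, so it is applied to one
  coordinate vector with entries in E; \<open>gal_pt\<close> would apply it to all multiples of that
  vector.\<close>

definition gal_on :: "'a set \<Rightarrow> ('a \<Rightarrow> 'a) \<Rightarrow> ('n, 'a::field) pt \<Rightarrow> ('n, 'a) pt" where
  "gal_on E \<tau> P = proj_pt (\<lambda>i. \<tau> ((SOME v. v \<in> P \<and> range v \<subseteq> E) i))"

locale galois_points = abelian_variety F A
  for F :: "'a::alg_closed_field set" and A :: "('n::finite, 'a) pt monoid" (structure) +
  fixes E :: "'a set"
  assumes sfE: "sfield E" and sfF: "sfield F" and FE: "F \<subseteq> E"
begin

abbreviation "AE \<equiv> rational_points E (carrier A)"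

lemma subrE: "subr E" and subrF: "subr F"
  using sfE sfF by (auto simp: sfield_def)

lemma Gal_hom: "\<tau> \<in> Gal E F \<Longrightarrow> hom_on E \<tau>"
  using Gal_hom_on subr_1[OF subrF] by blast

lemma AE_proj: "P \<in> AE \<Longrightarrow> P \<in> proj_space" "P \<in> AE \<Longrightarrow> P \<in> carrier A"
  using closed unfolding closed_over_def rational_points_def by blast+

lemma AE_normalized:
  assumes "P \<in> AE"
  obtains v j where "v \<in> P" "range v \<subseteq> E" "v j = 1"
proof -
  obtain v where v: "v \<in> P" "range v \<subseteq> E" using assms by (auto simp: rational_points_def)
  then obtain j where j: "v j \<noteq> 0" using proj_space_mem(2)[OF AE_proj(1)[OF assms] v(1)] by auto
  show ?thesis
  proof (rule that[of "\<lambda>i. 1 / v j * v i" j])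
    show "(\<lambda>i. 1 / v j * v i) \<in> P" by (rule proj_space_scale[OF AE_proj(1)[OF assms] v(1)]) (use j in simp)
    show "range (\<lambda>i. 1 / v j * v i) \<subseteq> E"
      using v(2) sfield_divide[OF sfE, of _ "v j"] by auto
  qed (use j in simp)
qed

text \<open>Two coordinate vectors over E of the same point differ by a scalar in E, and \<tau> is
  multiplicative on E.\<close>

lemma gal_on_eq:
  assumes "P \<in> proj_space" "v \<in> P" "range v \<subseteq> E" "\<tau> \<in> Gal E F"
  shows "gal_on E \<tau> P = proj_pt (\<lambda>i. \<tau> (v i))"
proof -
  define w where "w = (SOME v. v \<in> P \<and> range v \<subseteq> E)"
  have w: "w \<in> P \<and> range w \<subseteq> E" unfolding w_def by (rule someI[of _ v]) (use assms in blast)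
  obtain j where j: "v j \<noteq> 0" using proj_space_mem(2)[OF assms(1,2)] by auto
  obtain c where c: "c \<noteq> 0" "w = (\<lambda>i. c * v i)"
    using proj_space_mem(1)[OF assms(1,2)] w by (auto simp: proj_pt_def)
  have vE: "v i \<in> E" for i using assms(3) by auto
  have "c = w j / v j" using j c by simp
  moreover have "w j \<in> E" using w by auto
  ultimately have cE: "c \<in> E" using vE sfield_divide[OF sfE] by simp
  have "(\<lambda>i. \<tau> (w i)) = (\<lambda>i. \<tau> c * \<tau> (v i))"
    using hom_on_mult[OF Gal_hom[OF assms(4)] cE vE] c by simp
  moreover have "\<tau> c \<noteq> 0" by (rule Gal_nonzero[OF assms(4) sfF FE cE c(1)])
  ultimately show ?thesis unfolding gal_on_def w_def[symmetric] proj_pt_eq_iff[symmetric]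
    using proj_pt_eq_iff[of "\<lambda>i. \<tau> (v i)" "\<lambda>i. \<tau> (w i)"] by auto
qed

lemma gal_on_mem:
  assumes "P \<in> AE" "v \<in> P" "range v \<subseteq> E" "\<tau> \<in> Gal E F"
  shows "(\<lambda>i. \<tau> (v i)) \<in> gal_on E \<tau> P"
  using gal_on_eq[OF AE_proj(1)[OF assms(1)] assms(2-4)] proj_pt_self by simp

lemma gal_on_closed:
  assumes "P \<in> AE" "\<tau> \<in> Gal E F"
  shows "gal_on E \<tau> P \<in> AE"
proof -
  obtain v j where v: "v \<in> P" "range v \<subseteq> E" "v j = 1" using AE_normalized[OF assms(1)] .
  note eq = gal_on_eq[OF AE_proj(1)[OF assms(1)] v(1,2) assms(2)]
  have vE: "v i \<in> E" for i using v(2) by auto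
  have r: "range (\<lambda>i. \<tau> (v i)) \<subseteq> E" using Gal_closed[OF assms(2)] vE by auto
  have "\<tau> (v j) = 1" using v(3) hom_on_1[OF Gal_hom[OF assms(2)]] by simp
  then have nz: "(\<lambda>i. \<tau> (v i)) \<noteq> (\<lambda>_. 0)" by (auto simp: fun_eq_iff intro!: exI[of _ j])
  obtain S where S: "\<forall>f\<in>S. coeffs_in F f \<and> (\<exists>d. homogeneous d f)" "carrier A = {P \<in> proj_space. \<forall>f\<in>S. \<forall>v\<in>P. mp_eval f v = 0}"
    using closed unfolding closed_over_def by (elim exE conjE)
  have "proj_pt (\<lambda>i. \<tau> (v i)) \<in> carrier A"
  proof (subst S(2), intro CollectI conjI ballI)
    show P: "proj_pt (\<lambda>i. \<tau> (v i)) \<in> proj_space" unfolding proj_space_def using nz by blast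
    fix f u assume f: "f \<in> S" and u: "u \<in> proj_pt (\<lambda>i. \<tau> (v i))"
    obtain d where d: "homogeneous d f" "coeffs_in F f" using S(1) f by blast
    have "P \<in> {P \<in> proj_space. \<forall>f\<in>S. \<forall>v\<in>P. mp_eval f v = 0}" using AE_proj(2)[OF assms(1)] by (simp only: S(2))
    then have "mp_eval f v = 0" using v(1) f by blast
    then have "mp_eval f (\<lambda>i. \<tau> (v i)) = \<tau> 0"
      using hom_mp_eval[OF subrE Gal_hom[OF assms(2)] Gal_fixes[OF assms(2)] FE d(2) v(2)] by simp
    then have "mp_eval f (\<lambda>i. \<tau> (v i)) = 0" using hom_on_0[OF subrE Gal_hom[OF assms(2)]] by simp
    then show "mp_eval f u = 0" using homfun_vanish_iff(2)[OF P proj_pt_self homfunI[OF d(1)]] u by blast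
  qed
  then show ?thesis unfolding eq rational_points_def using proj_pt_self r by blast
qed

text \<open>The local formulas for the group law have coefficients in F, so they preserve E and
  commute with \<tau>.\<close>

lemma gal_on_mult:
  assumes P: "P \<in> AE" and Q: "Q \<in> AE"
  shows "P \<otimes> Q \<in> AE" and "\<tau> \<in> Gal E F \<Longrightarrow> gal_on E \<tau> (P \<otimes> Q) = gal_on E \<tau> P \<otimes> gal_on E \<tau> Q"
proof -
  note Pc = AE_proj(2)[OF P] and Qc = AE_proj(2)[OF Q]
  obtain v j where v: "v \<in> P" "range v \<subseteq> E" "v j = 1" using AE_normalized[OF P] .
  obtain w l where w: "w \<in> Q" "range w \<subseteq> E" "w l = 1" using AE_normalized[OF Q] .
  from mult_local[OF Pc Qc] obtain f :: "'n \<Rightarrow> ('n + 'n, 'a) mpoly" where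
    f1: "\<forall>v\<in>P. \<forall>w\<in>Q. (\<lambda>k. mp_eval (f k) (case_sum v w)) \<noteq> (\<lambda>_. 0)"
    and f2: "\<forall>P\<in>carrier A. \<forall>Q\<in>carrier A. \<forall>v\<in>P. \<forall>w\<in>Q. (\<lambda>k. mp_eval (f k) (case_sum v w)) \<noteq> (\<lambda>_. 0) \<longrightarrow>
      P \<otimes> Q = proj_pt (\<lambda>k. mp_eval (f k) (case_sum v w))"
    and f0: "\<forall>k. coeffs_in F (f k)"
    by (elim exE conjE) (rule that)
  let ?u = "\<lambda>k. mp_eval (f k) (case_sum v w)"
  have unz: "?u \<noteq> (\<lambda>_. 0)" using f1 v(1) w(1) by blast
  have PQ: "P \<otimes> Q = proj_pt ?u" using f2 Pc Qc v(1) w(1) unz by blast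
  have "v i \<in> E" "w i \<in> E" for i using v(2) w(2) by auto
  then have vw: "range (case_sum v w) \<subseteq> E" by (auto split: sum.splits)
  have uE: "range ?u \<subseteq> E" using mp_eval_closed[OF subrE FE _ vw] f0 by blast
  have "P \<otimes> Q \<in> carrier A" using Pc Qc by simp
  then show PQE: "P \<otimes> Q \<in> AE" unfolding rational_points_def using PQ uE proj_pt_self by blast
  assume \<tau>: "\<tau> \<in> Gal E F"
  let ?v = "\<lambda>i. \<tau> (v i)" and ?w = "\<lambda>i. \<tau> (w i)"
  have "(\<lambda>s. \<tau> (case_sum v w s)) = case_sum ?v ?w" by (auto simp: fun_eq_iff split: sum.splits)
  then have ev: "\<tau> (?u k) = mp_eval (f k) (case_sum ?v ?w)" for k
    using hom_mp_eval[OF subrE Gal_hom[OF \<tau>] Gal_fixes[OF \<tau>] FE _ vw] f0 by simp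
  obtain k where k: "?u k \<noteq> 0" using unz by auto
  then have "\<tau> (?u k) \<noteq> 0" using Gal_nonzero[OF \<tau> sfF FE] uE by blast
  then have nz: "(\<lambda>k. mp_eval (f k) (case_sum ?v ?w)) \<noteq> (\<lambda>_. 0)" unfolding ev by (metis (no_types, lifting))
  have "gal_on E \<tau> P \<otimes> gal_on E \<tau> Q = proj_pt (\<lambda>k. mp_eval (f k) (case_sum ?v ?w))"
    using f2 AE_proj(2)[OF gal_on_closed[OF P \<tau>]] AE_proj(2)[OF gal_on_closed[OF Q \<tau>]]
      gal_on_mem[OF P v(1,2) \<tau>] gal_on_mem[OF Q w(1,2) \<tau>] nz by blast
  also have "\<dots> = gal_on E \<tau> (P \<otimes> Q)"
  proof -
    have "?u \<in> P \<otimes> Q" unfolding PQ by (rule proj_pt_self)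
    then show ?thesis using gal_on_eq[OF AE_proj(1)[OF PQE] _ uE \<tau>] by (simp add: ev)
  qed
  finally show "gal_on E \<tau> (P \<otimes> Q) = gal_on E \<tau> P \<otimes> gal_on E \<tau> Q" by simp
qed

lemma one_AE: "\<one> \<in> AE"
  using one_rational FE unfolding rational_points_def by blast

lemma pow_AE: "P \<in> AE \<Longrightarrow> P [^] (m::nat) \<in> AE"
  by (induction m) (auto simp: one_AE gal_on_mult)

lemma gal_on_one: "\<tau> \<in> Gal E F \<Longrightarrow> gal_on E \<tau> \<one> = \<one>"
  using gal_on_mult(2)[OF one_AE one_AE] AE_proj(2)[OF gal_on_closed[OF one_AE]]
  by (metis l_one one_closed r_cancel_one')

lemma gal_on_pow: "\<tau> \<in> Gal E F \<Longrightarrow> P \<in> AE \<Longrightarrow> gal_on E \<tau> (P [^] (m::nat)) = gal_on E \<tau> P [^] m"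
  by (induction m) (auto simp: gal_on_one gal_on_mult(2) pow_AE)

lemma gal_on_compose:
  assumes "P \<in> AE" "\<sigma> \<in> Gal E F" "\<tau> \<in> Gal E F" "compose E \<sigma> \<tau> \<in> Gal E F"
  shows "gal_on E (compose E \<sigma> \<tau>) P = gal_on E \<sigma> (gal_on E \<tau> P)"
proof -
  obtain v j where v: "v \<in> P" "range v \<subseteq> E" "v j = 1" using AE_normalized[OF assms(1)] .
  have vE: "v i \<in> E" for i using v(2) by auto
  have r: "range (\<lambda>i. \<tau> (v i)) \<subseteq> E" using Gal_closed[OF assms(3)] vE by auto
  have "gal_on E \<sigma> (gal_on E \<tau> P) = proj_pt (\<lambda>i. \<sigma> (\<tau> (v i)))"
    using gal_on_eq[OF AE_proj(1)[OF gal_on_closed[OF assms(1,3)]] gal_on_mem[OF assms(1) v(1,2) assms(3)] r assms(2)] .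
  then show ?thesis using gal_on_eq[OF AE_proj(1)[OF assms(1)] v(1,2) assms(4)] vE by (simp add: compose_def)
qed

lemma gal_on_ident:
  assumes "P \<in> AE" "\<tau> \<in> Gal E F" "v \<in> P" "range v \<subseteq> E" "\<And>i. \<tau> (v i) = v i"
  shows "gal_on E \<tau> P = P"
  using gal_on_eq[OF AE_proj(1)[OF assms(1)] assms(3,4,2)] proj_space_mem(1)[OF AE_proj(1)[OF assms(1)] assms(3)] assms(5)
  by simp

text \<open>\<tau> can change a coordinate vector of a fixed point only by a scalar; an entry 1
  forces this scalar to be 1, so all entries are fixed and lie in F.\<close>

lemma gal_on_fixed_rational:
  assumes P: "P \<in> AE" and fixed: "\<And>\<tau>. \<tau> \<in> Gal E F \<Longrightarrow> gal_on E \<tau> P = P"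
    and EF: "{x \<in> E. \<forall>\<tau>\<in>Gal E F. \<tau> x = x} = F"
  shows "P \<in> rational_points F (carrier A)"
proof -
  obtain v j where v: "v \<in> P" "range v \<subseteq> E" "v j = 1" using AE_normalized[OF P] .
  have "v i \<in> F" for i
  proof -
    have "\<tau> (v i) = v i" if \<tau>: "\<tau> \<in> Gal E F" for \<tau>
    proof -
      have "(\<lambda>i. \<tau> (v i)) \<in> proj_pt v"
        using gal_on_mem[OF P v(1,2) \<tau>] fixed[OF \<tau>] proj_space_mem(1)[OF AE_proj(1)[OF P] v(1)] by simp
      then obtain c where c: "(\<lambda>i. \<tau> (v i)) = (\<lambda>i. c * v i)" by (auto simp: proj_pt_def)
      have "c = 1" using fun_cong[OF c, of j] v(3) hom_on_1[OF Gal_hom[OF \<tau>]] by simp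
      then show ?thesis using fun_cong[OF c, of i] by simp
    qed
    then have "v i \<in> {x \<in> E. \<forall>\<tau>\<in>Gal E F. \<tau> x = x}" using v(2) by blast
    then show ?thesis by (simp only: EF)
  qed
  then show ?thesis using v(1) AE_proj(2)[OF P] unfolding rational_points_def by blast
qed

end

section \<open>Actions of pro-p groups\<close>

text \<open>Every orbit has p-power length by the orbit-stabilizer theorem, and the orbits outside
  the fixed points are longer than 1.\<close>

lemma fixed_points_mod_p:
  assumes act: "group_action G W \<phi>" and G: "Coset.order G = p ^ k" and p: "prime p" and W: "finite W"
  shows "card {x \<in> W. \<forall>g\<in>carrier G. \<phi> g x = x} mod p = card W mod p"
proof -
  interpret group_action G W \<phi> by fact
  let ?Fix = "{x \<in> W. \<forall>g\<in>carrier G. \<phi> g x = x}"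
  let ?C = "{orbit G \<phi> x |x. x \<in> W - ?Fix}"
  have orb_sub: "orbit G \<phi> x \<subseteq> W - ?Fix" if x: "x \<in> W - ?Fix" for x
  proof
    fix z assume z: "z \<in> orbit G \<phi> x"
    have zW: "z \<in> W" using z x element_image by (auto simp: orbit_def)
    have "x \<in> orbit G \<phi> z" using orbit_sym[of x z] x z zW by blast
    then obtain g where g: "g \<in> carrier G" "x = \<phi> g z" by (auto simp: orbit_def)
    have "z \<notin> ?Fix"
    proof
      assume "z \<in> ?Fix"
      then have "x = z" using g by simp
      then show False using x \<open>z \<in> ?Fix\<close> by blast
    qed
    then show "z \<in> W - ?Fix" using zW by blast
  qed
  have U: "\<Union>?C = W - ?Fix"
    using orb_sub orbit_refl by blast
  have "p dvd card c" if c: "c \<in> ?C" for c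
  proof -
    obtain x where x: "x \<in> W" "x \<notin> ?Fix" "c = orbit G \<phi> x" using c by blast
    have "card c dvd p ^ k" using orbit_stabilizer_theorem[OF x(1)] x(3) G by (metis dvd_triv_left)
    then obtain i where i: "card c = p ^ i" using divides_primepow_nat[OF p] by blast
    have "i \<noteq> 0"
    proof
      assume "i = 0"
      then have "card c = 1" using i by simp
      then obtain z where "c = {z}" by (auto simp: card_1_singleton_iff)
      then have "c = {x}" using orbit_refl[OF x(1)] x(3) by simp
      then have "\<phi> g x = x" if "g \<in> carrier G" for g using that x(3) by (auto simp: orbit_def)
      then show False using x by blast
    qed
    then show ?thesis using i by simp
  qed
  moreover have "c1 \<inter> c2 = {}" if "c1 \<in> ?C" "c2 \<in> ?C" "c1 \<noteq> c2" for c1 c2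
  proof -
    have "c1 \<in> orbits G W \<phi>" "c2 \<in> orbits G W \<phi>" using that by (auto simp: orbits_def)
    then show ?thesis using disjoint_union that(3) by blast
  qed
  moreover have "finite (\<Union>?C)" unfolding U using W by simp
  ultimately have "p dvd card (W - ?Fix)" using dvd_partition[of ?C p] unfolding U by blast
  moreover have "card W = card (W - ?Fix) + card ?Fix"
    using W by (subst card_Un_disjoint[symmetric]) (auto intro: arg_cong[of _ _ card])
  ultimately show ?thesis by (auto elim!: dvdE)
qed

text \<open>The kernel is an open normal subgroup, so its index, which is the order of the image in
  \<open>BijGroup W\<close>, is a power of p. Passing to the image makes the results on finite
  groups available.\<close>

lemma pro_p_action_image:
  assumes pro: "pro_p_group p G T" and act: "group_action G W \<phi>" and op: "openin T {g \<in> carrier G. \<phi> g = \<phi> \<one>\<^bsub>G\<^esub>}"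
  obtains k where "group_action (BijGroup W \<lparr>carrier := \<phi> ` carrier G\<rparr>) W id"
    "Coset.order (BijGroup W \<lparr>carrier := \<phi> ` carrier G\<rparr>) = p ^ k"
proof -
  interpret a: group_action G W \<phi> by fact
  interpret h: group_hom G "BijGroup W" \<phi> by (rule a.group_hom)
  let ?H = "BijGroup W \<lparr>carrier := \<phi> ` carrier G\<rparr>"
  have sub: "subgroup (\<phi> ` carrier G) (BijGroup W)" by (rule h.img_is_subgroup)
  have H: "group ?H" using h.H.subgroup_imp_group[OF sub] .
  have "kernel G (BijGroup W) \<phi> = {g \<in> carrier G. \<phi> g = \<phi> \<one>\<^bsub>G\<^esub>}" by (simp add: kernel_def)
  then have "\<exists>k. card (rcosets\<^bsub>G\<^esub> (kernel G (BijGroup W) \<phi>)) = p ^ k"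
    using pro op h.normal_kernel unfolding pro_p_group_def by metis
  then obtain k where k: "card (rcosets\<^bsub>G\<^esub> (kernel G (BijGroup W) \<phi>)) = p ^ k" ..
  have "\<phi> \<in> hom G ?H" using h.homh by (auto simp: hom_def)
  then interpret h': group_hom G ?H \<phi>
    by (intro group_hom.intro[OF group_hom.axioms(1)[OF a.group_hom] H] group_hom_axioms.intro)
  have "kernel G ?H \<phi> = kernel G (BijGroup W) \<phi>" by (simp add: kernel_def)
  then have "(\<lambda>W. the_elem (\<phi> ` W)) \<in> iso (G Mod (kernel G (BijGroup W) \<phi>)) ?H"
    using h'.FactGroup_iso_set by simp
  then have "Coset.order (G Mod (kernel G (BijGroup W) \<phi>)) = Coset.order ?H"
    unfolding iso_def Coset.order_def using bij_betw_same_card by fastforce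
  then have "Coset.order ?H = p ^ k" using k by (simp add: Coset.order_def FactGroup_def)
  moreover have "id \<in> hom ?H (BijGroup W)"
    using subgroup.subset[OF sub] by (auto simp: hom_def)
  then have "group_action ?H W id"
    by (intro group_action.intro group_hom.intro[OF H group_BijGroup] group_hom_axioms.intro)
  ultimately show ?thesis using that by blast
qed

section \<open>Automorphisms of the big field and their restriction to a Galois extension\<close>

lemma Gal_compose:
  assumes "\<sigma> \<in> Gal E F" "\<tau> \<in> Gal E F" "F \<subseteq> E" "subr E"
  shows "compose E \<sigma> \<tau> \<in> Gal E F"
proof -
  have "bij_betw (compose E \<sigma> \<tau>) E E" using assms by (intro bij_betw_compose[of _ _ E]) (auto simp: Gal_def)
  moreover have "\<tau> x \<in> E" if "x \<in> E" for x using Gal_closed[OF assms(2) that] .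
  ultimately show ?thesis using assms by (auto simp: Gal_def compose_def subset_iff subr_add subr_mult)
qed

lemma Gal_id: "(\<lambda>x\<in>E. x) \<in> Gal E F" if "subr E" "F \<subseteq> E"
proof -
  have "bij_betw (\<lambda>x\<in>E. x) E E" by (auto simp: bij_betw_def inj_on_def)
  then show ?thesis using that by (auto simp: Gal_def subr_add subr_mult)
qed

text \<open>The minimal polynomial of \<open>x\<close> is the product over its Galois orbit.\<close>

lemma galois_extension_normal:
  assumes gal: "galois_extension E F" and \<sigma>: "\<sigma> \<in> Gal UNIV F" and x: "x \<in> E"
  shows "\<sigma> x \<in> E"
proof -
  have sE: "subr E" and sF: "subr F" "1 \<in> F" and FE: "F \<subseteq> E" and fixF: "{x \<in> E. \<forall>\<sigma>\<in>Gal E F. \<sigma> x = x} = F"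
    and alg: "\<exists>q. q \<noteq> 0 \<and> (\<forall>i. poly.coeff q i \<in> F) \<and> poly q x = 0"
    using gal x subfield_imp_sfield subr_1 unfolding galois_extension_def sfield_def by blast+
  have h\<sigma>: "hom_on UNIV \<sigma>" by (rule Gal_hom_on[OF \<sigma> sF(2)])
  obtain q where q: "q \<noteq> 0" "q \<in> polys_over F" "poly q x = 0" using alg by (auto simp: polys_over_def)
  have U: "subr (UNIV :: 'a set)" by (simp add: subr_def)
  have mapF: "map_poly \<tau> p = p" if "p \<in> polys_over F" "\<And>a. a \<in> F \<Longrightarrow> \<tau> a = a" for p and \<tau> :: "'a \<Rightarrow> 'a"
  proof (rule poly_eqI)
    fix n
    have "\<tau> 0 = 0" using that(2) subr_0[OF sF(1)] by blast
    then show "poly.coeff (map_poly \<tau> p) n = poly.coeff p n"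
      using that by (simp add: coeff_map_poly polys_over_def)
  qed
  define Orb where "Orb = (\<lambda>\<tau>. \<tau> x) ` Gal E F"
  have OE: "Orb \<subseteq> E" using Gal_closed x by (auto simp: Orb_def)
  have "Orb \<subseteq> {z. poly q z = 0}"
  proof
    fix z assume "z \<in> Orb"
    then obtain \<tau> where \<tau>: "\<tau> \<in> Gal E F" "z = \<tau> x" by (auto simp: Orb_def)
    have "q \<in> polys_over E" using q(2) FE by (auto simp: polys_over_def)
    from hom_on_poly_eval[OF sE Gal_hom_on[OF \<tau>(1) sF(2)] this x]
    have "poly (map_poly \<tau> q) z = \<tau> 0" using q \<tau> by simp
    then show "z \<in> {z. poly q z = 0}"
      using mapF[OF q(2) Gal_fixes[OF \<tau>(1)]] Gal_fixes[OF \<tau>(1) subr_0[OF sF(1)]] by simp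
  qed
  then have fin: "finite Orb" using poly_roots_finite[OF q(1)] finite_subset by blast
  define R where "R = (\<Prod>a\<in>Orb. [:- a, 1:])"
  have linE: "[:- a, 1:] \<in> polys_over E" if "a \<in> Orb" for a
    using that OE sE by (auto simp: polys_over_pCons subr_uminus subr_1) (simp add: polys_over_def subr_0)
  have RE: "R \<in> polys_over E" unfolding R_def by (intro subr_prod subr_polys_over sE linE)
  \<comment> \<open>\<tau> permutes the orbit, hence the factors of R; so the coefficients of R are
    fixed by the Galois group and lie in F.\<close>
  have "map_poly \<tau> R = R" if \<tau>: "\<tau> \<in> Gal E F" for \<tau>
  proof -
    note h = Gal_hom_on[OF \<tau> sF(2)]
    have "map_poly \<tau> (\<Prod>a\<in>I. [:- a, 1:]) = (\<Prod>a\<in>I. [:- \<tau> a, 1:])" if "I \<subseteq> Orb" for I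
      using finite_subset[OF that fin] that
    proof (induction I rule: finite_induct)
      case empty
      then show ?case using mapF[of 1 \<tau>] Gal_fixes[OF \<tau>] subr_1[OF subr_polys_over[OF sF(1)]] by simp
    next
      case (insert a I)
      have "(\<Prod>a\<in>I. [:- a, 1:]) \<in> polys_over E" using insert.prems by (intro subr_prod subr_polys_over sE linE) auto
      moreover have "map_poly \<tau> [:- a, 1:] = [:- \<tau> a, 1:]"
        using hom_on_uminus[OF sE h, of a] hom_on_0[OF sE h] hom_on_1[OF h] insert.prems OE
        by (simp add: map_poly_pCons subset_iff)
      ultimately show ?case using insert map_poly_hom_mult[OF sE h linE[of a]] by simp
    qed
    then have "map_poly \<tau> R = (\<Prod>a\<in>Orb. [:- \<tau> a, 1:])" by (simp add: R_def)
    also have "\<dots> = (\<Prod>a\<in>\<tau> ` Orb. [:- a, 1:])"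
    proof (rule prod.reindex_cong[symmetric])
      show "inj_on \<tau> Orb" using \<tau> OE by (auto simp: Gal_def bij_betw_def intro: inj_on_subset)
    qed auto
    also have "\<tau> ` Orb = Orb"
    proof (rule endo_inj_surj[OF fin])
      show "\<tau> ` Orb \<subseteq> Orb"
      proof
        fix z assume "z \<in> \<tau> ` Orb"
        then obtain \<rho> where \<rho>: "\<rho> \<in> Gal E F" "z = \<tau> (\<rho> x)" by (auto simp: Orb_def)
        then have "z = compose E \<tau> \<rho> x" using x by (simp add: compose_def)
        then show "z \<in> Orb" using Gal_compose[OF \<tau> \<rho>(1) FE sE] by (auto simp: Orb_def)
      qed
      show "inj_on \<tau> Orb" using \<tau> OE by (auto simp: Gal_def bij_betw_def intro: inj_on_subset)
    qed
    finally show ?thesis by (simp add: R_def)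
  qed
  then have "\<tau> (poly.coeff R n) = poly.coeff R n" if "\<tau> \<in> Gal E F" for \<tau> n
    using that coeff_map_poly[of \<tau> R n] hom_on_0[OF sE Gal_hom_on[OF that sF(2)]] by simp
  moreover have "poly.coeff R n \<in> E" for n using RE by (simp add: polys_over_def)
  ultimately have "poly.coeff R n \<in> {x \<in> E. \<forall>\<sigma>\<in>Gal E F. \<sigma> x = x}" for n by blast
  then have RF: "R \<in> polys_over F" unfolding fixF by (simp add: polys_over_def)
  have "x \<in> Orb" unfolding Orb_def by (rule image_eqI[OF _ Gal_id[OF sE FE]]) (use x in simp)
  then have "poly R x = 0" using fin by (auto simp: R_def poly_prod)
  moreover have "R \<in> polys_over UNIV" by (simp add: polys_over_def)
  \<comment> \<open>\<sigma> fixes the coefficients of R, so \<sigma> x is again a root of R, and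
    all roots of R lie in E.\<close>
  ultimately have "poly (map_poly \<sigma> R) (\<sigma> x) = \<sigma> 0"
    using hom_on_poly_eval[OF U h\<sigma>] by (metis UNIV_I)
  then have "poly R (\<sigma> x) = 0" using mapF[OF RF Gal_fixes[OF \<sigma>]] hom_on_0[OF U h\<sigma>] by simp
  then have "\<sigma> x \<in> Orb" using fin by (auto simp: R_def poly_prod)
  then show ?thesis using OE by blast
qed

lemma Gal_inv_UNIV:
  assumes "\<sigma> \<in> Gal UNIV F"
  shows "inv_into UNIV \<sigma> \<in> Gal UNIV F"
proof -
  have b: "bij \<sigma>" using assms by (auto simp: Gal_def)
  have i: "inv_into UNIV \<sigma> (\<sigma> x) = x" "\<sigma> (inv_into UNIV \<sigma> x) = x" for x
    using b by (simp_all add: bij_is_inj bij_is_surj surj_f_inv_f)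
  have "inv_into UNIV \<sigma> (x + y) = inv_into UNIV \<sigma> x + inv_into UNIV \<sigma> y" "inv_into UNIV \<sigma> (x * y) = inv_into UNIV \<sigma> x * inv_into UNIV \<sigma> y" for x y
  proof -
    have "\<sigma> (inv_into UNIV \<sigma> x + inv_into UNIV \<sigma> y) = x + y" "\<sigma> (inv_into UNIV \<sigma> x * inv_into UNIV \<sigma> y) = x * y"
      using assms i by (auto simp: Gal_def)
    then show "inv_into UNIV \<sigma> (x + y) = inv_into UNIV \<sigma> x + inv_into UNIV \<sigma> y" "inv_into UNIV \<sigma> (x * y) = inv_into UNIV \<sigma> x * inv_into UNIV \<sigma> y" using i by metis+
  qed
  moreover have "inv_into UNIV \<sigma> x = x" if "x \<in> F" for x using i(1)[of x] Gal_fixes[OF assms that] by simp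
  ultimately show ?thesis using b by (auto simp: Gal_def bij_imp_bij_inv)
qed

text \<open>Normality for \<sigma> gives one inclusion between E and its image, normality for the
  inverse of \<sigma> the other.\<close>

lemma Gal_restrict:
  assumes gal: "galois_extension E F" and \<sigma>: "\<sigma> \<in> Gal UNIV F"
  shows "restrict \<sigma> E \<in> Gal E F"
proof -
  have FE: "F \<subseteq> E" and sE: "subr E" using gal subfield_imp_sfield unfolding galois_extension_def sfield_def by blast+
  have b: "bij \<sigma>" using \<sigma> by (auto simp: Gal_def)
  have "\<sigma> ` E = E"
  proof
    show "\<sigma> ` E \<subseteq> E" using galois_extension_normal[OF gal \<sigma>] by blast
    show "E \<subseteq> \<sigma> ` E"
    proof
      fix x assume "x \<in> E"
      then have "inv_into UNIV \<sigma> x \<in> E" using galois_extension_normal[OF gal Gal_inv_UNIV[OF \<sigma>]] by blast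
      moreover have "x = \<sigma> (inv_into UNIV \<sigma> x)" using b by (simp add: bij_is_surj surj_f_inv_f)
      ultimately show "x \<in> \<sigma> ` E" by blast
    qed
  qed
  moreover have "inj_on \<sigma> E" using b by (auto simp: bij_def intro: inj_on_subset)
  ultimately have "bij_betw (restrict \<sigma> E) E E" by (simp add: bij_betw_def inj_on_restrict_eq)
  then show ?thesis using \<sigma> FE sE by (auto simp: Gal_def subr_add subr_mult)
qed

lemma mult_BijGroup: "f \<in> Bij W \<Longrightarrow> g \<in> Bij W \<Longrightarrow> f \<otimes>\<^bsub>BijGroup W\<^esub> g = compose W f g"
  by (simp add: BijGroup_def)

section \<open>Galois action on finite sets of points\<close>

context galois_points
begin

lemma gal_pt_eq:
  assumes \<sigma>: "\<sigma> \<in> Gal UNIV F" and P: "P \<in> proj_space" "v \<in> P"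
  shows "gal_pt \<sigma> P = proj_pt (\<lambda>i. \<sigma> (v i))"
proof -
  have s: "surj \<sigma>" and m: "\<sigma> (x * y) = \<sigma> x * \<sigma> y" for x y
    using \<sigma> by (auto simp: Gal_def bij_betw_def)
  have nz: "\<sigma> c \<noteq> 0" if "c \<noteq> 0" for c using Gal_nonzero[OF \<sigma> sfF _ _ that] by simp
  have "\<sigma> 0 = 0" using m[of 0 0] Gal_fixes[OF \<sigma> subr_0[OF subrF]] by simp
  then have cover: "\<exists>d. d \<noteq> 0 \<and> \<sigma> d = c" if "c \<noteq> 0" for c using s that by (metis surj_def)
  have "gal_pt \<sigma> (proj_pt v) = proj_pt (\<lambda>i. \<sigma> (v i))"
  proof
    show "gal_pt \<sigma> (proj_pt v) \<subseteq> proj_pt (\<lambda>i. \<sigma> (v i))"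
    proof
      fix u assume "u \<in> gal_pt \<sigma> (proj_pt v)"
      then obtain w where w: "u = (\<lambda>i. \<sigma> (w i))" "w \<in> proj_pt v" unfolding gal_pt_def by (rule imageE)
      obtain c where c: "w = (\<lambda>i. c * v i)" "c \<noteq> 0" using w(2) unfolding proj_pt_def by blast
      have "u = (\<lambda>i. \<sigma> c * \<sigma> (v i))" using w(1) c(1) by (simp add: m)
      then show "u \<in> proj_pt (\<lambda>i. \<sigma> (v i))" unfolding proj_pt_def using nz[OF c(2)] by blast
    qed
    show "proj_pt (\<lambda>i. \<sigma> (v i)) \<subseteq> gal_pt \<sigma> (proj_pt v)"
    proof
      fix u assume "u \<in> proj_pt (\<lambda>i. \<sigma> (v i))"
      then obtain c where c: "c \<noteq> 0" "u = (\<lambda>i. c * \<sigma> (v i))" by (auto simp: proj_pt_def)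
      obtain d where d: "d \<noteq> 0" "\<sigma> d = c" using cover[OF c(1)] by blast
      have "u = (\<lambda>w i. \<sigma> (w i)) (\<lambda>i. d * v i)" using c d by (simp add: m)
      moreover have "(\<lambda>i. d * v i) \<in> proj_pt v" using d by (auto simp: proj_pt_def)
      ultimately show "u \<in> gal_pt \<sigma> (proj_pt v)" unfolding gal_pt_def by (rule image_eqI)
    qed
  qed
  then show ?thesis using proj_space_mem(1)[OF P] by simp
qed

text \<open>For E = \<open>UNIV\<close> the action \<open>gal_on\<close> is \<open>gal_pt\<close>,
  so compatibility with the group law carries over.\<close>

lemma gal_pt_hom:
  assumes \<sigma>: "\<sigma> \<in> Gal UNIV F"
  shows "gal_pt \<sigma> \<in> hom A A"
proof -
  interpret U: galois_points F A UNIV by unfold_locales (auto simp: sfield_UNIV sfF)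
  have all: "rational_points UNIV (carrier A) = carrier A"
    using closed proj_space_nonempty unfolding closed_over_def by (auto simp: rational_points_def)
  have eq: "gal_pt \<sigma> P = gal_on UNIV \<sigma> P" if "P \<in> carrier A" for P
  proof -
    have P: "P \<in> rational_points UNIV (carrier A)" using all that by simp
    obtain v j where "v \<in> P" "range v \<subseteq> UNIV" "v j = 1" using U.AE_normalized[OF P] .
    then show ?thesis using gal_pt_eq[OF \<sigma> U.AE_proj(1)[OF P]] U.gal_on_eq[OF U.AE_proj(1)[OF P] _ _ \<sigma>] by simp
  qed
  show ?thesis
    using U.gal_on_closed[OF _ \<sigma>] U.gal_on_mult(2)[OF _ _ \<sigma>] by (auto simp: hom_def eq all)
qed

lemma gal_pt_restrict:
  assumes \<sigma>: "\<sigma> \<in> Gal UNIV F" and r: "restrict \<sigma> E \<in> Gal E F" and P: "P \<in> AE"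
  shows "gal_pt \<sigma> P = gal_on E (restrict \<sigma> E) P"
proof -
  obtain v j where v: "v \<in> P" "range v \<subseteq> E" "v j = 1" using AE_normalized[OF P] .
  have "v i \<in> E" for i using v(2) by auto
  then show ?thesis
    using gal_pt_eq[OF \<sigma> AE_proj(1)[OF P] v(1)] gal_on_eq[OF AE_proj(1)[OF P] v(1,2) r] by simp
qed

lemma gal_action:
  assumes G: "Group.group (gal_group E F)" and W: "finite W" "W \<subseteq> AE"
    and stable: "\<And>\<tau> P. \<tau> \<in> Gal E F \<Longrightarrow> P \<in> W \<Longrightarrow> gal_on E \<tau> P \<in> W"
  shows "group_action (gal_group E F) W (\<lambda>\<tau>. \<lambda>P\<in>W. gal_on E \<tau> P)"
    and "openin (krull_topology E F) {\<tau> \<in> carrier (gal_group E F).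
      (\<lambda>P\<in>W. gal_on E \<tau> P) = (\<lambda>P\<in>W. gal_on E \<one>\<^bsub>gal_group E F\<^esub> P)}"
proof -
  let ?\<phi> = "\<lambda>\<tau>. \<lambda>P\<in>W. gal_on E \<tau> P"
  interpret G: Group.group "gal_group E F" by fact
  have c: "carrier (gal_group E F) = Gal E F" "\<sigma> \<otimes>\<^bsub>gal_group E F\<^esub> \<tau> = compose E \<sigma> \<tau>"
    "\<one>\<^bsub>gal_group E F\<^esub> = (\<lambda>x\<in>E. x)" for \<sigma> \<tau> by (auto simp: gal_group_def)
  have one: "gal_on E (\<lambda>x\<in>E. x) P = P" if P: "P \<in> AE" for P
  proof -
    obtain v j where v: "v \<in> P" "range v \<subseteq> E" "v j = 1" using AE_normalized[OF P] .
    have "v i \<in> E" for i using v(2) by auto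
    then show ?thesis using gal_on_ident[OF P Gal_id[OF subrE FE] v(1,2)] by simp
  qed
  have comp: "gal_on E (compose E \<sigma> \<tau>) P = gal_on E \<sigma> (gal_on E \<tau> P)"
    if "\<sigma> \<in> Gal E F" "\<tau> \<in> Gal E F" "P \<in> W" for \<sigma> \<tau> P
    using gal_on_compose[OF _ that(1,2) Gal_compose[OF that(1,2) FE subrE]] that(3) W(2) by blast
  have bij: "?\<phi> \<tau> \<in> Bij W" if \<tau>: "\<tau> \<in> Gal E F" for \<tau>
  proof -
    have \<tau>': "inv\<^bsub>gal_group E F\<^esub> \<tau> \<in> Gal E F" "compose E (inv\<^bsub>gal_group E F\<^esub> \<tau>) \<tau> = (\<lambda>x\<in>E. x)"
      using G.inv_closed[of \<tau>] G.l_inv[of \<tau>] \<tau> by (simp_all add: c)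
    have "gal_on E (inv\<^bsub>gal_group E F\<^esub> \<tau>) (gal_on E \<tau> P) = P" if "P \<in> W" for P
      using comp[OF \<tau>'(1) \<tau> that] one[of P] W(2) that by (auto simp: \<tau>'(2))
    then have inj: "inj_on (gal_on E \<tau>) W" by (rule inj_on_inverseI)
    have "gal_on E \<tau> ` W = W" using endo_inj_surj[OF W(1) _ inj] stable[OF \<tau>] by blast
    then show ?thesis using inj by (auto simp: Bij_def bij_betw_def inj_on_restrict_eq)
  qed
  have "?\<phi> \<in> hom (gal_group E F) (BijGroup W)"
  proof (rule homI)
    fix \<tau> assume "\<tau> \<in> carrier (gal_group E F)"
    then show "?\<phi> \<tau> \<in> carrier (BijGroup W)" using bij by (simp add: c BijGroup_def)
  next
    fix \<sigma> \<tau> assume "\<sigma> \<in> carrier (gal_group E F)" "\<tau> \<in> carrier (gal_group E F)"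
    then have st: "\<sigma> \<in> Gal E F" "\<tau> \<in> Gal E F" by (simp_all add: c)
    have "?\<phi> (compose E \<sigma> \<tau>) = compose W (?\<phi> \<sigma>) (?\<phi> \<tau>)"
      using comp[OF st] stable[OF st(2)] by (auto simp: compose_def intro!: restrict_ext)
    then show "?\<phi> (\<sigma> \<otimes>\<^bsub>gal_group E F\<^esub> \<tau>) = ?\<phi> \<sigma> \<otimes>\<^bsub>BijGroup W\<^esub> ?\<phi> \<tau>"
      using bij[OF st(1)] bij[OF st(2)] by (simp add: c BijGroup_def)
  qed
  then show "group_action (gal_group E F) W ?\<phi>"
    by (intro group_action.intro group_hom.intro[OF G group_BijGroup] group_hom_axioms.intro)
  let ?N = "{\<tau> \<in> carrier (gal_group E F). ?\<phi> \<tau> = ?\<phi> \<one>\<^bsub>gal_group E F\<^esub>}"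
  have "\<forall>P\<in>W. \<exists>v. v \<in> P \<and> range v \<subseteq> E" using W(2) by (auto simp: rational_points_def)
  from bchoice[OF this] obtain w where w: "\<forall>P\<in>W. w P \<in> P \<and> range (w P) \<subseteq> E" ..
  \<comment> \<open>An automorphism acts on W through its values on these finitely many coordinates,
    and prescribing finitely many values is an open condition in the Krull topology.\<close>
  define S where "S = (\<Union>P\<in>W. range (w P))"
  have S: "finite S" "S \<subseteq> E" using W(1) w by (auto simp: S_def)
  show "openin (krull_topology E F) ?N"
  proof (subst openin_subopen, intro ballI)
    fix \<tau> assume \<tau>: "\<tau> \<in> ?N"
    let ?B = "PiE E (\<lambda>s. if s \<in> S then {\<tau> s} else E)"
    have \<tau>G: "\<tau> \<in> Gal E F" using \<tau> by (simp add: c)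
    have "openin (product_topology (\<lambda>_. discrete_topology E) E) ?B"
      unfolding openin_PiE_gen
    proof (intro disjI2 conjI ballI)
      have "{i \<in> E. (if i \<in> S then {\<tau> i} else E) \<noteq> topspace (discrete_topology E)} \<subseteq> S" by auto
      then show "finite {i \<in> E. (if i \<in> S then {\<tau> i} else E) \<noteq> topspace (discrete_topology E)}"
        using S(1) finite_subset by blast
    qed (use Gal_closed[OF \<tau>G] in auto)
    then have "openin (krull_topology E F) (?B \<inter> Gal E F)"
      unfolding krull_topology_def openin_subtopology by blast
    moreover have "\<tau> \<in> ?B \<inter> Gal E F"
      using \<tau>G Gal_closed[OF \<tau>G] by (auto simp: Gal_def PiE_def)
    moreover have "?B \<inter> Gal E F \<subseteq> ?N"
    proof
      fix \<sigma> assume "\<sigma> \<in> ?B \<inter> Gal E F"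
      then have \<sigma>: "\<sigma> \<in> Gal E F" "\<And>s. s \<in> S \<Longrightarrow> \<sigma> s = \<tau> s" using S(2) by (auto simp: PiE_def Pi_def)
      have "gal_on E \<sigma> P = gal_on E \<tau> P" if P: "P \<in> W" for P
      proof -
        have "w P i \<in> S" for i using P by (auto simp: S_def)
        then have v: "P \<in> AE" "w P \<in> P" "range (w P) \<subseteq> E" "\<And>i. \<sigma> (w P i) = \<tau> (w P i)"
          using w P W(2) \<sigma>(2) by blast+
        then show ?thesis using gal_on_eq[OF AE_proj(1)[OF v(1)] v(2,3)] \<sigma>(1) \<tau>G by simp
      qed
      then have "?\<phi> \<sigma> = ?\<phi> \<tau>" by (intro restrict_ext)
      then show "\<sigma> \<in> ?N" using \<tau> \<sigma>(1) by (simp add: c)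
    qed
    ultimately show "\<exists>T. openin (krull_topology E F) T \<and> \<tau> \<in> T \<and> T \<subseteq> ?N" by blast
  qed
qed

lemma pro_p_action:
  assumes pro: "pro_p_group p (gal_group E F) (krull_topology E F)" and p: "prime p"
    and W: "finite W" "W \<subseteq> AE" and stable: "\<And>\<tau> P. \<tau> \<in> Gal E F \<Longrightarrow> P \<in> W \<Longrightarrow> gal_on E \<tau> P \<in> W"
  shows "\<exists>k. \<forall>\<tau>\<in>Gal E F. \<forall>P\<in>W. (gal_on E \<tau> ^^ (p ^ k)) P = P"
    and "card {P \<in> W. \<forall>\<tau>\<in>Gal E F. gal_on E \<tau> P = P} mod p = card W mod p"
proof -
  let ?\<phi> = "\<lambda>\<tau>. \<lambda>P\<in>W. gal_on E \<tau> P"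
  have G: "Group.group (gal_group E F)" using pro by (simp add: pro_p_group_def profinite_group_def)
  have c: "carrier (gal_group E F) = Gal E F" by (simp add: gal_group_def)
  let ?H = "BijGroup W \<lparr>carrier := ?\<phi> ` Gal E F\<rparr>"
  obtain k where k: "group_action ?H W id" "Coset.order ?H = p ^ k"
    using pro_p_action_image[OF pro gal_action[OF G W stable]] unfolding c by blast
  have "card {x \<in> W. \<forall>g\<in>carrier ?H. id g x = x} mod p = card W mod p"
    by (rule fixed_points_mod_p[OF k p W(1)])
  moreover have "{x \<in> W. \<forall>g\<in>carrier ?H. id g x = x} = {P \<in> W. \<forall>\<tau>\<in>Gal E F. gal_on E \<tau> P = P}" by auto
  ultimately show "card {P \<in> W. \<forall>\<tau>\<in>Gal E F. gal_on E \<tau> P = P} mod p = card W mod p" by simp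
  have Hg: "Group.group ?H" using group_hom.axioms(1)[OF group_action.group_hom[OF k(1)]] .
  interpret H: Group.group ?H by (rule Hg)
  have sub: "?\<phi> ` Gal E F \<subseteq> Bij W"
    using group_hom.homh[OF group_action.group_hom[OF gal_action(1)[OF G W stable]]]
    by (auto simp: hom_def c BijGroup_def)
  have "(gal_on E \<tau> ^^ (p ^ k)) P = P" if \<tau>: "\<tau> \<in> Gal E F" and P: "P \<in> W" for \<tau> P
  proof -
    have \<phi>: "?\<phi> \<tau> \<in> carrier ?H" using \<tau> by simp
    \<comment> \<open>Powers in the group \<open>?H\<close> are iterates on W; its order p^k is an
      exponent that serves all \<tau> and all points of W.\<close>
    have "(?\<phi> \<tau> [^]\<^bsub>?H\<^esub> n) Q = (gal_on E \<tau> ^^ n) Q" if "Q \<in> W" for n Q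
      using that
    proof (induction n arbitrary: Q)
      case 0
      then show ?case by (simp add: BijGroup_def)
    next
      case (Suc n)
      have "?\<phi> \<tau> [^]\<^bsub>?H\<^esub> n \<in> Bij W" "?\<phi> \<tau> \<in> Bij W" using H.nat_pow_closed[OF \<phi>, of n] \<phi> sub by auto
      then have "(?\<phi> \<tau> [^]\<^bsub>?H\<^esub> n) \<otimes>\<^bsub>BijGroup W\<^esub> ?\<phi> \<tau> = compose W (?\<phi> \<tau> [^]\<^bsub>?H\<^esub> n) (?\<phi> \<tau>)"
        by (rule mult_BijGroup)
      then have "?\<phi> \<tau> [^]\<^bsub>?H\<^esub> Suc n = compose W (?\<phi> \<tau> [^]\<^bsub>?H\<^esub> n) (?\<phi> \<tau>)" by simp
      then have "(?\<phi> \<tau> [^]\<^bsub>?H\<^esub> Suc n) Q = (?\<phi> \<tau> [^]\<^bsub>?H\<^esub> n) (gal_on E \<tau> Q)"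
        using Suc.prems by (simp only: compose_def restrict_apply if_True)
      also have "\<dots> = (gal_on E \<tau> ^^ n) (gal_on E \<tau> Q)" by (rule Suc.IH[OF stable[OF \<tau> Suc.prems]])
      finally show ?case by (simp only: funpow_Suc_right o_apply)
    qed
    moreover have "?\<phi> \<tau> [^]\<^bsub>?H\<^esub> (p ^ k) = \<one>\<^bsub>?H\<^esub>"
      using H.pow_order_eq_1[OF \<phi>] k(2) by simp
    moreover have "\<one>\<^bsub>?H\<^esub> P = P" using P by (simp add: BijGroup_def)
    ultimately show ?thesis using P by metis
  qed
  then show "\<exists>k. \<forall>\<tau>\<in>Gal E F. \<forall>P\<in>W. (gal_on E \<tau> ^^ (p ^ k)) P = P" by blast
qed

end

section \<open>Finiteness of torsion\<close>

context galois_points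
begin

lemma pow_torsion_AE:
  "P \<in> rational_points E (torsion_of m A) \<longleftrightarrow> P \<in> AE \<and> P [^] m = \<one>"
  by (auto simp: rational_points_def torsion_of_def)

lemma gal_on_torsion:
  assumes "\<tau> \<in> Gal E F" "P \<in> rational_points E (torsion_of m A)"
  shows "gal_on E \<tau> P \<in> rational_points E (torsion_of m A)"
  using assms gal_on_closed[OF _ assms(1)] gal_on_pow[OF assms(1), of P m] gal_on_one[OF assms(1)]
  by (auto simp: pow_torsion_AE)

text \<open>A \<open>p\<close>-group acting on a nontrivial finite \<open>p\<close>-group has a nontrivial fixed point.\<close>

lemma p_torsion_trivial:
  assumes gal: "galois_extension E F" and pro: "pro_p_group p (gal_group E F) (krull_topology E F)"
    and p: "prime p" and fin: "finite (torsion_of p A)" and F: "rational_points F (torsion_of p A) = {\<one>}"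
  shows "rational_points E (torsion_of p A) = {\<one>}"
proof -
  let ?W = "rational_points E (torsion_of p A)"
  have fixF: "{x \<in> E. \<forall>\<sigma>\<in>Gal E F. \<sigma> x = x} = F" using gal by (simp add: galois_extension_def)
  have W: "finite ?W" "?W \<subseteq> AE"
    using fin finite_subset[of ?W "torsion_of p A"] by (auto simp: rational_points_def torsion_of_def)
  have oneW: "\<one> \<in> ?W" by (simp add: pow_torsion_AE one_AE)
  have "{P \<in> ?W. \<forall>\<tau>\<in>Gal E F. gal_on E \<tau> P = P} = {\<one>}"
  proof (intro antisym subsetI)
    fix P assume "P \<in> {P \<in> ?W. \<forall>\<tau>\<in>Gal E F. gal_on E \<tau> P = P}"
    then have P: "P \<in> ?W" "\<And>\<tau>. \<tau> \<in> Gal E F \<Longrightarrow> gal_on E \<tau> P = P" by auto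
    have "P \<in> rational_points F (carrier A)"
      using P(1) by (intro gal_on_fixed_rational[OF _ P(2) fixF]) (simp_all add: pow_torsion_AE)
    then have "P \<in> rational_points F (torsion_of p A)"
      using P(1) by (auto simp: rational_points_def)
    then show "P \<in> {\<one>}" by (simp only: F)
  qed (use oneW gal_on_one in auto)
  then have "card ?W mod p = 1 mod p"
    using pro_p_action(2)[OF pro p W gal_on_torsion] by simp
  \<comment> \<open>By Lagrange the exponent |W| kills every P in W; as |W| is 1 modulo p and P is
    killed by p, the corresponding power of P is P itself.\<close>
  then have cW: "card ?W = p * (card ?W div p) + 1"
    using prime_gt_1_nat[OF p] by (metis mod_less mult_div_mod_eq)
  have sub: "subgroup ?W A"
  proof (rule subgroupI)
    show "?W \<subseteq> carrier A" by (auto simp: rational_points_def torsion_of_def)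
    show "?W \<noteq> {}" using oneW by blast
  next
    fix P assume P: "P \<in> ?W"
    then have Pc: "P \<in> carrier A" "P \<in> AE" "P [^] p = \<one>" using AE_proj(2) by (auto simp: pow_torsion_AE)
    have "P [^] (p - 1) \<otimes> P = \<one>"
      using Pc prime_gt_0_nat[OF p] nat_pow_Suc[of P "p - 1"] by simp
    then have "inv P = P [^] (p - 1)" using Pc inv_equality[of "P [^] (p - 1)" P] by simp
    moreover have "(P [^] (p - 1)) [^] p = \<one>"
    proof -
      have "(P [^] (p - 1)) [^] p = (P [^] p) [^] (p - 1)"
        by (simp only: nat_pow_pow[OF Pc(1)] mult.commute)
      then show ?thesis using Pc(3) by simp
    qed
    ultimately show "inv P \<in> ?W" using pow_AE[OF Pc(2), of "p - 1"] by (simp add: pow_torsion_AE)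
  next
    fix P Q assume "P \<in> ?W" "Q \<in> ?W"
    then show "P \<otimes> Q \<in> ?W"
      using AE_proj(2) gal_on_mult(1) by (auto simp: pow_torsion_AE nat_pow_distrib)
  qed
  interpret S: Group.group "A\<lparr>carrier := ?W\<rparr>" by (rule subgroup_imp_group[OF sub])
  have "P = \<one>" if P: "P \<in> ?W" for P
  proof -
    have Pc: "P \<in> carrier A" "P [^] p = \<one>" using P AE_proj(2) by (auto simp: pow_torsion_AE)
    have "P [^] card ?W = \<one>"
      using S.pow_order_eq_1[of P] P nat_pow_consistent[of P "card ?W" ?W] by (simp add: Coset.order_def)
    moreover have "P [^] (p * (card ?W div p) + 1) = P"
      using Pc by (simp add: nat_pow_mult[symmetric] nat_pow_pow[symmetric])
    ultimately show ?thesis using cW by metis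
  qed
  then show ?thesis using oneW by blast
qed

text \<open>Factors p are peeled off one at a time: what remains is a point over E killed by p,
  hence trivial by \<open>triv\<close>.\<close>

lemma remove_p_part:
  assumes triv: "rational_points E (torsion_of p A) = {\<one>}" and P: "P \<in> AE" "P [^] (p ^ a * m) = \<one>"
  shows "P [^] m = \<one>"
  using P(2)
proof (induction a)
  case (Suc a)
  have Pc: "P \<in> carrier A" using P(1) AE_proj(2) by blast
  have "(P [^] (p ^ a * m)) [^] p = \<one>"
    using Suc.prems Pc by (simp add: nat_pow_pow mult_ac)
  then have "P [^] (p ^ a * m) \<in> {\<one>}"
    unfolding triv[symmetric] using pow_AE[OF P(1)] by (simp add: pow_torsion_AE)
  then show ?case using Suc.IH by simp
qed simp

end

theorem theorem3p13:
  fixes p g :: nat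
    and A :: "('n::finite, 'k::field_char_0 alg_closure) pt monoid"
    and D :: "('n, 'k alg_closure) divisor"
    and e :: "nat \<Rightarrow> nat \<Rightarrow> ('n, 'k alg_closure) pt"
    and Kinf :: "'k alg_closure set"
  defines "K \<equiv> range (to_ac :: 'k \<Rightarrow> 'k alg_closure)"
  assumes "prime p" and "odd p"
    and "number_field TYPE('k)"
    and "abelian_variety K A" and "has_dimension (carrier A) g"
    and "polarization K A D" and "symplectic_basis A D g e"
    and "has_big_image K A g e"
    and "galois_extension Kinf K"
    and "pro_p_group p (gal_group Kinf K) (krull_topology Kinf K)"
    and "rational_points K (torsion_of p A) = {\<one>\<^bsub>A\<^esub>}"
  shows "finite (rational_points Kinf (torsion A))"
proof -
  have gal: "galois_extension Kinf K" and pro: "pro_p_group p (gal_group Kinf K) (krull_topology Kinf K)"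
    and p: "prime p" by fact+
  have "sfield Kinf" "sfield K" "K \<subseteq> Kinf"
    using gal subfield_imp_sfield by (auto simp: galois_extension_def)
  then interpret galois_points K A Kinf
    using \<open>abelian_variety K A\<close> by (intro galois_points.intro galois_points_axioms.intro)
  have T: "tate_basis A e (2 * g)"
  proof (intro tate_basis.intro tate_basis_axioms.intro)
    show "comm_group A" by (rule comm_group_axioms)
    show "(\<lambda>x. x [^]\<^bsub>A\<^esub> m) ` carrier A = carrier A" if "1 \<le> m" for m :: nat
      \<comment> \<open>In characteristic zero a positive m is nonzero in the field.\<close>
      using that by (intro pow_surj) simp
    show "is_basis (tate_module A) (2 * g) e"
      using \<open>symplectic_basis A D g e\<close> by (simp add: symplectic_basis_def)
  qed
  interpret tate_basis A e "2 * g" by (rule T)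
  have p1: "1 \<le> p" using prime_gt_0_nat[OF p] by simp
  have triv: "rational_points Kinf (torsion_of p A) = {\<one>\<^bsub>A\<^esub>}"
    by (rule p_torsion_trivial[OF gal pro p finite_torsion_of[OF p1]]) fact
  have "\<exists>\<sigma>\<in>Gal UNIV K. \<exists>n::nat. 0 < n \<and> (\<forall>m\<ge>1. \<forall>i<g. gal_pt \<sigma> (e i m) = e i m \<and>
      gal_pt \<sigma> (e (i + g) m) = e (i + g) m \<otimes>\<^bsub>A\<^esub> e i m [^]\<^bsub>A\<^esub> int n)"
    by (rule big_image_transvections(1)[OF T gal_pt_hom \<open>has_big_image K A g e\<close>])
  then obtain \<sigma> n where \<sigma>: "\<sigma> \<in> Gal UNIV K" "0 < n \<and> (\<forall>m\<ge>1. \<forall>i<g. gal_pt \<sigma> (e i m) = e i m \<and>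
      gal_pt \<sigma> (e (i + g) m) = e (i + g) m \<otimes>\<^bsub>A\<^esub> e i m [^]\<^bsub>A\<^esub> int n)" by (elim bexE exE)
  have "\<exists>\<sigma>\<in>Gal UNIV K. \<exists>n::nat. 0 < n \<and> (\<forall>m\<ge>1. \<forall>i<g. gal_pt \<sigma> (e (i + g) m) = e (i + g) m \<and>
      gal_pt \<sigma> (e i m) = e i m \<otimes>\<^bsub>A\<^esub> e (i + g) m [^]\<^bsub>A\<^esub> int n)"
    by (rule big_image_transvections(2)[OF T gal_pt_hom \<open>has_big_image K A g e\<close>])
  then obtain \<sigma>' n' where \<sigma>': "\<sigma>' \<in> Gal UNIV K" "0 < n' \<and> (\<forall>m\<ge>1. \<forall>i<g. gal_pt \<sigma>' (e (i + g) m) = e (i + g) m \<and>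
      gal_pt \<sigma>' (e i m) = e i m \<otimes>\<^bsub>A\<^esub> e (i + g) m [^]\<^bsub>A\<^esub> int n')" by (elim bexE exE)
  \<comment> \<open>The numbers n and n' come from the two Galois elements alone, so a single finite
    torsion group contains all torsion over \<open>Kinf\<close>.\<close>
  have "P \<in> torsion_of (n * n') A" if P: "P \<in> rational_points Kinf (torsion A)" for P
  proof -
    have PAE: "P \<in> AE" using P by (auto simp: rational_points_def torsion_def torsion_of_def)
    have "P \<in> torsion A" using P by (simp add: rational_points_def)
    then obtain m0 where "m0 \<in> {1..}" "P \<in> torsion_of m0 A" unfolding torsion_def by (rule UN_E)
    then have m0: "1 \<le> m0" "P [^]\<^bsub>A\<^esub> m0 = \<one>\<^bsub>A\<^esub>" by (simp_all add: torsion_of_def)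
    have Pc: "P \<in> carrier A" using AE_proj(2)[OF PAE] .
    have "m0 \<noteq> 0" "\<not> is_unit p" using m0(1) p by auto
    \<comment> \<open>The exponent m0 is split into a power of p, which \<open>triv\<close> removes,
      and a factor m modulo which p is invertible.\<close>
    from multiplicity_decompose'[OF this] obtain m where m: "m0 = p ^ multiplicity p m0 * m" "\<not> p dvd m" .
    have m1: "1 \<le> m" using m(2) by (cases m) auto
    have Pm: "P [^]\<^bsub>A\<^esub> m = \<one>\<^bsub>A\<^esub>"
      by (rule remove_p_part[OF triv PAE, of "multiplicity p m0"]) (simp only: m(1)[symmetric] m0(2))
    let ?W = "rational_points Kinf (torsion_of m A)"
    have PW: "P \<in> ?W" using PAE Pm by (simp add: pow_torsion_AE)
    have W: "finite ?W" "?W \<subseteq> AE"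
      using finite_subset[OF _ finite_torsion_of[OF m1], of ?W] by (auto simp: rational_points_def torsion_of_def)
    from pro_p_action(1)[OF pro p W gal_on_torsion]
    obtain k where k: "\<forall>\<tau>\<in>Gal Kinf K. \<forall>P\<in>?W. (gal_on Kinf \<tau> ^^ (p ^ k)) P = P" ..
    have fixed: "(gal_pt \<rho> ^^ (p ^ k)) P = P" if \<rho>: "\<rho> \<in> Gal UNIV K" for \<rho>
    proof -
      note r = Gal_restrict[OF gal \<rho>]
      \<comment> \<open>Only the restriction of \<rho> to \<open>Kinf\<close> belongs to the pro-p
        group. It has the same iterates on P as \<rho>, because these stay rational over
        \<open>Kinf\<close>.\<close>
      have "(gal_pt \<rho> ^^ l) P = (gal_on Kinf (restrict \<rho> Kinf) ^^ l) P \<and> (gal_pt \<rho> ^^ l) P \<in> AE" for l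
      proof (induction l)
        case (Suc l)
        note 1 = conjunct1[OF Suc.IH] and 2 = conjunct2[OF Suc.IH]
        show ?case
          unfolding funpow.simps o_apply gal_pt_restrict[OF \<rho> r 2]
          using gal_on_closed[OF 2 r] by (simp only: 1[symmetric] simp_thms)
      qed (use PAE in simp)
      then show ?thesis using k r PW by simp
    qed
    have cop: "coprime (p ^ k) m" using m(2) p by (simp add: prime_imp_coprime)
    have "P [^]\<^bsub>A\<^esub> (n * n') = \<one>\<^bsub>A\<^esub>"
      by (rule two_transvections[OF refl m1 gal_pt_hom[OF \<sigma>(1)] gal_pt_hom[OF \<sigma>'(1)] _ _ _ _ _ fixed[OF \<sigma>(1)] fixed[OF \<sigma>'(1)] cop])
         (use \<sigma>(2) \<sigma>'(2) m1 Pc Pm in \<open>auto simp: torsion_of_def\<close>)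
    then show ?thesis using Pc by (simp add: torsion_of_def)
  qed
  then have "rational_points Kinf (torsion A) \<subseteq> torsion_of (n * n') A" by blast
  moreover have "1 \<le> n * n'" using \<sigma>(2) \<sigma>'(2) by (simp add: Suc_le_eq)
  ultimately show ?thesis using finite_torsion_of finite_subset by blast
qed

end
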